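(* Let $V$ be a short representation of the symmetric group $\mathfrak{S}_n$ and let $\varphi:\mathbb{R}^n\to\mathrm{Sym}_2(V)$ be an $\mathfrak{S}_n$-linear map. Let $S\subset\mathbb{R}^n$ be the preimage under $\varphi$ of the cone of positive semidefinite elements of $\mathrm{Sym}_2(V)$. Then $$\Lambda(S)=\{A\in\mathrm{Sym}_2(\mathbb{R}^n):\ \lambda(A)\in S\}$$ is a spectrahedral cone in $\mathrm{Sym}_2(\mathbb{R}^n)$.
   Context: Representations are finite-dimensional and real. Irreducible representations of $\mathfrak{S}_n$ correspond bijectively to partitions of $n$; the one corresponding to $\lambda$ is denoted $V_\lambda$ (with $V_{(n)}$ trivial and $V_{(n-1,1)}$ the standard representation). A representation of $\mathfrak{S}_n$ is called short if all its irreducible constituents correspond to partitions with at most $2$ parts. $\mathfrak{S}_n$ acts on $\mathbb{R}^n$ by permuting coordinates. $V$ carries an $\mathfrak{S}_n$-invariant scalar product, which is used to identify $V$ with its dual; $\mathrm{Sym}_2(V)$ is the space of symmetric tensors in $V\otimes V$, identified with symmetric bilinear forms on $V$ (equivalently self-adjoint endomorphisms), with the induced action. $\mathrm{Sym}_2(\mathbb{R}^n)$ is the space of real symmetric $n\times n$ matrices. $\lambda(A)$ is the vector of eigenvalues (with multiplicity) of the symmetric matrix $A$; the order does not matter since $S$ is invariant under permutations of coordinates. A spectrahedral cone in a finite-dimensional real vector space $U$ is the preimage of the cone of positive semidefinite $N\times N$ real symmetric matrices under a linear map from $U$ to the space of real symmetric $N\times N$ matrices, for some $N$. *)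

theory Defs
  imports "HOL-Analysis.Analysis"
begin

text \<open>
  The symmetric group on \<open>n\<close> letters is the group of permutations of a finite index type
  \<open>'n\<close> with \<open>CARD('n) = n\<close>. Representation spaces are subspaces of Euclidean spaces, so the
  zero representation is included; all conditions on maps are imposed only on the subspace.
\<close>

abbreviation perms :: "('n::finite \<Rightarrow> 'n) set" where
  "perms \<equiv> {\<sigma>. \<sigma> permutes UNIV}"

definition linear_on :: "'a::real_vector set \<Rightarrow> ('a \<Rightarrow> 'b::real_vector) \<Rightarrow> bool" where
  "linear_on U f \<longleftrightarrow>
     (\<forall>x\<in>U. \<forall>y\<in>U. f (x + y) = f x + f y) \<and> (\<forall>c. \<forall>x\<in>U. f (c *\<^sub>R x) = c *\<^sub>R f x)"


subsection \<open>Representations of the symmetric group\<close>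

definition symmetric_group_rep ::
    "(('n::finite \<Rightarrow> 'n) \<Rightarrow> 'v \<Rightarrow> 'v) \<Rightarrow> 'v::euclidean_space set \<Rightarrow> bool" where
  "symmetric_group_rep \<rho> V \<longleftrightarrow>
     subspace V \<and>
     (\<forall>\<sigma>\<in>perms. linear_on V (\<rho> \<sigma>) \<and> \<rho> \<sigma> ` V \<subseteq> V) \<and>
     (\<forall>v\<in>V. \<rho> id v = v) \<and>
     (\<forall>\<sigma>\<in>perms. \<forall>\<tau>\<in>perms. \<forall>v\<in>V. \<rho> (\<sigma> \<circ> \<tau>) v = \<rho> \<sigma> (\<rho> \<tau> v))"

definition invariant_inner ::
    "(('n::finite \<Rightarrow> 'n) \<Rightarrow> 'v \<Rightarrow> 'v) \<Rightarrow> 'v::euclidean_space set \<Rightarrow> bool" where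
  "invariant_inner \<rho> V \<longleftrightarrow>
     (\<forall>\<sigma>\<in>perms. \<forall>u\<in>V. \<forall>v\<in>V. \<rho> \<sigma> u \<bullet> \<rho> \<sigma> v = u \<bullet> v)"

definition subrepresentation ::
    "(('n::finite \<Rightarrow> 'n) \<Rightarrow> 'v \<Rightarrow> 'v) \<Rightarrow> 'v::euclidean_space set \<Rightarrow> 'v set \<Rightarrow> bool" where
  "subrepresentation \<rho> V W \<longleftrightarrow>
     subspace W \<and> W \<subseteq> V \<and> (\<forall>\<sigma>\<in>perms. \<rho> \<sigma> ` W \<subseteq> W)"

definition irreducible_rep ::
    "(('n::finite \<Rightarrow> 'n) \<Rightarrow> 'v \<Rightarrow> 'v) \<Rightarrow> 'v::euclidean_space set \<Rightarrow> bool" where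
  "irreducible_rep \<rho> W \<longleftrightarrow>
     symmetric_group_rep \<rho> W \<and> W \<noteq> {0} \<and>
     (\<forall>W'. subrepresentation \<rho> W W' \<longrightarrow> W' = {0} \<or> W' = W)"

definition isomorphic_reps ::
    "(('n::finite \<Rightarrow> 'n) \<Rightarrow> 'v \<Rightarrow> 'v) \<Rightarrow> 'v::euclidean_space set \<Rightarrow>
     (('n \<Rightarrow> 'n) \<Rightarrow> 'w \<Rightarrow> 'w) \<Rightarrow> 'w::euclidean_space set \<Rightarrow> bool" where
  "isomorphic_reps \<rho> V \<rho>' W \<longleftrightarrow>
     (\<exists>f. linear_on V f \<and> bij_betw f V W \<and>
          (\<forall>\<sigma>\<in>perms. \<forall>v\<in>V. f (\<rho> \<sigma> v) = \<rho>' \<sigma> (f v)))"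


subsection \<open>The irreducible representations attached to partitions\<close>

definition is_partition :: "nat \<Rightarrow> nat list \<Rightarrow> bool" where
  "is_partition n \<mu> \<longleftrightarrow> sorted_wrt (\<ge>) \<mu> \<and> 0 \<notin> set \<mu> \<and> sum_list \<mu> = n"

definition young_diagram :: "nat list \<Rightarrow> (nat \<times> nat) set" where
  "young_diagram \<mu> = {(i, j). i < length \<mu> \<and> j < \<mu> ! i}"

definition tableau :: "nat list \<Rightarrow> (nat \<times> nat \<Rightarrow> 'n::finite) \<Rightarrow> bool" where
  "tableau \<mu> T \<longleftrightarrow> bij_betw T (young_diagram \<mu>) UNIV"

definition row_stabilizer ::
    "nat list \<Rightarrow> (nat \<times> nat \<Rightarrow> 'n::finite) \<Rightarrow> ('n \<Rightarrow> 'n) set" where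
  "row_stabilizer \<mu> T =
     {p\<in>perms. \<forall>i. p ` (T ` {c\<in>young_diagram \<mu>. fst c = i}) = T ` {c\<in>young_diagram \<mu>. fst c = i}}"

definition column_stabilizer ::
    "nat list \<Rightarrow> (nat \<times> nat \<Rightarrow> 'n::finite) \<Rightarrow> ('n \<Rightarrow> 'n) set" where
  "column_stabilizer \<mu> T =
     {q\<in>perms. \<forall>j. q ` (T ` {c\<in>young_diagram \<mu>. snd c = j}) = T ` {c\<in>young_diagram \<mu>. snd c = j}}"

text \<open>
  The real group algebra is the span of the vectors \<open>axis \<sigma> 1\<close>, for \<open>\<sigma>\<close> a permutation, in
  \<open>real ^ ('n \<Rightarrow> 'n)\<close>. The map below is left multiplication by \<open>\<sigma>\<close>: it sends \<open>axis \<tau> 1\<close> to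
  \<open>axis (\<sigma> \<circ> \<tau>) 1\<close>.
\<close>

definition left_mult ::
    "('n::finite \<Rightarrow> 'n) \<Rightarrow> real ^ ('n \<Rightarrow> 'n) \<Rightarrow> real ^ ('n \<Rightarrow> 'n)" where
  "left_mult \<sigma> x = (\<chi> \<tau>. x $ (inv \<sigma> \<circ> \<tau>))"

text \<open>
  The Specht module: the left ideal of the group algebra generated by the Young symmetrizer
  \<open>(\<Sum>q. sign q \<cdot> q) \<cdot> (\<Sum>p. p)\<close>, with \<open>q\<close> in the column and \<open>p\<close> in the row stabilizer of \<open>T\<close>.
  If a tabloid is identified with the sum over the corresponding left coset of the row
  stabilizer, the spanning vectors are the polytabloids. Up to isomorphism the module depends
  only on the shape. The shape \<open>[n]\<close> gives the trivial representation, and \<open>[n - 1, 1]\<close> the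
  standard one.
\<close>

definition specht_module ::
    "nat list \<Rightarrow> (nat \<times> nat \<Rightarrow> 'n::finite) \<Rightarrow> (real ^ ('n \<Rightarrow> 'n)) set" where
  "specht_module \<mu> T =
     span ((\<lambda>\<sigma>. \<Sum>q\<in>column_stabilizer \<mu> T. \<Sum>p\<in>row_stabilizer \<mu> T.
                  of_int (sign q) *\<^sub>R axis (\<sigma> \<circ> q \<circ> p) 1) ` perms)"

definition corresponds_to ::
    "(('n::finite \<Rightarrow> 'n) \<Rightarrow> 'v \<Rightarrow> 'v) \<Rightarrow> 'v::euclidean_space set \<Rightarrow> nat list \<Rightarrow> bool" where
  "corresponds_to \<rho> W \<mu> \<longleftrightarrow>
     (\<exists>T :: nat \<times> nat \<Rightarrow> 'n. tableau \<mu> T \<and> isomorphic_reps \<rho> W left_mult (specht_module \<mu> T))"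

text \<open>
  By complete reducibility, the irreducible constituents are the irreducible
  subrepresentations.
\<close>

definition short :: "(('n::finite \<Rightarrow> 'n) \<Rightarrow> 'v \<Rightarrow> 'v) \<Rightarrow> 'v::euclidean_space set \<Rightarrow> bool" where
  "short \<rho> V \<longleftrightarrow>
     (\<forall>W. subrepresentation \<rho> V W \<and> irreducible_rep \<rho> W \<longrightarrow>
        (\<exists>\<mu>. is_partition CARD('n) \<mu> \<and> length \<mu> \<le> 2 \<and> corresponds_to \<rho> W \<mu>))"


subsection \<open>Equivariant maps into symmetric tensors\<close>

definition permute_coords :: "('n::finite \<Rightarrow> 'n) \<Rightarrow> real ^ 'n \<Rightarrow> real ^ 'n" where
  "permute_coords \<sigma> x = (\<chi> i. x $ inv \<sigma> i)"

text \<open>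
  Symmetric tensors are identified with self-adjoint endomorphisms through the scalar product;
  the induced action is conjugation. Endomorphisms of \<open>V\<close> are compared only on \<open>V\<close>.
\<close>

definition Sym2 :: "'v::euclidean_space set \<Rightarrow> ('v \<Rightarrow> 'v) set" where
  "Sym2 V = {f. linear_on V f \<and> f ` V \<subseteq> V \<and> (\<forall>u\<in>V. \<forall>v\<in>V. f u \<bullet> v = u \<bullet> f v)}"

definition equivariant_linear_Sym2 ::
    "(('n::finite \<Rightarrow> 'n) \<Rightarrow> 'v \<Rightarrow> 'v) \<Rightarrow> 'v::euclidean_space set \<Rightarrow>
     (real ^ 'n \<Rightarrow> 'v \<Rightarrow> 'v) \<Rightarrow> bool" where
  "equivariant_linear_Sym2 \<rho> V \<phi> \<longleftrightarrow>
     range \<phi> \<subseteq> Sym2 V \<and>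
     (\<forall>v\<in>V. linear (\<lambda>x. \<phi> x v)) \<and>
     (\<forall>\<sigma>\<in>perms. \<forall>x. \<forall>v\<in>V. \<phi> (permute_coords \<sigma> x) v = \<rho> \<sigma> (\<phi> x (\<rho> (inv \<sigma>) v)))"

definition psd_on :: "'v::euclidean_space set \<Rightarrow> ('v \<Rightarrow> 'v) \<Rightarrow> bool" where
  "psd_on V f \<longleftrightarrow> (\<forall>v\<in>V. 0 \<le> f v \<bullet> v)"


subsection \<open>Spectral sets and spectrahedral cones\<close>

definition symmetric_matrices :: "(real ^ 'n ^ 'n) set" where
  "symmetric_matrices = {A. transpose A = A}"

text \<open>The entries of \<open>x\<close> are the eigenvalues of \<open>A\<close> with multiplicity, in some order.\<close>

definition eigenvalue_vector :: "real ^ 'n ^ 'n \<Rightarrow> real ^ 'n::finite \<Rightarrow> bool" where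
  "eigenvalue_vector A x \<longleftrightarrow> (\<forall>t. det (t *\<^sub>R mat 1 - A) = (\<Prod>i\<in>UNIV. t - x $ i))"

text \<open>For permutation-invariant \<open>S\<close> the choice of the ordering is immaterial.\<close>

definition spectral_set :: "(real ^ 'n::finite) set \<Rightarrow> (real ^ 'n ^ 'n) set" where
  "spectral_set S = {A\<in>symmetric_matrices. \<exists>x. eigenvalue_vector A x \<and> x \<in> S}"

text \<open>
  Since the size \<open>N\<close> is quantified, \<open>N \<times> N\<close> matrices are functions of two natural-number
  indices, of which only the entries with indices below \<open>N\<close> matter.
\<close>

definition psd_matrix :: "nat \<Rightarrow> (nat \<Rightarrow> nat \<Rightarrow> real) \<Rightarrow> bool" where
  "psd_matrix N M \<longleftrightarrow>
     (\<forall>i<N. \<forall>j<N. M i j = M j i) \<and>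
     (\<forall>v :: nat \<Rightarrow> real. 0 \<le> (\<Sum>i<N. \<Sum>j<N. v i * M i j * v j))"

definition spectrahedral_cone_in :: "'a::euclidean_space set \<Rightarrow> 'a set \<Rightarrow> bool" where
  "spectrahedral_cone_in U C \<longleftrightarrow>
     (\<exists>(N::nat) (L :: 'a \<Rightarrow> nat \<Rightarrow> nat \<Rightarrow> real).
        (\<forall>i<N. \<forall>j<N. linear_on U (\<lambda>A. L A i j)) \<and>
        (\<forall>A\<in>U. \<forall>i<N. \<forall>j<N. L A i j = L A j i) \<and>
        C = {A\<in>U. psd_matrix N (L A)})"

end

theory Submission
  imports Defs
begin

text \<open>
  Shortness means that \<open>V\<close> is spanned by vectors fixed by Young subgroups with two blocks. Hence
  \<open>\<phi> x\<close> is governed by finitely many permutation-invariant forms, linear in \<open>x\<close>, on the functions on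
  subsets of the index set, that is, on the tensor power \<open>\<real>\<^sup>2 \<otimes> \<dots> \<otimes> \<real>\<^sup>2\<close>. This space is the part of
  the fermionic Fock space \<open>\<Lambda>(\<real>\<^sup>n \<otimes> \<real>\<^sup>2)\<close> in which every site carries an even number of particles,
  and the action of \<open>gl\<^sub>2\<close> on each site extends to quadratic expressions in the fermions.
  Since \<open>\<Sum>i. x i * X i\<close> extends to \<open>\<Sum>i j. A i j * X i j\<close>, which is covariant under orthogonal changes of
  basis, and the invariant forms are generated by such expressions and the total action of \<open>gl\<^sub>2\<close>,
  every invariant form extends to a form on the even Fock space that depends linearly on a symmetric matrix.
  For a diagonal matrix the Fock space splits according to the set of sites with an odd number of
  particles. These sites are inert, and replacing them by a product of singlets
  identifies each summand with a compression of the original form. So the extended form at \<open>A\<close> is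
  positive semidefinite iff \<open>\<phi>\<close> is so at the eigenvalues of \<open>A\<close>.
\<close>

subsection \<open>Fermionic operators and reflections\<close>

text \<open>A symmetric matrix is turned by orthogonal matrices, but on the tensor power of
  \<real>^2 only the permutations among them act naturally. Fock space supplies the missing action
  at the price of extra states, and the difficulty is to control these. Only reflections are ever
  used: for them the exterior power is the polynomial \<open>fock_reflection v\<close> in the
  fermions, and they suffice to diagonalise. Linearity in the matrix is the second constraint, since
  an invariant form may involve many sites. Hence one factor alone carries the coefficients; the
  others arise from total operators, which are taken at the identity matrix and so commute with
  every reflection. On the extra states, a singly occupied site sees a 2 by 2 matrix only through
  half of its trace. A singlet reproduces this exactly for total operators, but for an operator on
  one inert site only in expectation; this is why forms rather than operators are lifted. An odd
  number of inert sites admits no singlet; those states are projected out, which is compatible with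
  reflections because they preserve parity.\<close>

text \<open>Annihilation operators on the exterior algebra, in the Jordan--Wigner form: the sign counts the
  occupied positions before \<open>i\<close> in the order given by \<^const>\<open>to_nat\<close>.\<close>

definition jw_sign :: "'n::finite \<Rightarrow> 'n set \<Rightarrow> real" where
  "jw_sign i K = (-1) ^ card {j\<in>K. to_nat j < to_nat i}"

definition ann :: "'n::finite \<Rightarrow> real ^ 'n set ^ 'n set" where
  "ann i = (\<chi> I K. if i \<notin> I \<and> K = insert i I then jw_sign i I else 0)"

lemma jw_sign_square [simp]: "jw_sign i K * jw_sign i K = 1"
  by (simp add: jw_sign_def flip: power_add mult_2)

lemma jw_sign_square_left [simp]: "jw_sign i K * (jw_sign i K * c) = c"
  by (simp flip: mult.assoc)

lemma jw_sign_self [simp]: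
  "jw_sign i (insert i K) = jw_sign i K" "jw_sign i (K - {i}) = jw_sign i K"
proof -
  have "{j \<in> insert i K. to_nat j < to_nat i} = {j\<in>K. to_nat j < to_nat i}"
    "{j \<in> K - {i}. to_nat j < to_nat i} = {j\<in>K. to_nat j < to_nat i}" by auto
  then show "jw_sign i (insert i K) = jw_sign i K" "jw_sign i (K - {i}) = jw_sign i K"
    unfolding jw_sign_def by presburger+
qed

text \<open>All signs in the anticommutation relations come from here: of two distinct sites exactly
  one precedes the other, so exactly one of their two signs flips when the other site gets
  occupied.\<close>

lemma jw_sign_insert:
  assumes "i \<notin> K"
  shows "jw_sign j (insert i K) = (if to_nat i < to_nat j then - jw_sign j K else jw_sign j K)"
proof -
  have "{l \<in> insert i K. to_nat l < to_nat j} =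
    (if to_nat i < to_nat j then insert i {l \<in> K. to_nat l < to_nat j} else {l \<in> K. to_nat l < to_nat j})"
    by auto
  with assms show ?thesis by (simp add: jw_sign_def)
qed

lemma ann_mult:
  "(ann i ** w) $ I $ K = (if i \<notin> I then jw_sign i I * w $ insert i I $ K else 0)"
  by (simp add: matrix_matrix_mult_def ann_def if_distrib if_distribR cong: if_cong)

lemma mult_ann:
  "(w ** ann i) $ I $ K = (if i \<in> K then jw_sign i K * w $ I $ (K - {i}) else 0)"
proof -
  have "(w ** ann i) $ I $ K = (\<Sum>L\<in>UNIV. w $ I $ L * (if i \<notin> L \<and> K = insert i L then jw_sign i L else 0))"
    by (simp add: matrix_matrix_mult_def ann_def)
  also have "\<dots> = (\<Sum>L\<in>UNIV. if L = K - {i} then (if i \<in> K then jw_sign i K * w $ I $ (K - {i}) else 0) else 0)"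
    by (intro sum.cong) (auto simp: insert_absorb)
  finally show ?thesis by simp
qed

lemma mult_transpose_ann:
  "(w ** transpose (ann i)) $ I $ K = (if i \<notin> K then jw_sign i K * w $ I $ insert i K else 0)"
  by (simp add: matrix_matrix_mult_def ann_def transpose_def if_distrib if_distribR cong: if_cong)

lemma transpose_ann_mult:
  "(transpose (ann i) ** w) $ I $ K = (if i \<in> I then jw_sign i I * w $ (I - {i}) $ K else 0)"
proof -
  have "(transpose (ann i) ** w) $ I $ K = (\<Sum>L\<in>UNIV. (if i \<notin> L \<and> I = insert i L then jw_sign i L else 0) * w $ L $ K)"
    by (simp add: matrix_matrix_mult_def ann_def transpose_def)
  also have "\<dots> = (\<Sum>L\<in>UNIV. if L = I - {i} then (if i \<in> I then jw_sign i I * w $ (I - {i}) $ K else 0) else 0)"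
    by (intro sum.cong) (auto simp: insert_absorb)
  finally show ?thesis by simp
qed

lemma ann_nth: "ann i $ I $ K = (if i \<notin> I \<and> K = insert i I then jw_sign i I else 0)"
  by (simp add: ann_def)

lemma transpose_nth: "transpose A $ I $ K = A $ K $ I"
  by (simp add: transpose_def)

section \<open>Canonical anticommutation relations\<close>

lemma ann_anticommute: "ann i ** ann j = - (ann j ** ann i)"
proof (cases "i = j")
  case True
  then show ?thesis by (simp add: vec_eq_iff ann_mult ann_nth)
next
  case False
  then have "to_nat i \<noteq> to_nat j" by simp
  with False show ?thesis
    by (auto simp: vec_eq_iff ann_mult ann_nth jw_sign_insert insert_commute)
qed

lemma ann_transpose_anticommute:
  "ann i ** transpose (ann j) = (if i = j then mat 1 else 0) - transpose (ann j) ** ann i"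
proof (cases "i = j")
  case True
  have "(ann j ** transpose (ann j)) $ I $ K + (transpose (ann j) ** ann j) $ I $ K = (if I = K then 1 else 0)"
    for I K
  proof (cases "I = K")
    case True
    then show ?thesis
      by (auto simp: ann_mult transpose_ann_mult ann_nth transpose_nth insert_absorb)
  next
    case False
    then have "j \<notin> I \<Longrightarrow> j \<notin> K \<Longrightarrow> insert j I \<noteq> insert j K" "j \<in> I \<Longrightarrow> K \<noteq> insert j (I - {j})"
      by (auto simp: insert_absorb)
    with False show ?thesis
      by (auto simp: ann_mult transpose_ann_mult ann_nth transpose_nth)
  qed
  with True show ?thesis by (simp add: vec_eq_iff mat_def eq_diff_eq)
next
  case False
  then have ne: "to_nat i \<noteq> to_nat j" by simp
  have "(ann i ** transpose (ann j)) $ I $ K = (- (transpose (ann j) ** ann i)) $ I $ K" for I K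
  \<comment> \<open>Both products have a nonzero entry at \<open>I\<close>, \<open>K\<close> only if
    \<open>K\<close> is \<open>I\<close> with \<open>j\<close> replaced by \<open>i\<close>;
    \<open>M\<close> is the common part.\<close>
  proof (cases "i \<notin> I \<and> j \<in> I \<and> K = insert i (I - {j})")
    case True
    then obtain M where M: "I = insert j M" "j \<notin> M" "i \<notin> M" "K = insert i M"
      by (metis Diff_iff insertCI insert_Diff)
    have "insert i (insert j M) = insert j (insert i M)" "insert j M - {j} = M" using M by auto
    then show ?thesis using M False ne
      by (auto simp: ann_mult transpose_ann_mult ann_nth transpose_nth jw_sign_insert)
  next
    case c: False
    have 1: "\<not> (i \<notin> I \<and> j \<notin> K \<and> insert i I = insert j K)" using c False by auto
    have 2: "\<not> (j \<in> I \<and> i \<notin> I - {j} \<and> K = insert i (I - {j}))" using c False by auto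
    have "(ann i ** transpose (ann j)) $ I $ K = 0"
      using 1 by (cases "i \<in> I"; cases "j \<in> K") (simp_all add: ann_mult ann_nth transpose_nth)
    moreover have "(transpose (ann j) ** ann i) $ I $ K = 0"
      using 2 False by (cases "j \<in> I"; cases "i \<in> I - {j}") (simp_all add: transpose_ann_mult ann_nth)
    ultimately show ?thesis by simp
  qed
  then have "ann i ** transpose (ann j) = - (transpose (ann j) ** ann i)"
    unfolding vec_eq_iff by blast
  with False show ?thesis by simp
qed

section \<open>Reflections of \<real>^n and their exterior powers\<close>

definition annv :: "real ^ 'n::finite \<Rightarrow> real ^ 'n set ^ 'n set" where
  "annv v = (\<Sum>j\<in>UNIV. v $ j *\<^sub>R ann j)"

text \<open>For a unit vector \<open>v\<close> this is the exterior power of the reflection along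
  \<open>v\<close>: it is -1 on states in which the mode \<open>v\<close> is occupied and 1 on those
  in which it is empty.\<close>

definition fock_reflection :: "real ^ 'n::finite \<Rightarrow> real ^ 'n set ^ 'n set" where
  "fock_reflection v = mat 1 - 2 *\<^sub>R (transpose (annv v) ** annv v)"

definition householder :: "real ^ 'n::finite \<Rightarrow> real ^ 'n ^ 'n" where
  "householder v = (\<chi> i j. (if i = j then 1 else 0) - 2 * v $ i * v $ j)"

lemma matrix_mult_sum_left: "(\<Sum>j\<in>S. f j) ** (w :: real ^ 'a ^ 'b::finite) = (\<Sum>j\<in>S. f j ** w)"
  for f :: "_ \<Rightarrow> real ^ 'b ^ 'c"
  by (simp add: vec_eq_iff matrix_matrix_mult_def sum_distrib_right) (subst sum.swap, simp)

lemma matrix_mult_sum_right: "(w :: real ^ 'b::finite ^ 'c) ** (\<Sum>j\<in>S. f j) = (\<Sum>j\<in>S. w ** f j)"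
  for f :: "_ \<Rightarrow> real ^ 'a ^ 'b"
  by (simp add: vec_eq_iff matrix_matrix_mult_def sum_distrib_left) (subst sum.swap, simp)

lemma matrix_diff_ldistrib: "(A :: real ^ 'b::finite ^ 'c) ** (B - C) = A ** B - A ** C"
  for B :: "real ^ 'a ^ 'b"
  by (simp add: vec_eq_iff matrix_matrix_mult_def right_diff_distrib sum_subtractf)

lemma matrix_diff_rdistrib: "(B - C) ** (A :: real ^ 'a ^ 'b::finite) = B ** A - C ** A"
  for B :: "real ^ 'b ^ 'c"
  by (simp add: vec_eq_iff matrix_matrix_mult_def left_diff_distrib sum_subtractf)

lemma matrix_minus_left: "(- B) ** (A :: real ^ 'a ^ 'b::finite) = - (B ** A)"
  for B :: "real ^ 'b ^ 'c"
  by (simp add: vec_eq_iff matrix_matrix_mult_def sum_negf)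

lemma matrix_minus_right: "(B :: real ^ 'b::finite ^ 'c) ** (- A) = - (B ** A)"
  for A :: "real ^ 'a ^ 'b"
  by (simp add: vec_eq_iff matrix_matrix_mult_def sum_negf)

lemma transpose_sum: "transpose (\<Sum>j\<in>S. f j) = (\<Sum>j\<in>S. transpose (f j :: real ^ 'a ^ 'b))"
  by (simp add: vec_eq_iff transpose_def)

lemma transpose_diff: "transpose (A - B :: real ^ 'a ^ 'b) = transpose A - transpose B"
  by (simp add: vec_eq_iff transpose_def)

lemma matrix_add_rdistrib: "(B + C) ** (A :: real ^ 'a ^ 'b::finite) = B ** A + C ** A"
  for B :: "real ^ 'b ^ 'c"
  by (simp add: vec_eq_iff matrix_matrix_mult_def distrib_right sum.distrib)

lemma matrix_zero: "0 ** (A :: real ^ 'a ^ 'b::finite) = (0 :: real ^ 'a ^ 'c)" "(B :: real ^ 'b::finite ^ 'a) ** (0 :: real ^ 'c ^ 'b) = 0"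
  by (simp_all add: vec_eq_iff matrix_matrix_mult_def)

lemmas matrix_bilinear = matrix_diff_ldistrib matrix_diff_rdistrib matrix_add_ldistrib
  matrix_add_rdistrib matrix_minus_left matrix_minus_right scalar_matrix_assoc[symmetric]
  matrix_scalar_ac matrix_zero

text \<open>The relations make \<open>t ** a\<close> an occupation number, that is, an idempotent
  \<open>n\<close> with \<open>n ** a = 0\<close>; hence \<open>1 - 2 n\<close> is an involution.
  Moving \<open>b\<close> past \<open>n\<close> costs \<open>c *\<^sub>R a\<close>, and the
  conjugation doubles this term.\<close>

lemma fermionic_reflection:
  fixes a t b :: "real ^ 'k::finite ^ 'k"
  assumes aa: "a ** a = 0" and at: "a ** t = mat 1 - t ** a"
    and ba: "b ** a = - (a ** b)" and bt: "b ** t = c *\<^sub>R mat 1 - t ** b"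
  defines "P \<equiv> mat 1 - 2 *\<^sub>R (t ** a)"
  shows "P ** P = mat 1" "P ** b ** P = b - (2 * c) *\<^sub>R a"
proof -
  define n where "n = t ** a"
  have na: "n ** a = 0"
    by (simp add: n_def aa matrix_bilinear flip: matrix_mul_assoc)
  have "n ** n = t ** (a ** t) ** a" by (simp add: n_def matrix_mul_assoc)
  also have "\<dots> = n - t ** (t ** (a ** a))" by (simp add: at n_def matrix_bilinear matrix_mul_assoc)
  finally have nn: "n ** n = n" by (simp add: aa matrix_bilinear)
  have "b ** n = (b ** t) ** a" by (simp add: n_def matrix_mul_assoc)
  also have "\<dots> = c *\<^sub>R a - t ** (b ** a)" by (simp add: bt matrix_bilinear matrix_mul_assoc)
  finally have bn: "b ** n = c *\<^sub>R a + n ** b" by (simp add: ba n_def matrix_bilinear matrix_mul_assoc)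
  show "P ** P = mat 1"
    by (simp add: P_def matrix_bilinear nn vec_eq_iff flip: n_def)
  have "P ** b ** P = b - 2 *\<^sub>R (b ** n) - 2 *\<^sub>R (n ** b) + 4 *\<^sub>R (n ** (b ** n))"
    by (simp add: P_def matrix_bilinear algebra_simps matrix_mul_assoc flip: n_def)
  also have "n ** (b ** n) = n ** b" by (simp add: bn matrix_bilinear na nn matrix_mul_assoc)
  finally show "P ** b ** P = b - (2 * c) *\<^sub>R a"
    by (simp add: bn vec_eq_iff)
qed

lemma annv_mult: "annv v ** w = (\<Sum>j\<in>UNIV. v $ j *\<^sub>R (ann j ** w))"
  by (simp add: annv_def matrix_mult_sum_left matrix_bilinear)

lemma mult_annv: "w ** annv v = (\<Sum>j\<in>UNIV. v $ j *\<^sub>R (w ** ann j))"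
  by (simp add: annv_def matrix_mult_sum_right matrix_bilinear)

lemma ann_annv: "ann j ** annv v = - (annv v ** ann j)"
proof -
  have "ann j ** annv v = (\<Sum>k\<in>UNIV. v $ k *\<^sub>R (ann j ** ann k))"
    by (simp add: annv_def matrix_mult_sum_right matrix_bilinear)
  also have "\<dots> = (\<Sum>k\<in>UNIV. v $ k *\<^sub>R - (ann k ** ann j))"
    by (subst ann_anticommute) simp
  also have "\<dots> = - (annv v ** ann j)"
    by (simp add: annv_def matrix_mult_sum_left matrix_bilinear sum_negf)
  finally show ?thesis .
qed

lemma ann_transpose_annv: "ann j ** transpose (annv v) = v $ j *\<^sub>R mat 1 - transpose (annv v) ** ann j"
proof -
  have "ann j ** transpose (annv v) = (\<Sum>k\<in>UNIV. v $ k *\<^sub>R (ann j ** transpose (ann k)))"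
    by (simp add: annv_def matrix_mult_sum_right matrix_bilinear transpose_sum transpose_scalar)
  also have "\<dots> = (\<Sum>k\<in>UNIV. (if j = k then v $ k *\<^sub>R mat 1 else 0) - v $ k *\<^sub>R (transpose (ann k) ** ann j))"
    by (intro sum.cong refl) (simp add: ann_transpose_anticommute algebra_simps)
  also have "\<dots> = v $ j *\<^sub>R mat 1 - transpose (annv v) ** ann j"
    by (simp add: annv_def matrix_mult_sum_left matrix_bilinear sum_subtractf transpose_sum transpose_scalar)
  finally show ?thesis .
qed

lemma annv_transpose_annv:
  assumes "norm v = 1"
  shows "annv v ** transpose (annv v) = mat 1 - transpose (annv v) ** annv v"
proof -
  have "annv v ** transpose (annv v) = (\<Sum>j\<in>UNIV. v $ j *\<^sub>R (ann j ** transpose (annv v)))"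
    by (rule annv_mult)
  also have "\<dots> = (\<Sum>j\<in>UNIV. v $ j * v $ j) *\<^sub>R mat 1 - (\<Sum>j\<in>UNIV. v $ j *\<^sub>R (transpose (annv v) ** ann j))"
    by (simp add: ann_transpose_annv algebra_simps sum_subtractf scaleR_sum_left)
  also have "(\<Sum>j\<in>UNIV. v $ j * v $ j) = 1"
    using assms by (simp add: norm_eq_1 inner_vec_def)
  also have "(\<Sum>j\<in>UNIV. v $ j *\<^sub>R (transpose (annv v) ** ann j)) = transpose (annv v) ** annv v"
    by (simp only: mult_annv)
  finally show ?thesis by simp
qed

lemma annv_square: "annv v ** annv v = 0"
proof -
  have "annv v ** annv v = (\<Sum>j\<in>UNIV. v $ j *\<^sub>R (ann j ** annv v))"
    by (rule annv_mult)
  also have "\<dots> = - (\<Sum>j\<in>UNIV. v $ j *\<^sub>R (annv v ** ann j))"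
    by (simp add: ann_annv sum_negf)
  also have "\<dots> = - (annv v ** annv v)"
    by (simp only: mult_annv)
  finally have "2 *\<^sub>R (annv v ** annv v) = 0"
    unfolding scaleR_2 by (simp only: eq_neg_iff_add_eq_0)
  then show ?thesis by simp
qed

lemma fock_reflection_square: "norm v = 1 \<Longrightarrow> fock_reflection v ** fock_reflection v = mat 1"
  unfolding fock_reflection_def
  by (rule fermionic_reflection[OF annv_square annv_transpose_annv ann_annv ann_transpose_annv])

lemma fock_reflection_ann:
  assumes "norm v = 1"
  shows "fock_reflection v ** ann j ** fock_reflection v = (\<Sum>l\<in>UNIV. householder v $ j $ l *\<^sub>R ann l)"
proof -
  have "fock_reflection v ** ann j ** fock_reflection v = ann j - (2 * v $ j) *\<^sub>R annv v"
    unfolding fock_reflection_def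
    by (rule fermionic_reflection[where b = "ann j" and c = "v $ j"])
       (rule annv_square annv_transpose_annv[OF assms] ann_annv ann_transpose_annv)+
  also have "\<dots> = (\<Sum>l\<in>UNIV. (if l = j then ann l else 0) - (2 * v $ j * v $ l) *\<^sub>R ann l)"
    by (simp add: sum_subtractf annv_def scaleR_sum_right)
  also have "\<dots> = (\<Sum>l\<in>UNIV. householder v $ j $ l *\<^sub>R ann l)"
    by (intro sum.cong) (auto simp: householder_def algebra_simps)
  finally show ?thesis .
qed

lemma transpose_fock_reflection [simp]: "transpose (fock_reflection v) = fock_reflection v"
  by (simp add: fock_reflection_def transpose_diff transpose_scalar matrix_transpose_mul transpose_mat)

text \<open>The Fock space \<open>\<Lambda>(\<real>\<^sup>n) \<otimes> \<Lambda>(\<real>\<^sup>n)\<close> of two species is the space of matrices: the first species acts from the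
  left, the second from the right, and operators of different species commute instead of
  anticommuting.\<close>

definition ferm_E :: "real ^ 'n ^ 'n \<Rightarrow> real ^ 'n set ^ 'n set \<Rightarrow> real ^ 'n set ^ 'n::finite set" where
  "ferm_E A w = (\<Sum>j\<in>UNIV. \<Sum>k\<in>UNIV. A $ j $ k *\<^sub>R (transpose (ann j) ** w ** ann k))"

definition ferm_F :: "real ^ 'n ^ 'n \<Rightarrow> real ^ 'n set ^ 'n set \<Rightarrow> real ^ 'n set ^ 'n::finite set" where
  "ferm_F A w = (\<Sum>j\<in>UNIV. \<Sum>k\<in>UNIV. A $ j $ k *\<^sub>R (ann j ** w ** transpose (ann k)))"

definition second_quant :: "real ^ 'n ^ 'n \<Rightarrow> real ^ 'n set ^ 'n::finite set" where
  "second_quant A = (\<Sum>j\<in>UNIV. \<Sum>k\<in>UNIV. A $ j $ k *\<^sub>R (transpose (ann j) ** ann k))"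

text \<open>The average over the species lets a singly occupied site count as 1/2. There every 2 by
  2 matrix then acts by half its trace, which is its expectation at a site of a singlet.\<close>

definition ferm_N :: "real ^ 'n ^ 'n \<Rightarrow> real ^ 'n set ^ 'n set \<Rightarrow> real ^ 'n set ^ 'n::finite set" where
  "ferm_N A w = (1/2) *\<^sub>R (second_quant A ** w + w ** second_quant A)"

text \<open>A matrix unit with indices \<open>True\<close> and \<open>False\<close> creates a pair of particles of both species,
  its transpose annihilates one, and the diagonal matrix units count occupied and empty
  positions, averaged over the species.\<close>

definition ferm_op :: "(bool \<Rightarrow> bool \<Rightarrow> real) \<Rightarrow> real ^ 'n ^ 'n \<Rightarrow> real ^ 'n set ^ 'n set \<Rightarrow> real ^ 'n set ^ 'n::finite set" where
  "ferm_op C A w = C True False *\<^sub>R ferm_E A w + C False True *\<^sub>R ferm_F A w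
     + C True True *\<^sub>R ferm_N A w + C False False *\<^sub>R (trace A *\<^sub>R w - ferm_N A w)"

lemma householder_mult_vec: "householder v *v x = x - (2 * (v \<bullet> x)) *\<^sub>R v"
proof -
  have "(\<Sum>j\<in>UNIV. ((if i = j then 1 else 0) - 2 * v $ i * v $ j) * x $ j) = x $ i - 2 * (v \<bullet> x) * v $ i" for i
  proof -
    have "(\<Sum>j\<in>UNIV. ((if i = j then 1 else 0) - 2 * v $ i * v $ j) * x $ j)
      = (\<Sum>j\<in>UNIV. (if i = j then x $ j else 0) - 2 * v $ i * (v $ j * x $ j))"
      by (intro sum.cong) (auto simp: algebra_simps)
    then show ?thesis
      by (simp add: sum_subtractf inner_vec_def flip: sum_distrib_left)
  qed
  then show ?thesis
    by (simp add: vec_eq_iff householder_def matrix_vector_mult_def)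
qed

lemma householder_sym: "householder v $ i $ j = householder v $ j $ i"
  by (simp add: householder_def)

lemma transpose_householder [simp]: "transpose (householder v) = householder v"
  by (simp add: vec_eq_iff transpose_def householder_sym)

lemma householder_square: "norm v = 1 \<Longrightarrow> householder v ** householder v = mat 1"
  by (simp add: matrix_eq householder_mult_vec inner_diff_right norm_eq_1 algebra_simps flip: matrix_vector_mul_assoc scaleR_left_distrib)

abbreviation conj_by :: "real ^ 'k ^ 'k \<Rightarrow> real ^ 'k ^ 'k \<Rightarrow> real ^ 'k ^ 'k::finite" where
  "conj_by P w \<equiv> P ** w ** P"

lemma conj_by_sum: "conj_by P (\<Sum>j\<in>S. f j) = (\<Sum>j\<in>S. conj_by P (f j))"
  by (simp add: matrix_mult_sum_left matrix_mult_sum_right)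

lemma conj_by_scaleR: "conj_by P (c *\<^sub>R w) = c *\<^sub>R conj_by P w"
  by (simp add: matrix_bilinear)

lemma conj_by_mult:
  assumes "P ** P = mat 1"
  shows "conj_by P (x ** y) = conj_by P x ** conj_by P y"
  by (metis assms matrix_mul_assoc matrix_mul_rid)

lemma conj_by_householder:
  "conj_by (householder v) A $ l $ m = (\<Sum>j\<in>UNIV. \<Sum>k\<in>UNIV. A $ j $ k * householder v $ j $ l * householder v $ k $ m)"
proof -
  have "conj_by (householder v) A $ l $ m =
     (\<Sum>k\<in>UNIV. \<Sum>j\<in>UNIV. A $ j $ k * householder v $ j $ l * householder v $ k $ m)"
    by (simp add: matrix_matrix_mult_def sum_distrib_left sum_distrib_right mult_ac householder_sym[of v l])
  also have "\<dots> = (\<Sum>j\<in>UNIV. \<Sum>k\<in>UNIV. A $ j $ k * householder v $ j $ l * householder v $ k $ m)"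
    by (rule sum.swap)
  finally show ?thesis .
qed

lemma sum_swap4:
  "(\<Sum>j\<in>A. \<Sum>k\<in>B. \<Sum>l\<in>C. \<Sum>m\<in>D. g j k l m) = (\<Sum>l\<in>C. \<Sum>m\<in>D. \<Sum>j\<in>A. \<Sum>k\<in>B. g j k l m)"
proof -
  have "(\<Sum>j\<in>A. \<Sum>k\<in>B. \<Sum>l\<in>C. \<Sum>m\<in>D. g j k l m) = (\<Sum>j\<in>A. \<Sum>l\<in>C. \<Sum>k\<in>B. \<Sum>m\<in>D. g j k l m)"
    by (rule sum.cong[OF refl], rule sum.swap)
  also have "\<dots> = (\<Sum>l\<in>C. \<Sum>j\<in>A. \<Sum>k\<in>B. \<Sum>m\<in>D. g j k l m)"
    by (rule sum.swap)
  also have "\<dots> = (\<Sum>l\<in>C. \<Sum>j\<in>A. \<Sum>m\<in>D. \<Sum>k\<in>B. g j k l m)"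
    by (rule sum.cong[OF refl], rule sum.cong[OF refl], rule sum.swap)
  also have "\<dots> = (\<Sum>l\<in>C. \<Sum>m\<in>D. \<Sum>j\<in>A. \<Sum>k\<in>B. g j k l m)"
    by (rule sum.cong[OF refl], rule sum.swap)
  finally show ?thesis .
qed

text \<open>Transfers the effect of a reflection from the two operators in a quadratic expression to
  the coefficient matrix.\<close>

lemma bilinear_conj_by_householder:
  fixes f :: "'n::finite \<Rightarrow> 'n \<Rightarrow> 'w::real_vector"
  shows "(\<Sum>j\<in>UNIV. \<Sum>k\<in>UNIV. A $ j $ k *\<^sub>R
       (\<Sum>l\<in>UNIV. \<Sum>m\<in>UNIV. (householder v $ j $ l * householder v $ k $ m) *\<^sub>R f l m))
    = (\<Sum>l\<in>UNIV. \<Sum>m\<in>UNIV. conj_by (householder v) A $ l $ m *\<^sub>R f l m)"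
  unfolding conj_by_householder scaleR_sum_right scaleR_sum_left
  by (subst sum_swap4) (simp add: mult.assoc)

text \<open>Conjugation turns annihilation and creation operators by the Householder matrix
  (\<open>fock_reflection_ann\<close> and its transpose), so quadratic expressions have their
  coefficients conjugated; the remaining scalar term is covariant because the trace is
  invariant.\<close>

lemma ferm_op_reflection:
  fixes v :: "real ^ 'n::finite"
  assumes "norm v = 1"
  shows "conj_by (fock_reflection v) (ferm_op C A w) =
    ferm_op C (conj_by (householder v) A) (conj_by (fock_reflection v) w)"
proof -
  let ?P = "fock_reflection v" and ?h = "householder v"
  note PP = fock_reflection_square[OF assms]
  note a = fock_reflection_ann[OF assms]
  have t: "conj_by ?P (transpose (ann j)) = (\<Sum>l\<in>UNIV. ?h $ j $ l *\<^sub>R transpose (ann l))" for j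
  proof -
    have "conj_by ?P (transpose (ann j)) = transpose (conj_by ?P (ann j))"
      by (simp add: matrix_transpose_mul matrix_mul_assoc)
    then show ?thesis by (simp add: a transpose_sum transpose_scalar)
  qed
  have E: "conj_by ?P (ferm_E A w) = ferm_E (conj_by ?h A) (conj_by ?P w)"
  proof -
    have "conj_by ?P (transpose (ann j) ** w ** ann k) =
       (\<Sum>l\<in>UNIV. \<Sum>m\<in>UNIV. (?h $ j $ l * ?h $ k $ m) *\<^sub>R (transpose (ann l) ** conj_by ?P w ** ann m))" for j k
      by (simp add: conj_by_mult[OF PP] a t matrix_mult_sum_left matrix_mult_sum_right matrix_bilinear scaleR_sum_right mult_ac) (rule sum.swap)
    then show ?thesis
      by (simp only: ferm_E_def conj_by_sum conj_by_scaleR bilinear_conj_by_householder)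
  qed
  have F: "conj_by ?P (ferm_F A w) = ferm_F (conj_by ?h A) (conj_by ?P w)"
  proof -
    have "conj_by ?P (ann j ** w ** transpose (ann k)) =
       (\<Sum>l\<in>UNIV. \<Sum>m\<in>UNIV. (?h $ j $ l * ?h $ k $ m) *\<^sub>R (ann l ** conj_by ?P w ** transpose (ann m)))" for j k
      by (simp add: conj_by_mult[OF PP] a t matrix_mult_sum_left matrix_mult_sum_right matrix_bilinear scaleR_sum_right mult_ac) (rule sum.swap)
    then show ?thesis
      by (simp only: ferm_F_def conj_by_sum conj_by_scaleR bilinear_conj_by_householder)
  qed
  have "conj_by ?P (second_quant A) = second_quant (conj_by ?h A)"
  proof -
    have "conj_by ?P (transpose (ann j) ** ann k) =
       (\<Sum>l\<in>UNIV. \<Sum>m\<in>UNIV. (?h $ j $ l * ?h $ k $ m) *\<^sub>R (transpose (ann l) ** ann m))" for j k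
      by (simp add: conj_by_mult[OF PP] a t matrix_mult_sum_left matrix_mult_sum_right matrix_bilinear scaleR_sum_right mult_ac) (rule sum.swap)
    then show ?thesis
      by (simp only: second_quant_def conj_by_sum conj_by_scaleR bilinear_conj_by_householder)
  qed
  then have N: "conj_by ?P (ferm_N A w) = ferm_N (conj_by ?h A) (conj_by ?P w)"
    by (metis (no_types, lifting) conj_by_mult[OF PP] conj_by_scaleR ferm_N_def matrix_add_ldistrib matrix_add_rdistrib)
  have "trace (conj_by ?h A) = trace A"
    by (metis householder_square[OF assms] matrix_mul_assoc matrix_mul_lid trace_mul_sym)
  with E F N show ?thesis
    by (simp add: ferm_op_def matrix_bilinear scaleR_diff_right mult.commute)
qed

section \<open>Diagonal matrices and operators on single sites\<close>

definition diag :: "'a::zero ^ 'k \<Rightarrow> 'a ^ 'k ^ 'k::finite" where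
  "diag x = (\<chi> i j. if i = j then x $ i else 0)"

lemma diag_nth: "diag x $ i $ j = (if i = j then x $ i else 0)"
  by (simp add: diag_def)

definition put :: "'a \<Rightarrow> bool \<Rightarrow> 'a set \<Rightarrow> 'a set" where
  "put i q K = (if q then insert i K else K - {i})"

text \<open>A vector indexed by subsets is a tensor in a power of \<real>^2, with membership of
  \<open>i\<close> as the basis index of the factor at \<open>i\<close>; \<open>C\<close> acts on
  that factor.\<close>

definition site_op :: "(bool \<Rightarrow> bool \<Rightarrow> real) \<Rightarrow> 'n \<Rightarrow> real ^ 'n set \<Rightarrow> real ^ 'n::finite set" where
  "site_op C i u = (\<chi> K. \<Sum>q\<in>UNIV. C (i \<in> K) q * u $ put i q K)"

text \<open>The first branch is \<open>C\<close> on the span of the empty and the doubly occupied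
  state of the site, twisted by the fermionic sign of creating or removing a pair. The second is a
  singly occupied site, which is inert up to a scalar.\<close>

definition ferm_site_op :: "(bool \<Rightarrow> bool \<Rightarrow> real) \<Rightarrow> 'n \<Rightarrow> real ^ 'n set ^ 'n set \<Rightarrow> real ^ 'n set ^ 'n::finite set" where
  "ferm_site_op C i w = (\<chi> I K. if (i \<in> I) = (i \<in> K)
     then \<Sum>q\<in>UNIV. C (i \<in> I) q * (if q = (i \<in> I) then 1 else jw_sign i I * jw_sign i K) * w $ put i q I $ put i q K
     else (C True True + C False False) / 2 * w $ I $ K)"

lemma sum_diag: "(\<Sum>j\<in>UNIV. \<Sum>k\<in>UNIV. diag x $ j $ k *\<^sub>R f j k) = (\<Sum>j\<in>UNIV. x $ j *\<^sub>R f j j)"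
  for f :: "'n::finite \<Rightarrow> 'n \<Rightarrow> 'w::real_vector"
proof (rule sum.cong[OF refl])
  fix j
  have "(\<Sum>k\<in>UNIV. diag x $ j $ k *\<^sub>R f j k) = (\<Sum>k\<in>UNIV. if j = k then x $ j *\<^sub>R f j k else 0)"
    by (intro sum.cong) (auto simp: diag_nth)
  then show "(\<Sum>k\<in>UNIV. diag x $ j $ k *\<^sub>R f j k) = x $ j *\<^sub>R f j j" by simp
qed

lemma second_quant_diag_mult:
  "(second_quant (diag x) ** w) $ I $ K = (\<Sum>i\<in>UNIV. x $ i * (if i \<in> I then w $ I $ K else 0))"
proof -
  have "(transpose (ann i) ** ann i ** w) $ I $ K = (if i \<in> I then w $ I $ K else 0)" for i
    by (simp add: transpose_ann_mult ann_mult insert_absorb flip: matrix_mul_assoc)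
  then show ?thesis
    by (simp add: second_quant_def sum_diag matrix_mult_sum_left matrix_bilinear)
qed

lemma mult_second_quant_diag:
  "(w ** second_quant (diag x)) $ I $ K = (\<Sum>i\<in>UNIV. x $ i * (if i \<in> K then w $ I $ K else 0))"
proof -
  have "(w ** (transpose (ann i) ** ann i)) $ I $ K = (if i \<in> K then w $ I $ K else 0)" for i
    by (simp add: mult_transpose_ann mult_ann insert_absorb matrix_mul_assoc)
  then show ?thesis
    by (simp add: second_quant_def sum_diag matrix_mult_sum_right matrix_bilinear)
qed

lemma ferm_op_diag:
  "ferm_op C (diag x) w = (\<Sum>i\<in>UNIV. x $ i *\<^sub>R ferm_site_op C i w)"
proof -
  have E: "ferm_E (diag x) w $ I $ K = (\<Sum>i\<in>UNIV. x $ i * (if i \<in> I \<and> i \<in> K then jw_sign i I * jw_sign i K * w $ (I - {i}) $ (K - {i}) else 0))" for I K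
  proof -
    have "(transpose (ann i) ** w ** ann i) $ I $ K = (if i \<in> I \<and> i \<in> K then jw_sign i I * jw_sign i K * w $ (I - {i}) $ (K - {i}) else 0)" for i
      by (simp add: transpose_ann_mult mult_ann)
    then show ?thesis by (simp add: ferm_E_def sum_diag)
  qed
  have F: "ferm_F (diag x) w $ I $ K = (\<Sum>i\<in>UNIV. x $ i * (if i \<notin> I \<and> i \<notin> K then jw_sign i I * jw_sign i K * w $ insert i I $ insert i K else 0))" for I K
  proof -
    have "(ann i ** w ** transpose (ann i)) $ I $ K = (if i \<notin> I \<and> i \<notin> K then jw_sign i I * jw_sign i K * w $ insert i I $ insert i K else 0)" for i
      by (simp add: ann_mult mult_transpose_ann)
    then show ?thesis by (simp add: ferm_F_def sum_diag)
  qed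
  have N: "ferm_N (diag x) w $ I $ K = (\<Sum>i\<in>UNIV. x $ i * (((if i \<in> I then 1/2 else 0) + (if i \<in> K then 1/2 else 0)) * w $ I $ K))" for I K
    unfolding ferm_N_def vector_scaleR_component vector_add_component second_quant_diag_mult mult_second_quant_diag
      real_scaleR_def sum.distrib[symmetric] sum_distrib_left
    by (intro sum.cong) auto
  have T: "trace (diag x) * w $ I $ K = (\<Sum>i\<in>UNIV. x $ i * w $ I $ K)" for I K
    by (simp add: trace_def diag_nth sum_distrib_right)
  have "ferm_op C (diag x) w $ I $ K = (\<Sum>i\<in>UNIV. x $ i * ferm_site_op C i w $ I $ K)" for I K
    unfolding ferm_op_def vector_add_component vector_scaleR_component[of _ _ I] vector_scaleR_component[of _ _ K]
      vector_minus_component E F N T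
      real_scaleR_def sum_distrib_left sum.distrib[symmetric] sum_subtractf[symmetric]
  proof (rule sum.cong[OF refl])
    fix i
    show "C True False * (x $ i * (if i \<in> I \<and> i \<in> K then jw_sign i I * jw_sign i K * w $ (I - {i}) $ (K - {i}) else 0)) +
      C False True * (x $ i * (if i \<notin> I \<and> i \<notin> K then jw_sign i I * jw_sign i K * w $ insert i I $ insert i K else 0)) +
      C True True * (x $ i * (((if i \<in> I then 1 / 2 else 0) + (if i \<in> K then 1 / 2 else 0)) * w $ I $ K)) +
      C False False * (x $ i * w $ I $ K - x $ i * (((if i \<in> I then 1 / 2 else 0) + (if i \<in> K then 1 / 2 else 0)) * w $ I $ K))
      = x $ i * ferm_site_op C i w $ I $ K"
      by (cases "i \<in> I"; cases "i \<in> K")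
         (simp_all add: ferm_site_op_def put_def UNIV_bool insert_absorb algebra_simps)
  qed
  then show ?thesis by (simp add: vec_eq_iff)
qed

text \<open>The total operators are obtained at the identity matrix, which every Householder
  conjugation fixes; therefore they commute with the Fock reflections.\<close>

lemma ferm_op_mat:
  fixes w :: "real ^ 'n set ^ 'n::finite set"
  shows "ferm_op C (mat 1) w = (\<Sum>i\<in>UNIV. ferm_site_op C i w)"
proof -
  have "mat 1 = (diag (\<chi> i. 1) :: real ^ 'n ^ 'n)" by (simp add: vec_eq_iff diag_nth mat_def)
  then show ?thesis by (simp add: ferm_op_diag)
qed

lemma linear_second_quant: "linear second_quant"
  by (rule linearI) (simp_all add: second_quant_def scaleR_left_distrib sum.distrib scaleR_sum_right)

lemma linear_ferm_op_left:
  fixes w :: "real ^ 'n set ^ 'n::finite set"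
  shows "linear (\<lambda>A. ferm_op C A w)"
proof -
  interpret linear second_quant by (rule linear_second_quant)
  have "linear (\<lambda>A. ferm_E A w)" "linear (\<lambda>A. ferm_F A w)"
    by (rule linearI; simp add: ferm_E_def ferm_F_def scaleR_left_distrib sum.distrib scaleR_sum_right)+
  moreover have "linear (\<lambda>A. ferm_N A w)"
    by (rule linearI) (simp_all add: ferm_N_def add scale matrix_bilinear scaleR_right_distrib)
  moreover have "linear (\<lambda>A::real ^ 'n ^ 'n. trace A *\<^sub>R w)"
    by (rule linearI) (simp_all add: trace_def sum.distrib scaleR_left_distrib scaleR_sum_left scaleR_sum_right)
  ultimately show ?thesis
    unfolding ferm_op_def by (intro linear_compose_add linear_compose_sub linear_compose_scale_right)
qed

lemma linear_ferm_op:
  fixes A :: "real ^ 'n ^ 'n::finite"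
  shows "linear (ferm_op C A)"
proof -
  have "linear (ferm_E A)" "linear (ferm_F A)"
    by (rule linearI; simp add: ferm_E_def ferm_F_def matrix_bilinear scaleR_right_distrib sum.distrib scaleR_sum_right mult.commute)+
  moreover have "linear (ferm_N A)"
    by (rule linearI) (simp_all add: ferm_N_def matrix_bilinear scaleR_right_distrib)
  moreover have "linear (\<lambda>w :: real ^ 'n set ^ 'n set. trace A *\<^sub>R w)"
    by (rule linearI) (simp_all add: scaleR_right_distrib)
  ultimately have "linear (\<lambda>w. ferm_op C A w)"
    unfolding ferm_op_def by (intro linear_compose_add linear_compose_sub linear_compose_scale_right linear_ident)
  then show ?thesis .
qed

subsection \<open>Singlet pairings\<close>

text \<open>A unit vector in the tensor product over \<open>J\<close> of copies of \<open>\<real>\<^sup>2\<close> annihilated by the total action of \<open>sl\<^sub>2\<close>,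
  with both states of each site equally likely.\<close>

definition singlet :: "'a set \<Rightarrow> ('a set \<Rightarrow> real) \<Rightarrow> bool" where
  "singlet J s \<longleftrightarrow>
     (\<forall>S\<subseteq>J. s S \<noteq> 0 \<longrightarrow> 2 * card S = card J) \<and>
     (\<Sum>S\<in>Pow J. s S * s S) = 1 \<and>
     (\<forall>S\<subseteq>J. (\<Sum>i\<in>J - S. s (insert i S)) = 0) \<and>
     (\<forall>S\<subseteq>J. (\<Sum>i\<in>S. s (S - {i})) = 0) \<and>
     (\<forall>i\<in>J. (\<Sum>S\<in>Pow J. if i \<in> S then s S * s S else 0) = 1 / 2)"

lemma sum_Pow_insert:
  assumes "finite J" "x \<notin> J"
  shows "(\<Sum>S\<in>Pow (insert x J). f S) = (\<Sum>S\<in>Pow J. f S) + (\<Sum>S\<in>Pow J. f (insert x S))"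
proof -
  have "inj_on (insert x) (Pow J)" using assms by (auto simp: inj_on_def)
  moreover have "Pow J \<inter> insert x ` Pow J = {}" using assms by auto
  ultimately show ?thesis
    using assms by (simp add: Pow_insert sum.union_disjoint sum.reindex)
qed

lemma singlet_empty: "singlet {} (\<lambda>S. 1)"
  by (simp add: singlet_def)

text \<open>\<open>r\<close> is the tensor product of \<open>s\<close> with the antisymmetric
  two-site state on \<open>x\<close> and \<open>y\<close>; \<open>sqrt 2\<close> normalizes the
  latter.\<close>

lemma singlet_step:
  assumes s: "singlet J s" and J: "finite J" "x \<notin> J" "y \<notin> J" "x \<noteq> y"
  defines "r \<equiv> \<lambda>S. if x \<in> S \<and> y \<notin> S then s (S - {x}) / sqrt 2
                  else if y \<in> S \<and> x \<notin> S then - s (S - {y}) / sqrt 2 else 0"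
  shows "singlet (insert x (insert y J)) r"
proof -
  let ?J = "insert x (insert y J)"
  have r: "r S = 0" "r (insert x S) = s S / sqrt 2" "r (insert y S) = - s S / sqrt 2"
      "r (insert x (insert y S)) = 0" if "S \<subseteq> J" for S
  proof -
    have "x \<notin> S" "y \<notin> S" using that J by auto
    then show "r S = 0" "r (insert x S) = s S / sqrt 2" "r (insert y S) = - s S / sqrt 2"
      "r (insert x (insert y S)) = 0" using J by (auto simp: r_def)
  qed
  have subsets: thesis if S: "S \<subseteq> ?J"
      and cases: "\<And>S0. S0 \<subseteq> J \<Longrightarrow> S = S0 \<or> S = insert x S0 \<or> S = insert y S0 \<or> S = insert x (insert y S0) \<Longrightarrow> thesis"
    for S thesis
    by (rule cases[of "S - {x, y}"]) (use S in auto)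
  have expand: "(\<Sum>S\<in>Pow ?J. f S) = (\<Sum>S\<in>Pow J. f S + f (insert y S) + (f (insert x S) + f (insert x (insert y S))))"
    for f :: "'a set \<Rightarrow> real"
    using J by (simp add: sum_Pow_insert sum.distrib)
  have s1: "S \<subseteq> J \<Longrightarrow> s S \<noteq> 0 \<Longrightarrow> 2 * card S = card J" for S
    using s by (auto simp: singlet_def)
  have s2: "(\<Sum>S\<in>Pow J. s S * s S) = 1"
    using s by (auto simp: singlet_def)
  have s3: "S \<subseteq> J \<Longrightarrow> (\<Sum>i\<in>J - S. s (insert i S)) = 0" for S
    using s by (auto simp: singlet_def)
  have s4: "S \<subseteq> J \<Longrightarrow> (\<Sum>i\<in>S. s (S - {i})) = 0" for S
    using s by (auto simp: singlet_def)
  have s5: "i \<in> J \<Longrightarrow> (\<Sum>S\<in>Pow J. if i \<in> S then s S * s S else 0) = 1 / 2" for i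
    using s by (auto simp: singlet_def)
  have "\<forall>S\<subseteq>?J. r S \<noteq> 0 \<longrightarrow> 2 * card S = card ?J"
  proof (intro allI impI)
    fix S assume S': "S \<subseteq> ?J" and nz: "r S \<noteq> 0"
    obtain S0 where S0: "S0 \<subseteq> J" "S = S0 \<or> S = insert x S0 \<or> S = insert y S0 \<or> S = insert x (insert y S0)"
      using S' by (rule subsets)
    have S: "S = insert x S0 \<or> S = insert y S0" using S0(2) nz r(1,4)[OF S0(1)] by metis
    have "s S0 \<noteq> 0" using S r(2,3)[OF S0(1)] nz by (metis div_0 minus_zero)
    then have "2 * card S0 = card J" using s1 S0 by blast
    moreover have "finite S0" "x \<notin> S0" "y \<notin> S0" using S0 J finite_subset by auto
    ultimately show "2 * card S = card ?J" using S J by auto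
  qed
  moreover have "(\<Sum>S\<in>Pow ?J. r S * r S) = 1"
  proof -
    have "(\<Sum>S\<in>Pow ?J. r S * r S) = (\<Sum>S\<in>Pow J. s S * s S)"
      unfolding expand by (intro sum.cong) (auto simp: r)
    then show ?thesis by (simp add: s2)
  qed
  moreover have "\<forall>S\<subseteq>?J. (\<Sum>i\<in>?J - S. r (insert i S)) = 0"
  proof (intro allI impI)
    fix S assume "S \<subseteq> ?J"
    then obtain S0 where S0: "S0 \<subseteq> J" "S = S0 \<or> S = insert x S0 \<or> S = insert y S0 \<or> S = insert x (insert y S0)"
      by (rule subsets)
    have nx: "x \<notin> S0" "y \<notin> S0" using S0 J by auto
    have fin: "finite (J - S0)" using J by simp
    have ins: "insert i S0 \<subseteq> J" if "i \<in> J - S0" for i using that S0 by auto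
    consider "S = S0" | "S = insert x S0" | "S = insert y S0" | "S = insert x (insert y S0)" using S0(2) by blast
    then show "(\<Sum>i\<in>?J - S. r (insert i S)) = 0"
    proof cases
      \<comment> \<open>Raising \<open>x\<close> and raising \<open>y\<close> contribute with
        opposite signs; every other term leaves both sites empty and vanishes.\<close>
      case 1
      have "?J - S = insert x (insert y (J - S0))" using 1 nx J by auto
      moreover have "(\<Sum>i\<in>J - S0. r (insert i S)) = 0"
        by (rule sum.neutral) (use 1 r(1) ins in blast)
      ultimately show ?thesis using 1 J fin r[OF S0(1)] by simp
    next
      case 2
      have "?J - S = insert y (J - S0)" using 2 nx J by auto
      moreover have "(\<Sum>i\<in>J - S0. r (insert i S)) = (\<Sum>i\<in>J - S0. s (insert i S0) / sqrt 2)"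
      proof (rule sum.cong[OF refl])
        fix i assume "i \<in> J - S0"
        moreover have "insert i S = insert x (insert i S0)" using 2 by auto
        ultimately show "r (insert i S) = s (insert i S0) / sqrt 2" using r(2)[OF ins] by simp
      qed
      ultimately show ?thesis using 2 J fin r[OF S0(1)] s3[OF S0(1)]
        by (simp add: insert_commute flip: sum_divide_distrib)
    next
      case 3
      have "?J - S = insert x (J - S0)" using 3 nx J by auto
      moreover have "(\<Sum>i\<in>J - S0. r (insert i S)) = (\<Sum>i\<in>J - S0. - (s (insert i S0) / sqrt 2))"
      proof (rule sum.cong[OF refl])
        fix i assume "i \<in> J - S0"
        moreover have "insert i S = insert y (insert i S0)" using 3 by auto
        ultimately show "r (insert i S) = - (s (insert i S0) / sqrt 2)" using r(3)[OF ins] by simp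
      qed
      ultimately show ?thesis using 3 J fin r[OF S0(1)] s3[OF S0(1)]
        by (simp add: insert_commute sum_negf flip: sum_divide_distrib)
    next
      case 4
      have "?J - S = J - S0" using 4 nx J by auto
      moreover have "(\<Sum>i\<in>J - S0. r (insert i S)) = 0"
      proof (rule sum.neutral, rule ballI)
        fix i assume "i \<in> J - S0"
        moreover have "insert i S = insert x (insert y (insert i S0))" using 4 by auto
        ultimately show "r (insert i S) = 0" using r(4)[OF ins] by simp
      qed
      ultimately show ?thesis by simp
    qed
  qed
  moreover have "\<forall>S\<subseteq>?J. (\<Sum>i\<in>S. r (S - {i})) = 0"
  proof (intro allI impI)
    fix S assume "S \<subseteq> ?J"
    then obtain S0 where S0: "S0 \<subseteq> J" "S = S0 \<or> S = insert x S0 \<or> S = insert y S0 \<or> S = insert x (insert y S0)"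
      by (rule subsets)
    have nx: "x \<notin> S0" "y \<notin> S0" using S0 J by auto
    have fin: "finite S0" using J S0 finite_subset by blast
    have del: "S0 - {i} \<subseteq> J" for i using S0 by auto
    consider "S = S0" | "S = insert x S0" | "S = insert y S0" | "S = insert x (insert y S0)" using S0(2) by blast
    then show "(\<Sum>i\<in>S. r (S - {i})) = 0"
    proof cases
      case 1
      then show ?thesis using r(1)[OF del] by simp
    next
      case 2
      have "(\<Sum>i\<in>S0. r (S - {i})) = (\<Sum>i\<in>S0. s (S0 - {i}) / sqrt 2)"
      proof (rule sum.cong[OF refl])
        fix i assume "i \<in> S0"
        then have "S - {i} = insert x (S0 - {i})" using 2 nx by auto
        then show "r (S - {i}) = s (S0 - {i}) / sqrt 2" using r(2)[OF del] by simp
      qed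
      then show ?thesis using 2 fin nx r[OF S0(1)] s4[OF S0(1)]
        by (simp flip: sum_divide_distrib)
    next
      case 3
      have "(\<Sum>i\<in>S0. r (S - {i})) = (\<Sum>i\<in>S0. - (s (S0 - {i}) / sqrt 2))"
      proof (rule sum.cong[OF refl])
        fix i assume "i \<in> S0"
        then have "S - {i} = insert y (S0 - {i})" using 3 nx by auto
        then show "r (S - {i}) = - (s (S0 - {i}) / sqrt 2)" using r(3)[OF del] by simp
      qed
      then show ?thesis using 3 fin nx r[OF S0(1)] s4[OF S0(1)]
        by (simp add: sum_negf flip: sum_divide_distrib)
    next
      case 4
      have "(\<Sum>i\<in>S0. r (S - {i})) = 0"
      proof (rule sum.neutral, rule ballI)
        fix i assume "i \<in> S0"
        then have "S - {i} = insert x (insert y (S0 - {i}))" using 4 nx by auto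
        then show "r (S - {i}) = 0" using r(4)[OF del] by simp
      qed
      moreover have "S - {x} = insert y S0" "S - {y} = insert x S0" using 4 nx J by auto
      ultimately show ?thesis using 4 fin nx J r[OF S0(1)] by simp
    qed
  qed
  moreover have "\<forall>i\<in>?J. (\<Sum>S\<in>Pow ?J. if i \<in> S then r S * r S else 0) = 1 / 2"
  proof
    fix i assume i: "i \<in> ?J"
    have n: "x \<notin> S" "y \<notin> S" if "S \<in> Pow J" for S using that J by auto
    \<comment> \<open>Each new site is occupied in one of the two terms of the two-site state, and
      that term carries half of the squared norm.\<close>
    have half: "(\<Sum>S\<in>Pow J. s S * s S / 2) = 1 / 2" using s2 by (simp flip: sum_divide_distrib)
    consider "i = x" | "i = y" | "i \<in> J" "i \<noteq> x" "i \<noteq> y" using i J by auto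
    then show "(\<Sum>S\<in>Pow ?J. if i \<in> S then r S * r S else 0) = 1 / 2"
    proof cases
      case 1
      have "(\<Sum>S\<in>Pow ?J. if i \<in> S then r S * r S else 0) = (\<Sum>S\<in>Pow J. s S * s S / 2)"
        unfolding expand by (rule sum.cong) (use 1 J n r in auto)
      then show ?thesis by (simp add: half)
    next
      case 2
      have "(\<Sum>S\<in>Pow ?J. if i \<in> S then r S * r S else 0) = (\<Sum>S\<in>Pow J. s S * s S / 2)"
        unfolding expand by (rule sum.cong) (use 2 J n r in auto)
      then show ?thesis by (simp add: half)
    next
      case 3
      have "(\<Sum>S\<in>Pow ?J. if i \<in> S then r S * r S else 0) = (\<Sum>S\<in>Pow J. if i \<in> S then s S * s S else 0)"
        unfolding expand by (rule sum.cong) (use 3 J n r in auto)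
      then show ?thesis using s5 3 by simp
    qed
  qed
  ultimately show ?thesis unfolding singlet_def by blast
qed

lemma singlet_exists:
  assumes "finite J" "even (card J)"
  shows "\<exists>s. singlet J s"
  using assms
proof (induction "card J" arbitrary: J rule: less_induct)
  case less
  show ?case
  proof (cases "J = {}")
    case True
    then show ?thesis using singlet_empty by blast
  next
    case False
    then obtain x where x: "x \<in> J" by auto
    have "J - {x} \<noteq> {}"
      using less.prems x by (metis card_1_singleton_iff insert_Diff is_singletonI odd_one One_nat_def)
    then obtain y where y: "y \<in> J" "y \<noteq> x" by auto
    define J' where "J' = J - {x, y}"
    have J: "J = insert x (insert y J')" "x \<notin> J'" "y \<notin> J'" "finite J'"
      using x y less.prems by (auto simp: J'_def)
    have c: "card J = card J' + 2" using J y by simp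
    moreover have "even (card J')" using c less.prems by simp
    ultimately obtain s where s: "singlet J' s" using less.hyps[of J'] J(4) by auto
    show ?thesis
      using singlet_step[OF s J(4) J(2) J(3) y(2)[symmetric]] unfolding J(1)[symmetric] by blast
  qed
qed

text \<open>For \<open>J\<close> of odd size no singlet exists and the value is unspecified;
  \<open>sectors\<close> admits even sizes only.\<close>

definition pairing :: "'n::finite set \<Rightarrow> 'n set \<Rightarrow> real" where
  "pairing J = (SOME s. singlet J s)"

lemma singlet_pairing: "even (card J) \<Longrightarrow> singlet J (pairing J)"
  unfolding pairing_def using singlet_exists[of J] by (metis finite_code someI_ex)

lemma
  assumes "even (card J)"
  shows pairing_card: "S \<subseteq> J \<Longrightarrow> pairing J S \<noteq> 0 \<Longrightarrow> 2 * card S = card J"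
    and pairing_norm: "(\<Sum>S\<in>Pow J. pairing J S * pairing J S) = 1"
    and pairing_raise: "S \<subseteq> J \<Longrightarrow> (\<Sum>i\<in>J - S. pairing J (insert i S)) = 0"
    and pairing_lower: "S \<subseteq> J \<Longrightarrow> (\<Sum>i\<in>S. pairing J (S - {i})) = 0"
    and pairing_half: "i \<in> J \<Longrightarrow> (\<Sum>S\<in>Pow J. if i \<in> S then pairing J S * pairing J S else 0) = 1 / 2"
  using singlet_pairing[OF assms] unfolding singlet_def by blast+

text \<open>A singlet is supported on subsets of one cardinality, and flipping a site changes the
  cardinality. So the off-diagonal entries of a site operator have no expectation.\<close>

lemma pairing_put_mult:
  assumes "even (card J)" "S \<subseteq> J" "i \<in> J" "q \<noteq> (i \<in> S)"
  shows "pairing J (put i q S) * pairing J S = 0"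
proof (rule ccontr)
  assume *: "pairing J (put i q S) * pairing J S \<noteq> 0"
  have "put i q S \<subseteq> J" using assms by (auto simp: put_def)
  with * assms pairing_card[OF assms(1)] have "card (put i q S) = card S"
    by (metis mult_eq_0_iff mult_left_cancel zero_neq_numeral)
  moreover have "card (put i q S) \<noteq> card S"
    using assms card_Suc_Diff1[of S i] by (cases q) (auto simp: put_def)
  ultimately show False by simp
qed

text \<open>A single site of a singlet is in the maximally mixed state, so the expectation of
  \<open>C\<close> is half its trace.\<close>

lemma pairing_site:
  assumes J: "even (card J)" and i: "i \<in> J"
  shows "(\<Sum>S\<in>Pow J. (\<Sum>q\<in>UNIV. C (i \<in> S) q * pairing J (put i q S)) * pairing J S)
    = (C True True + C False False) / 2"
proof -
  let ?s = "pairing J"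
  have "(\<Sum>S\<in>Pow J. (\<Sum>q\<in>UNIV. C (i \<in> S) q * ?s (put i q S)) * ?s S)
    = (\<Sum>S\<in>Pow J. (C True True - C False False) * (if i \<in> S then ?s S * ?s S else 0) + C False False * (?s S * ?s S))"
  proof (rule sum.cong[OF refl])
    fix S assume S: "S \<in> Pow J"
    have "(\<Sum>q\<in>UNIV. C (i \<in> S) q * ?s (put i q S)) * ?s S = C (i \<in> S) (i \<in> S) * (?s S * ?s S)"
    proof -
      have "?s (put i (\<not> (i \<in> S)) S) * ?s S = 0"
        using S i by (intro pairing_put_mult[OF J]) auto
      then have "?s S = 0 \<or> ?s (put i (\<not> (i \<in> S)) S) = 0" by auto
      moreover have "put i (i \<in> S) S = S" by (auto simp: put_def)
      ultimately show ?thesis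
        by (cases "i \<in> S") (auto simp: UNIV_bool)
    qed
    then show "(\<Sum>q\<in>UNIV. C (i \<in> S) q * ?s (put i q S)) * ?s S =
      (C True True - C False False) * (if i \<in> S then ?s S * ?s S else 0) + C False False * (?s S * ?s S)"
      by (cases "i \<in> S") (simp_all add: algebra_simps)
  qed
  also have "\<dots> = (C True True - C False False) * (\<Sum>S\<in>Pow J. if i \<in> S then ?s S * ?s S else 0)
      + C False False * (\<Sum>S\<in>Pow J. ?s S * ?s S)"
    by (simp only: sum.distrib sum_distrib_left)
  also have "\<dots> = (C True True + C False False) / 2"
    unfolding pairing_half[OF J i] pairing_norm[OF J] by (simp add: field_simps)
  finally show ?thesis .
qed

text \<open>The off-diagonal entries of \<open>C\<close> drop out by \<open>pairing_raise\<close>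
  and \<open>pairing_lower\<close>. The diagonal ones count occupied and empty sites, and wherever
  the singlet is nonzero both numbers are half of \<open>card J\<close>.\<close>

lemma pairing_total:
  assumes J: "even (card J)" and S: "S \<subseteq> J"
  shows "(\<Sum>i\<in>J. \<Sum>q\<in>UNIV. C (i \<in> S) q * pairing J (put i q S))
    = (C True True + C False False) / 2 * card J * pairing J S"
proof -
  let ?s = "pairing J"
  have fin: "finite S" "finite J" by auto
  have "(\<Sum>i\<in>J. \<Sum>q\<in>UNIV. C (i \<in> S) q * ?s (put i q S))
    = (\<Sum>i\<in>J - S. \<Sum>q\<in>UNIV. C (i \<in> S) q * ?s (put i q S)) + (\<Sum>i\<in>S. \<Sum>q\<in>UNIV. C (i \<in> S) q * ?s (put i q S))"
    by (rule sum.subset_diff[OF S fin(2)])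
  also have "(\<Sum>i\<in>J - S. \<Sum>q\<in>UNIV. C (i \<in> S) q * ?s (put i q S)) = (\<Sum>i\<in>J - S. C False False * ?s S + C False True * ?s (insert i S))"
    by (rule sum.cong) (auto simp: UNIV_bool put_def)
  also have "\<dots> = C False False * (card (J - S) * ?s S)"
    using pairing_raise[OF J S] by (simp add: sum.distrib flip: sum_distrib_left)
  also have "(\<Sum>i\<in>S. \<Sum>q\<in>UNIV. C (i \<in> S) q * ?s (put i q S)) = (\<Sum>i\<in>S. C True True * ?s S + C True False * ?s (S - {i}))"
    by (rule sum.cong) (auto simp: UNIV_bool put_def insert_absorb)
  also have "\<dots> = C True True * (card S * ?s S)"
    using pairing_lower[OF J S] by (simp add: sum.distrib flip: sum_distrib_left)
  also have "C False False * (card (J - S) * ?s S) + C True True * (card S * ?s S)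
      = (C True True + C False False) / 2 * card J * ?s S"
  proof (cases "?s S = 0")
    case False
    then have "2 * card S = card J" using pairing_card[OF J S] by blast
    moreover have "card (J - S) + card S = card J" using card_Diff_subset[OF fin(1) S] card_mono[OF fin(2) S] by simp
    ultimately have half: "real (card S) = card J / 2" "real (card (J - S)) = card J / 2" by linarith+
    show ?thesis unfolding half by (simp add: field_simps)
  qed simp
  finally show ?thesis .
qed

subsection \<open>Decomposition of the Fock space into spin systems\<close>

lemma put_simps: "put i (i \<in> K) K = K" "q \<noteq> (i \<in> K) \<Longrightarrow> put i q K \<noteq> K"
  "(i \<in> put i q K) = q" "j \<noteq> i \<Longrightarrow> (j \<in> put i q K) = (j \<in> K)"
  by (auto simp: put_def)

text \<open>Sites occupied by both species enter both signs and cancel. Hence on a sector the sign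
  of a pair operator depends only on the inert sites, not on the configuration it acts on.\<close>

lemma jw_sign_disjoint:
  fixes i :: "'n::finite"
  assumes "L \<inter> L' = {}" "K \<inter> (L \<union> L') = {}"
  shows "jw_sign i (K \<union> L) * jw_sign i (K \<union> L') = jw_sign i (L \<union> L')"
proof -
  define X where "X = {j\<in>K. to_nat j < to_nat i}"
  define Y where "Y = {j\<in>L. to_nat j < to_nat i}"
  define Y' where "Y' = {j\<in>L'. to_nat j < to_nat i}"
  have "{j\<in>K \<union> L. to_nat j < to_nat i} = X \<union> Y" "{j\<in>K \<union> L'. to_nat j < to_nat i} = X \<union> Y'"
    "{j\<in>L \<union> L'. to_nat j < to_nat i} = Y \<union> Y'"
    by (auto simp: X_def Y_def Y'_def)
  moreover have "X \<inter> Y = {}" "X \<inter> Y' = {}" "Y \<inter> Y' = {}"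
    using assms by (auto simp: X_def Y_def Y'_def)
  ultimately show ?thesis
    by (simp add: jw_sign_def card_Un_disjoint power_add mult_ac flip: power_mult_distrib)
qed

text \<open>A diagonal change of basis absorbing the constant signs \<open>jw_sign i J\<close> of
  pair operators on a sector: adding or removing a pair at \<open>i\<close> multiplies the phase by
  just this sign.\<close>

definition jw_phase :: "'n::finite set \<Rightarrow> 'n set \<Rightarrow> real" where
  "jw_phase J K = (\<Prod>i\<in>K. jw_sign i J)"

lemma jw_phase_square [simp]: "jw_phase J K * jw_phase J K = 1"
  by (simp add: jw_phase_def flip: prod.distrib)

lemma jw_phase_put: "jw_phase J (put i q K) = (if q = (i \<in> K) then 1 else jw_sign i J) * jw_phase J K"
proof (cases "i \<in> K")
  case True
  then have "jw_phase J K = jw_sign i J * jw_phase J (K - {i})"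
    by (simp add: jw_phase_def prod.remove)
  with True show ?thesis by (auto simp: put_def insert_absorb)
next
  case False
  then show ?thesis by (auto simp: put_def jw_phase_def)
qed

text \<open>In the sector \<open>(L, L')\<close> the sites in \<open>L\<close> carry a particle of the first species only, those in \<open>L'\<close>
  of the second only, and all other sites carry none or both.\<close>

definition sectors :: "('n::finite set \<times> 'n set) set" where
  "sectors = {(L, L'). L \<inter> L' = {} \<and> even (card (L \<union> L'))}"

text \<open>One sector of \<open>w\<close> read as a spin vector: the inert sites
  \<open>L \<union> L'\<close> are filled with a singlet, doubly occupied sites become occupied, and
  the phase removes the fermionic signs.\<close>

definition to_spin :: "'n set \<times> 'n set \<Rightarrow> real ^ 'n set ^ 'n set \<Rightarrow> real ^ 'n::finite set" where
  "to_spin = (\<lambda>(L, L') w. \<chi> K. pairing (L \<union> L') (K \<inter> (L \<union> L')) * jw_phase (L \<union> L') (K - (L \<union> L'))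
      * w $ ((K - (L \<union> L')) \<union> L) $ ((K - (L \<union> L')) \<union> L'))"

text \<open>The projection that discards the states with an odd number of inert sites, on which no
  singlet exists.\<close>

definition even_part :: "real ^ 'n set ^ 'n set \<Rightarrow> real ^ 'n set ^ 'n::finite set" where
  "even_part w = (\<chi> I K. if even (card I + card K) then w $ I $ K else 0)"

lemma site_op_nth: "site_op C i u $ K = (\<Sum>q\<in>UNIV. C (i \<in> K) q * u $ put i q K)"
  by (simp add: site_op_def)

lemma to_spin_nth:
  assumes "K \<inter> (L \<union> L') = {}" "S \<subseteq> L \<union> L'"
  shows "to_spin (L, L') w $ (K \<union> S) = pairing (L \<union> L') S * jw_phase (L \<union> L') K * w $ (K \<union> L) $ (K \<union> L')"
proof -
  have "(K \<union> S) \<inter> (L \<union> L') = S" "(K \<union> S) - (L \<union> L') = K" using assms by auto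
  then show ?thesis by (simp add: to_spin_def)
qed

lemma split_set: "\<exists>K S. K \<inter> J = {} \<and> S \<subseteq> J \<and> M = K \<union> S"
  by (rule exI[of _ "M - J"], rule exI[of _ "M \<inter> J"]) auto

text \<open>Pairs are created and removed only on sites that are empty or doubly occupied, so the
  set of inert sites and their species never change.\<close>

lemma ferm_site_op_sector:
  assumes "L \<inter> L' = {}" "K \<inter> (L \<union> L') = {}"
  shows "ferm_site_op C i w $ (K \<union> L) $ (K \<union> L') =
    (if i \<in> L \<union> L' then (C True True + C False False) / 2 * w $ (K \<union> L) $ (K \<union> L')
     else \<Sum>q\<in>UNIV. C (i \<in> K) q * (if q = (i \<in> K) then 1 else jw_sign i (L \<union> L')) * w $ (put i q K \<union> L) $ (put i q K \<union> L'))"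
proof (cases "i \<in> L \<union> L'")
  case True
  then have "(i \<in> K \<union> L) \<noteq> (i \<in> K \<union> L')" using assms by auto
  then show ?thesis using True unfolding ferm_site_op_def by (simp only: vec_lambda_beta if_False if_True)
next
  case False
  then have "put i q (K \<union> L) = put i q K \<union> L" "put i q (K \<union> L') = put i q K \<union> L'" for q
    by (auto simp: put_def)
  with False show ?thesis by (simp add: ferm_site_op_def jw_sign_disjoint[OF assms] cong: if_cong)
qed

text \<open>Off the inert sites the phase cancels the fermionic sign and the operators intertwine.
  At an inert site \<open>C\<close> hits the singlet and in general leads out of the range of
  \<open>to_spin\<close>, so that there only totals and expectations can be compared.\<close>

lemma site_op_to_spin:
  assumes "L \<inter> L' = {}" "K \<inter> (L \<union> L') = {}" "S \<subseteq> L \<union> L'"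
  shows "site_op C i (to_spin (L, L') w) $ (K \<union> S) =
    (if i \<in> L \<union> L'
     then (\<Sum>q\<in>UNIV. C (i \<in> S) q * pairing (L \<union> L') (put i q S)) * jw_phase (L \<union> L') K * w $ (K \<union> L) $ (K \<union> L')
     else pairing (L \<union> L') S * jw_phase (L \<union> L') K * ferm_site_op C i w $ (K \<union> L) $ (K \<union> L'))"
proof (cases "i \<in> L \<union> L'")
  case True
  then have "put i q (K \<union> S) = K \<union> put i q S" "(i \<in> K \<union> S) = (i \<in> S)" "put i q S \<subseteq> L \<union> L'" for q
    using assms by (auto simp: put_def)
  then show ?thesis
    using True by (simp add: site_op_nth to_spin_nth[OF assms(2)] sum_distrib_right mult.assoc)
next
  case False
  have 1: "put i q (K \<union> S) = put i q K \<union> S" "(i \<in> K \<union> S) = (i \<in> K)" "put i q K \<inter> (L \<union> L') = {}" for q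
    using assms False by (auto simp: put_def)
  have "site_op C i (to_spin (L, L') w) $ (K \<union> S) = (\<Sum>q\<in>UNIV. pairing (L \<union> L') S * jw_phase (L \<union> L') K *
     (C (i \<in> K) q * (if q = (i \<in> K) then 1 else jw_sign i (L \<union> L')) * w $ (put i q K \<union> L) $ (put i q K \<union> L')))"
    unfolding site_op_nth 1 to_spin_nth[OF 1(3) assms(3)] jw_phase_put
    by (rule sum.cong) auto
  also have "\<dots> = pairing (L \<union> L') S * jw_phase (L \<union> L') K * ferm_site_op C i w $ (K \<union> L) $ (K \<union> L')"
    unfolding ferm_site_op_sector[OF assms(1,2)] using False by (simp add: sum_distrib_left)
  finally show ?thesis using False by simp
qed

text \<open>Summed over the inert sites, \<open>C\<close> acts on the singlet by half its trace per
  site, as \<open>ferm_site_op\<close> does there. Thus the totals intertwine although the single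
  terms need not.\<close>

lemma to_spin_total:
  assumes "t \<in> sectors"
  shows "to_spin t (\<Sum>i\<in>UNIV. ferm_site_op C i w) = (\<Sum>i\<in>UNIV. site_op C i (to_spin t w))"
proof -
  obtain L L' where t: "t = (L, L')" "L \<inter> L' = {}" "even (card (L \<union> L'))"
    using assms by (auto simp: sectors_def)
  let ?J = "L \<union> L'"
  have "to_spin t (\<Sum>i\<in>UNIV. ferm_site_op C i w) $ M = (\<Sum>i\<in>UNIV. site_op C i (to_spin t w)) $ M" for M
  proof -
    obtain K S where K: "K \<inter> ?J = {}" and S: "S \<subseteq> ?J" and M: "M = K \<union> S"
      using split_set[of "L \<union> L'" M] by blast
    let ?p = "pairing ?J S" and ?g = "jw_phase ?J K" and ?w = "w $ (K \<union> L) $ (K \<union> L')"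
    let ?c = "(C True True + C False False) / 2"
    have split: "(\<Sum>i\<in>UNIV. f i) = (\<Sum>i\<in>-?J. f i) + (\<Sum>i\<in>?J. f i)" for f :: "'a \<Rightarrow> real"
      by (metis Compl_eq_Diff_UNIV finite_code sum.subset_diff top_greatest)
    have "to_spin t (\<Sum>i\<in>UNIV. ferm_site_op C i w) $ M = (\<Sum>i\<in>UNIV. ?p * ?g * ferm_site_op C i w $ (K \<union> L) $ (K \<union> L'))"
      by (simp add: t M to_spin_nth[OF K S] sum_distrib_left)
    also have "\<dots> = (\<Sum>i\<in>-?J. ?p * ?g * ferm_site_op C i w $ (K \<union> L) $ (K \<union> L')) + (\<Sum>i\<in>?J. ?p * ?g * (?c * ?w))"
      unfolding split
      by (intro arg_cong2[where f = "(+)"] sum.cong refl) (auto simp: ferm_site_op_sector[OF t(2) K])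
    also have "(\<Sum>i\<in>?J. ?p * ?g * (?c * ?w)) = (?c * card ?J * ?p) * ?g * ?w"
      by (simp add: algebra_simps)
    also have "?c * card ?J * ?p = (\<Sum>i\<in>?J. \<Sum>q\<in>UNIV. C (i \<in> S) q * pairing ?J (put i q S))"
      by (rule pairing_total[OF t(3) S, symmetric])
    also have "(\<Sum>i\<in>-?J. ?p * ?g * ferm_site_op C i w $ (K \<union> L) $ (K \<union> L'))
         + (\<Sum>i\<in>?J. \<Sum>q\<in>UNIV. C (i \<in> S) q * pairing ?J (put i q S)) * ?g * ?w
       = (\<Sum>i\<in>UNIV. site_op C i (to_spin t w) $ M)"
      unfolding split sum_distrib_right
      by (intro arg_cong2[where f = "(+)"] sum.cong refl)
         (auto simp: t(1) M site_op_to_spin[OF t(2) K S] sum_distrib_right)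
    finally show ?thesis by simp
  qed
  then show ?thesis by (simp add: vec_eq_iff)
qed

lemma sum_Pow_Un:
  fixes J :: "'n::finite set"
  shows "(\<Sum>M\<in>UNIV. f M) = (\<Sum>K\<in>Pow (- J). \<Sum>S\<in>Pow J. f (K \<union> S) :: real)"
proof -
  have "bij_betw (\<lambda>(K, S). K \<union> S) (Pow (- J) \<times> Pow J) UNIV"
    by (rule bij_betw_byWitness[where f' = "\<lambda>M. (M - J, M \<inter> J)"]) auto
  then have "(\<Sum>M\<in>UNIV. f M) = (\<Sum>(K, S)\<in>Pow (- J) \<times> Pow J. f (K \<union> S))"
    by (subst sum.reindex_bij_betw[symmetric]) (auto simp: case_prod_unfold)
  then show ?thesis by (simp add: sum.cartesian_product)
qed

text \<open>At an inert site the two sides agree by \<open>pairing_site\<close>, elsewhere because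
  the singlet has norm one. Equality of matrix entries replaces intertwining: the fermionic operator
  is a compression of the spin operator.\<close>

lemma site_op_to_spin_inner:
  assumes "(L, L') \<in> sectors"
  shows "site_op C i (to_spin (L, L') w) \<bullet> to_spin (L, L') w' =
    (\<Sum>K\<in>Pow (- (L \<union> L')). ferm_site_op C i w $ (K \<union> L) $ (K \<union> L') * w' $ (K \<union> L) $ (K \<union> L'))"
proof -
  let ?J = "L \<union> L'"
  have t: "L \<inter> L' = {}" "even (card ?J)" using assms by (auto simp: sectors_def)
  have "site_op C i (to_spin (L, L') w) \<bullet> to_spin (L, L') w' =
     (\<Sum>K\<in>Pow (- ?J). \<Sum>S\<in>Pow ?J. site_op C i (to_spin (L, L') w) $ (K \<union> S) * to_spin (L, L') w' $ (K \<union> S))"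
    by (simp add: inner_vec_def sum_Pow_Un[of _ ?J])
  also have "\<dots> = (\<Sum>K\<in>Pow (- ?J). ferm_site_op C i w $ (K \<union> L) $ (K \<union> L') * w' $ (K \<union> L) $ (K \<union> L'))"
  proof (rule sum.cong[OF refl])
    fix K assume "K \<in> Pow (- ?J)"
    then have K: "K \<inter> ?J = {}" by auto
    let ?w' = "w' $ (K \<union> L) $ (K \<union> L')" and ?w = "w $ (K \<union> L) $ (K \<union> L')"
    let ?g = "jw_phase ?J K" and ?X = "ferm_site_op C i w $ (K \<union> L) $ (K \<union> L')"
    show "(\<Sum>S\<in>Pow ?J. site_op C i (to_spin (L, L') w) $ (K \<union> S) * to_spin (L, L') w' $ (K \<union> S)) = ?X * ?w'"
    proof (cases "i \<in> ?J")
      case True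
      have "(\<Sum>S\<in>Pow ?J. site_op C i (to_spin (L, L') w) $ (K \<union> S) * to_spin (L, L') w' $ (K \<union> S))
        = (\<Sum>S\<in>Pow ?J. ((\<Sum>q\<in>UNIV. C (i \<in> S) q * pairing ?J (put i q S)) * pairing ?J S) * (?g * ?g * ?w * ?w'))"
        by (rule sum.cong) (use True in \<open>auto simp: site_op_to_spin[OF t(1) K] to_spin_nth[OF K]\<close>)
      also have "\<dots> = (C True True + C False False) / 2 * (?w * ?w')"
        unfolding sum_distrib_right[symmetric] pairing_site[OF t(2) True] by simp
      finally show ?thesis using True by (simp add: ferm_site_op_sector[OF t(1) K])
    next
      case False
      have "(\<Sum>S\<in>Pow ?J. site_op C i (to_spin (L, L') w) $ (K \<union> S) * to_spin (L, L') w' $ (K \<union> S))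
        = (\<Sum>S\<in>Pow ?J. (pairing ?J S * pairing ?J S) * (?g * ?g * ?X * ?w'))"
        by (rule sum.cong) (use False in \<open>auto simp: site_op_to_spin[OF t(1) K] to_spin_nth[OF K]\<close>)
      also have "\<dots> = ?X * ?w'"
        unfolding sum_distrib_right[symmetric] pairing_norm[OF t(2)] by simp
      finally show ?thesis .
    qed
  qed
  finally show ?thesis .
qed

lemma even_card_sym_diff:
  fixes I K :: "'n::finite set"
  shows "even (card ((I - K) \<union> (K - I))) \<longleftrightarrow> even (card I + card K)"
proof -
  have "card I = card (I - K) + card (I \<inter> K)" "card K = card (K - I) + card (I \<inter> K)"
    by (metis card_Diff_subset_Int card_Int_Diff finite_code add.commute inf_commute)+
  moreover have "card ((I - K) \<union> (K - I)) = card (I - K) + card (K - I)"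
    by (rule card_Un_disjoint) auto
  ultimately show ?thesis by auto
qed

text \<open>Each pair \<open>I\<close>, \<open>K\<close> of index sets lies in exactly one
  configuration of inert sites, \<open>L = I - K\<close> and \<open>L' = K - I\<close>, with
  \<open>I \<inter> K\<close> doubly occupied. By \<open>even_card_sym_diff\<close> the
  configurations of even size are the pairs that \<open>even_part\<close> keeps.\<close>

lemma to_spin_form:
  fixes w :: "real ^ 'n set ^ 'n::finite set"
  shows "(\<Sum>t\<in>sectors. site_op C i (to_spin t w) \<bullet> to_spin t w') = ferm_site_op C i w \<bullet> even_part w'"
proof -
  let ?f = "\<lambda>(I, K). ferm_site_op C i w $ I $ K * w' $ I $ K"
  let ?D = "Sigma sectors (\<lambda>(L, L'). Pow (- (L \<union> L')))"
  have "(\<Sum>t\<in>sectors. site_op C i (to_spin t w) \<bullet> to_spin t w') =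
     (\<Sum>t\<in>sectors. \<Sum>K\<in>(case t of (L, L') \<Rightarrow> Pow (- (L \<union> L'))). ?f (K \<union> fst t, K \<union> snd t))"
    by (rule sum.cong) (auto simp: site_op_to_spin_inner)
  also have "\<dots> = (\<Sum>(t, K)\<in>?D. ?f (K \<union> fst t, K \<union> snd t))"
    by (rule sum.Sigma) auto
  also have "\<dots> = (\<Sum>p\<in>{(I, K). even (card I + card K)}. ?f p)"
  proof (rule sum.reindex_bij_witness[where i = "\<lambda>(I, K). ((I - K, K - I), I \<inter> K)" and j = "\<lambda>(t, K). (K \<union> fst t, K \<union> snd t)"])
    fix p :: "'n set \<times> 'n set"
    assume "p \<in> {(I, K). even (card I + card K)}"
    then show "(\<lambda>(I, K). ((I - K, K - I), I \<inter> K)) p \<in> ?D"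
      by (auto simp: sectors_def even_card_sym_diff)
  next
    fix a :: "('n set \<times> 'n set) \<times> 'n set"
    assume "a \<in> ?D"
    then obtain L L' K where a: "a = ((L, L'), K)" "L \<inter> L' = {}" "even (card (L \<union> L'))"
        "K \<subseteq> - L" "K \<subseteq> - L'"
      by (auto simp: sectors_def)
    have e: "(K \<union> L) - (K \<union> L') = L" "(K \<union> L') - (K \<union> L) = L'" "(K \<union> L) \<inter> (K \<union> L') = K" using a by auto
    then show "(\<lambda>(I, K). ((I - K, K - I), I \<inter> K)) ((\<lambda>(t, K). (K \<union> fst t, K \<union> snd t)) a) = a"
      using a by simp
    show "(\<lambda>(t, K). (K \<union> fst t, K \<union> snd t)) a \<in> {(I, K). even (card I + card K)}"
      using a even_card_sym_diff[of "K \<union> L" "K \<union> L'"] unfolding e by simp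
  qed auto
  also have "\<dots> = (\<Sum>p\<in>UNIV. if even (card (fst p) + card (snd p)) then ?f p else 0)"
    by (rule sum.mono_neutral_cong_left) auto
  also have "\<dots> = ferm_site_op C i w \<bullet> even_part w'"
    by (simp add: inner_vec_def even_part_def sum.cartesian_product case_prod_unfold if_distrib cong: if_cong)
  finally show ?thesis .
qed

text \<open>\<open>diag\<close> embeds spin vectors as the Fock states without singly occupied
  sites; on them the signs of the two species coincide and cancel.\<close>

lemma ferm_site_op_diag: "ferm_site_op C i (diag u) = diag (site_op C i u)"
proof -
  have "ferm_site_op C i (diag u) $ I $ K = diag (site_op C i u) $ I $ K" for I K
  proof (cases "I = K")
    case True
    then show ?thesis by (auto simp: ferm_site_op_def diag_nth site_op_nth intro!: sum.cong)
  next
    case False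
    then have "(i \<in> I) = (i \<in> K) \<Longrightarrow> put i q I \<noteq> put i q K" for q
      by (auto simp: put_def)
    with False show ?thesis by (simp add: ferm_site_op_def diag_nth)
  qed
  then show ?thesis by (simp add: vec_eq_iff)
qed

lemma even_part_diag: "even_part (diag u) = diag u"
  by (simp add: vec_eq_iff even_part_def diag_nth)

lemma inner_diag: "diag u \<bullet> diag u' = u \<bullet> (u' :: real ^ 'k::finite)"
proof -
  have "diag u \<bullet> diag u' = (\<Sum>I\<in>UNIV. \<Sum>K\<in>UNIV. if I = K then u $ I * u' $ I else 0)"
    unfolding inner_vec_def by (intro sum.cong refl) (simp add: diag_nth)
  then show ?thesis by (simp add: inner_vec_def)
qed

subsection \<open>Liftable forms\<close>

lemma inner_transpose: "transpose A \<bullet> transpose B = A \<bullet> (B :: real ^ 'a::finite ^ 'b::finite)"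
  unfolding inner_vec_def transpose_def by (simp, rule sum.swap)

lemma inner_matrix_mult_left:
  "(P ** w) \<bullet> w' = w \<bullet> (transpose P ** w')"
  for P :: "real ^ 'a::finite ^ 'b::finite" and w :: "real ^ 'c::finite ^ 'a"
proof -
  have "(P ** w) \<bullet> w' = (\<Sum>I\<in>UNIV. \<Sum>K\<in>UNIV. \<Sum>L\<in>UNIV. P $ I $ L * w $ L $ K * w' $ I $ K)"
    by (simp add: inner_vec_def matrix_matrix_mult_def sum_distrib_right)
  also have "\<dots> = (\<Sum>I\<in>UNIV. \<Sum>L\<in>UNIV. \<Sum>K\<in>UNIV. P $ I $ L * w $ L $ K * w' $ I $ K)"
    by (rule sum.cong[OF refl], rule sum.swap)
  also have "\<dots> = (\<Sum>L\<in>UNIV. \<Sum>I\<in>UNIV. \<Sum>K\<in>UNIV. P $ I $ L * w $ L $ K * w' $ I $ K)"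
    by (rule sum.swap)
  also have "\<dots> = (\<Sum>L\<in>UNIV. \<Sum>K\<in>UNIV. \<Sum>I\<in>UNIV. P $ I $ L * w $ L $ K * w' $ I $ K)"
    by (rule sum.cong[OF refl], rule sum.swap)
  also have "\<dots> = w \<bullet> (transpose P ** w')"
    by (simp add: inner_vec_def matrix_matrix_mult_def sum_distrib_left transpose_def mult_ac)
  finally show ?thesis .
qed

lemma inner_matrix_mult_right:
  "(w ** P) \<bullet> w' = w \<bullet> (w' ** transpose P)"
  for P :: "real ^ 'a::finite ^ 'b::finite" and w :: "real ^ 'b ^ 'c::finite"
proof -
  have "(w ** P) \<bullet> w' = (transpose P ** transpose w) \<bullet> transpose w'"
    by (simp only: inner_transpose matrix_transpose_mul[symmetric])
  also have "\<dots> = transpose w \<bullet> transpose (w' ** transpose P)"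
    by (simp only: inner_matrix_mult_left matrix_transpose_mul transpose_transpose)
  finally show ?thesis by (simp only: inner_transpose)
qed

lemma inner_conj_by:
  fixes P :: "real ^ 'a::finite ^ 'a"
  assumes "P ** P = mat 1" "transpose P = P"
  shows "conj_by P w \<bullet> conj_by P w' = w \<bullet> w'"
proof -
  have "conj_by P w \<bullet> conj_by P w' = (P ** w) \<bullet> (P ** w' ** P ** P)"
    by (subst inner_matrix_mult_right) (simp add: assms(2))
  also have "\<dots> = w \<bullet> (P ** (P ** w' ** P ** P))"
    by (subst inner_matrix_mult_left) (simp add: assms(2))
  also have "P ** (P ** w' ** P ** P) = (P ** P) ** w' ** (P ** P)"
    by (simp only: matrix_mul_assoc)
  finally show ?thesis by (simp add: assms)
qed

section \<open>Fermion parity\<close>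

definition parity_matrix :: "real ^ 'n set ^ 'n::finite set" where
  "parity_matrix = diag (\<chi> I. (-1) ^ card I)"

lemma diag_mult: "(diag x ** w) $ I $ K = x $ I * w $ I $ K" for w :: "real ^ 'b ^ 'a::finite"
proof -
  have "(diag x ** w) $ I $ K = (\<Sum>L\<in>UNIV. if I = L then x $ I * w $ I $ K else 0)"
    unfolding matrix_matrix_mult_def vec_lambda_beta by (rule sum.cong) (auto simp: diag_nth)
  then show ?thesis by simp
qed

lemma mult_diag: "(w ** diag x) $ I $ K = w $ I $ K * x $ K" for w :: "real ^ 'a::finite ^ 'b"
proof -
  have "(w ** diag x) $ I $ K = (\<Sum>L\<in>UNIV. if L = K then w $ I $ K * x $ K else 0)"
    unfolding matrix_matrix_mult_def vec_lambda_beta by (rule sum.cong) (auto simp: diag_nth)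
  then show ?thesis by simp
qed

lemma transpose_diag: "transpose (diag x) = diag x"
  by (simp add: vec_eq_iff transpose_def diag_nth)

lemma ann_parity: "ann j ** parity_matrix = - (parity_matrix ** ann j)"
  by (auto simp: vec_eq_iff parity_matrix_def diag_mult mult_diag ann_nth)

lemma annv_parity: "annv v ** parity_matrix = - (parity_matrix ** annv v)"
  by (simp add: annv_mult mult_annv ann_parity sum_negf)

lemma transpose_annv_parity:
  fixes v :: "real ^ 'n::finite"
  shows "transpose (annv v) ** parity_matrix = - (parity_matrix ** transpose (annv v))"
proof -
  let ?G = "parity_matrix :: real ^ 'n set ^ 'n set"
  have 1: "transpose (?G ** annv v) = transpose (- (annv v ** ?G))"
    by (simp add: annv_parity)
  have 2: "transpose (- B) = - transpose B" for B :: "real ^ 'n set ^ 'n set"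
    by (simp add: vec_eq_iff transpose_def)
  have 3: "transpose ?G = ?G"
    by (simp add: parity_matrix_def transpose_diag)
  show ?thesis using 1 unfolding 2 matrix_transpose_mul 3 .
qed

text \<open>A Fock reflection is quadratic in the fermions, and each of these anticommutes with the
  parity.\<close>

lemma fock_reflection_parity: "fock_reflection v ** parity_matrix = parity_matrix ** fock_reflection v"
proof -
  have "transpose (annv v) ** annv v ** parity_matrix = transpose (annv v) ** (annv v ** parity_matrix)"
    by (simp add: matrix_mul_assoc)
  also have "\<dots> = - ((transpose (annv v) ** parity_matrix) ** annv v)"
    by (simp add: annv_parity matrix_bilinear matrix_mul_assoc)
  also have "\<dots> = parity_matrix ** (transpose (annv v) ** annv v)"
    by (simp add: transpose_annv_parity matrix_bilinear matrix_mul_assoc)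
  finally show ?thesis
    by (simp add: fock_reflection_def matrix_bilinear)
qed

lemma even_part_eq:
  fixes w :: "real ^ 'n set ^ 'n::finite set"
  shows "even_part w = (1/2) *\<^sub>R (w + parity_matrix ** w ** parity_matrix)"
proof -
  have "even_part w $ I $ K = ((1/2) *\<^sub>R (w + parity_matrix ** w ** parity_matrix)) $ I $ K" for I K
    by (cases "even (card I)"; cases "even (card K)")
       (simp_all add: even_part_def parity_matrix_def diag_mult mult_diag)
  then show ?thesis unfolding vec_eq_iff by blast
qed

lemma even_part_conj_by:
  "even_part (conj_by (fock_reflection v) w) = conj_by (fock_reflection v) (even_part w)"
proof -
  let ?P = "fock_reflection v" and ?G = parity_matrix
  have "?G ** (?P ** w ** ?P) ** ?G = (?G ** ?P) ** w ** (?P ** ?G)"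
    by (simp only: matrix_mul_assoc)
  also have "\<dots> = (?P ** ?G) ** w ** (?G ** ?P)"
    by (simp only: fock_reflection_parity)
  also have "\<dots> = ?P ** (?G ** w ** ?G) ** ?P"
    by (simp only: matrix_mul_assoc)
  finally show ?thesis by (simp add: even_part_eq matrix_bilinear scaleR_add_right)
qed

lemma linear_even_part: "linear even_part"
  by (rule linearI) (simp_all add: vec_eq_iff even_part_def)

type_synonym 'n spin_form = "real ^ 'n \<Rightarrow> real ^ 'n set \<Rightarrow> real ^ 'n set \<Rightarrow> real"
type_synonym 'n fock_form = "real ^ 'n ^ 'n \<Rightarrow> real ^ 'n set ^ 'n set \<Rightarrow> real ^ 'n set ^ 'n set \<Rightarrow> real"

text \<open>The two clauses on diagonal matrices serve opposite directions: restriction to embedded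
  spin vectors passes positivity from the lift down to \<open>\<psi>\<close>, the decomposition over
  \<open>sectors\<close> passes it up. Reflection invariance reduces symmetric matrices to diagonal
  ones.\<close>

definition lifts :: "'n::finite fock_form \<Rightarrow> 'n spin_form \<Rightarrow> bool" where
  "lifts \<Psi> \<psi> \<longleftrightarrow>
     (\<forall>w w'. linear (\<lambda>A. \<Psi> A w w')) \<and> (\<forall>A w'. linear (\<lambda>w. \<Psi> A w w')) \<and> (\<forall>A w. linear (\<Psi> A w)) \<and>
     (\<forall>v A w w'. norm v = 1 \<longrightarrow> \<Psi> (conj_by (householder v) A) (conj_by (fock_reflection v) w)
        (conj_by (fock_reflection v) w') = \<Psi> A w w') \<and>
     (\<forall>x u u'. \<Psi> (diag x) (diag u) (diag u') = \<psi> x u u') \<and>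
     (\<forall>x w w'. \<Psi> (diag x) w w' = (\<Sum>t\<in>sectors. \<psi> x (to_spin t w) (to_spin t w')))"

definition liftable :: "'n::finite spin_form \<Rightarrow> bool" where
  "liftable \<psi> \<longleftrightarrow> (\<exists>\<Psi>. lifts \<Psi> \<psi>)"

text \<open>The matrix enters through a single \<open>ferm_op\<close>, hence linearly.
  \<open>even_part\<close> is placed in one argument so that only sectors with a singlet
  contribute.\<close>

lemma liftable_site_op:
  "liftable (\<lambda>(x :: real ^ 'n::finite) u u'. \<Sum>i\<in>UNIV. x $ i * (site_op C i u \<bullet> u'))"
proof -
  have "lifts (\<lambda>A w w'. ferm_op C A w \<bullet> even_part w') (\<lambda>(x :: real ^ 'n) u u'. \<Sum>i\<in>UNIV. x $ i * (site_op C i u \<bullet> u'))"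
    unfolding lifts_def
  proof (intro conjI allI impI)
    fix w w' :: "real ^ 'n set ^ 'n set" and A :: "real ^ 'n ^ 'n" and x :: "real ^ 'n"
    interpret L: linear "\<lambda>A :: real ^ 'n ^ 'n. ferm_op C A w" by (rule linear_ferm_op_left)
    interpret R: linear "ferm_op C A" by (rule linear_ferm_op)
    interpret E: linear "even_part :: real ^ 'n set ^ 'n set \<Rightarrow> real ^ 'n set ^ 'n set" by (rule linear_even_part)
    show "linear (\<lambda>A. ferm_op C A w \<bullet> even_part w')"
      by (rule linearI) (simp_all add: L.add L.scale inner_add_left)
    show "linear (\<lambda>w. ferm_op C A w \<bullet> even_part w')"
      by (rule linearI) (simp_all add: R.add R.scale inner_add_left)
    show "linear (\<lambda>w'. ferm_op C A w \<bullet> even_part w')"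
      by (rule linearI) (simp_all add: E.add E.scale inner_add_right)
    show "ferm_op C (diag x) w \<bullet> even_part w' = (\<Sum>t\<in>sectors. \<Sum>i\<in>UNIV. x $ i * (site_op C i (to_spin t w) \<bullet> to_spin t w'))"
      by (subst sum.swap) (simp add: ferm_op_diag inner_sum_left to_spin_form flip: sum_distrib_left)
    fix u u' :: "real ^ 'n set"
    show "ferm_op C (diag x) (diag u) \<bullet> even_part (diag u') = (\<Sum>i\<in>UNIV. x $ i * (site_op C i u \<bullet> u'))"
      by (simp add: ferm_op_diag inner_sum_left even_part_diag ferm_site_op_diag inner_diag)
    fix v :: "real ^ 'n" assume v: "norm v = 1"
    show "ferm_op C (conj_by (householder v) A) (conj_by (fock_reflection v) w) \<bullet> even_part (conj_by (fock_reflection v) w')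
        = ferm_op C A w \<bullet> even_part w'"
      unfolding ferm_op_reflection[OF v, symmetric] even_part_conj_by
      by (rule inner_conj_by) (simp_all add: fock_reflection_square v)
  qed
  then show ?thesis unfolding liftable_def by blast
qed

lemma liftable_zero: "liftable (\<lambda>x u u'. 0)"
  unfolding liftable_def lifts_def
  by (rule exI[of _ "\<lambda>A w w'. 0"]) (simp add: linear_zero)

lemma liftable_add:
  assumes "liftable \<psi>" "liftable \<psi>'"
  shows "liftable (\<lambda>x u u'. \<psi> x u u' + \<psi>' x u u')"
proof -
  obtain \<Psi> \<Psi>' where "lifts \<Psi> \<psi>" "lifts \<Psi>' \<psi>'" using assms by (auto simp: liftable_def)
  then have "lifts (\<lambda>A w w'. \<Psi> A w w' + \<Psi>' A w w') (\<lambda>x u u'. \<psi> x u u' + \<psi>' x u u')"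
    unfolding lifts_def by (auto simp: sum.distrib intro!: linear_compose_add)
  then show ?thesis unfolding liftable_def by blast
qed

lemma liftable_scale:
  assumes "liftable \<psi>"
  shows "liftable (\<lambda>x u u'. c * \<psi> x u u')"
proof -
  obtain \<Psi> where \<Psi>: "lifts \<Psi> \<psi>" using assms by (auto simp: liftable_def)
  have lin: "linear (\<lambda>x. c * f x)" if "linear f" for f :: "'b::real_vector \<Rightarrow> real"
    using linear_compose_scale_right[OF that, of c] by simp
  have "lifts (\<lambda>A w w'. c * \<Psi> A w w') (\<lambda>x u u'. c * \<psi> x u u')"
    using \<Psi> unfolding lifts_def by (auto intro!: lin simp flip: sum_distrib_left)
  then show ?thesis unfolding liftable_def by blast
qed

lemma liftable_sum:
  assumes "\<And>a. a \<in> S \<Longrightarrow> liftable (\<psi> a)"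
  shows "liftable (\<lambda>x u u'. \<Sum>a\<in>S. \<psi> a x u u')"
  using assms
proof (induction S rule: infinite_finite_induct)
  case (insert a S)
  then show ?case using liftable_add[of "\<psi> a" "\<lambda>x u u'. \<Sum>a\<in>S. \<psi> a x u u'"] by simp
qed (simp_all add: liftable_zero)

text \<open>The total site operators commute with \<^const>\<open>to_spin\<close> and do not depend on the
  matrix, so composing with them preserves liftability.\<close>

lemma liftable_total:
  fixes \<psi> :: "'n::finite spin_form"
  assumes "liftable \<psi>"
  shows "liftable (\<lambda>x u u'. \<psi> x (\<Sum>k\<in>UNIV. site_op C k u) u')"
proof -
  obtain \<Psi> where \<Psi>: "lifts \<Psi> \<psi>" using assms by (auto simp: liftable_def)
  let ?T = "ferm_op C (mat 1)"
  have "lifts (\<lambda>A w w'. \<Psi> A (?T w) w') (\<lambda>x u u'. \<psi> x (\<Sum>k\<in>UNIV. site_op C k u) u')"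
    unfolding lifts_def
  proof (intro conjI allI impI)
    fix w w' :: "real ^ 'n set ^ 'n set" and A :: "real ^ 'n ^ 'n" and x :: "real ^ 'n"
    show "linear (\<lambda>A. \<Psi> A (?T w) w')" "linear (\<Psi> A (?T w))"
      using \<Psi> by (simp_all add: lifts_def)
    have "linear (\<lambda>w. \<Psi> A w w')" using \<Psi> by (simp add: lifts_def)
    from linear_compose[OF linear_ferm_op this] show "linear (\<lambda>w. \<Psi> A (?T w) w')"
      by (simp add: o_def)
    show "\<Psi> (diag x) (?T w) w' = (\<Sum>t\<in>sectors. \<psi> x (\<Sum>k\<in>UNIV. site_op C k (to_spin t w)) (to_spin t w'))"
    proof -
      have "\<Psi> (diag x) (?T w) w' = (\<Sum>t\<in>sectors. \<psi> x (to_spin t (?T w)) (to_spin t w'))"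
        using \<Psi> unfolding lifts_def by blast
      then show ?thesis by (simp add: ferm_op_mat to_spin_total cong: sum.cong)
    qed
    fix u u' :: "real ^ 'n set"
    have "?T (diag u) = diag (\<Sum>k\<in>UNIV. site_op C k u)"
      by (simp add: ferm_op_mat ferm_site_op_diag vec_eq_iff diag_nth)
    moreover have "\<Psi> (diag x) (diag y) (diag u') = \<psi> x y u'" for y
      using \<Psi> unfolding lifts_def by blast
    ultimately show "\<Psi> (diag x) (?T (diag u)) (diag u') = \<psi> x (\<Sum>k\<in>UNIV. site_op C k u) u'"
      by simp
    fix v :: "real ^ 'n" assume v: "norm v = 1"
    have "?T (conj_by (fock_reflection v) w) = conj_by (fock_reflection v) (?T w)"
      using ferm_op_reflection[OF v, of C "mat 1" w] by (simp add: householder_square[OF v])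
    then show "\<Psi> (conj_by (householder v) A) (?T (conj_by (fock_reflection v) w)) (conj_by (fock_reflection v) w')
        = \<Psi> A (?T w) w'"
      using \<Psi> v by (simp add: lifts_def)
  qed
  then show ?thesis unfolding liftable_def by blast
qed

subsection \<open>Invariant forms are liftable\<close>

type_synonym op2 = "bool \<Rightarrow> bool \<Rightarrow> real"

definition one2 :: op2 where "one2 a b = (if a = b then 1 else 0)"

definition mult2 :: "op2 \<Rightarrow> op2 \<Rightarrow> op2" where
  "mult2 A C a c = (\<Sum>b\<in>UNIV. A a b * C b c)"

text \<open>The tensor product of the 2 by 2 matrices \<open>B j\<close>, applied to
  \<open>u\<close> and paired with \<open>u'\<close>.\<close>

definition tensor_form :: "('n \<Rightarrow> op2) \<Rightarrow> real ^ 'n set \<Rightarrow> real ^ 'n::finite set \<Rightarrow> real" where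
  "tensor_form B u u' = (\<Sum>M\<in>UNIV. \<Sum>K\<in>UNIV. (\<Prod>j\<in>UNIV. B j (j \<in> M) (j \<in> K)) * u $ K * u' $ M)"

text \<open>The average over the group, up to normalization; \<open>i0\<close> marks the one site
  whose coefficient in \<open>x\<close> is used.\<close>

definition sym_form :: "'n \<Rightarrow> ('n \<Rightarrow> op2) \<Rightarrow> 'n::finite spin_form" where
  "sym_form i0 B x u u' = (\<Sum>\<sigma>\<in>perms. x $ \<sigma> i0 * tensor_form (B \<circ> inv \<sigma>) u u')"

lemma one2_mult2 [simp]: "mult2 one2 C = C"
  by (simp add: fun_eq_iff mult2_def one2_def UNIV_bool)

text \<open>Exchanging the bit at \<open>k\<close> with the free bit is an involution on pairs of a
  set and a bit. It serves to move a site operator from the vector into the form.\<close>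

lemma sum_put:
  "(\<Sum>K\<in>UNIV. \<Sum>q\<in>UNIV. F K q (put k q K)) = (\<Sum>K\<in>UNIV. \<Sum>p\<in>UNIV. F (put k p K) (k \<in> K) K :: real)"
  for F :: "'n::finite set \<Rightarrow> bool \<Rightarrow> 'n set \<Rightarrow> real"
proof -
  have "(\<Sum>(K, q)\<in>UNIV. F K q (put k q K)) = (\<Sum>(K, p)\<in>UNIV. F (put k p K) (k \<in> K) K)"
    by (rule sum.reindex_bij_witness[where i = "\<lambda>(K, p). (put k p K, k \<in> K)" and j = "\<lambda>(K, q). (put k q K, k \<in> K)"])
       (auto simp: put_def insert_absorb split: if_splits)
  then show ?thesis by (simp add: sum.cartesian_product)
qed

lemma prod_put:
  fixes B :: "'n::finite \<Rightarrow> op2"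
  shows "(\<Prod>j\<in>UNIV. B j (j \<in> M) (j \<in> put k p K)) = B k (k \<in> M) p * (\<Prod>j\<in>UNIV - {k}. B j (j \<in> M) (j \<in> K))"
proof -
  have "(\<Prod>j\<in>UNIV. B j (j \<in> M) (j \<in> put k p K))
    = B k (k \<in> M) (k \<in> put k p K) * (\<Prod>j\<in>UNIV - {k}. B j (j \<in> M) (j \<in> put k p K))"
    by (simp add: prod.remove)
  also have "(\<Prod>j\<in>UNIV - {k}. B j (j \<in> M) (j \<in> put k p K)) = (\<Prod>j\<in>UNIV - {k}. B j (j \<in> M) (j \<in> K))"
    by (rule prod.cong) (auto simp: put_def)
  finally show ?thesis by (simp add: put_simps)
qed

lemma tensor_form_site_op:
  fixes B :: "'n::finite \<Rightarrow> op2"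
  shows "tensor_form B (site_op C k u) u' = tensor_form (B(k := mult2 (B k) C)) u u'"
  unfolding tensor_form_def
proof (rule sum.cong[OF refl])
  fix M
  let ?R = "\<lambda>K. \<Prod>j\<in>UNIV - {k}. B j (j \<in> M) (j \<in> K)"
  have "(\<Sum>K\<in>UNIV. (\<Prod>j\<in>UNIV. B j (j \<in> M) (j \<in> K)) * site_op C k u $ K * u' $ M)
    = (\<Sum>K\<in>UNIV. \<Sum>q\<in>UNIV. (\<Prod>j\<in>UNIV. B j (j \<in> M) (j \<in> K)) * (C (k \<in> K) q * u $ put k q K) * u' $ M)"
    by (simp add: site_op_nth sum_distrib_left sum_distrib_right)
  also have "\<dots> = (\<Sum>K\<in>UNIV. \<Sum>p\<in>UNIV. (\<Prod>j\<in>UNIV. B j (j \<in> M) (j \<in> put k p K)) * (C (k \<in> put k p K) (k \<in> K) * u $ K) * u' $ M)"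
    by (rule sum_put[where F = "\<lambda>K q L. (\<Prod>j\<in>UNIV. B j (j \<in> M) (j \<in> K)) * (C (k \<in> K) q * u $ L) * u' $ M"])
  also have "\<dots> = (\<Sum>K\<in>UNIV. mult2 (B k) C (k \<in> M) (k \<in> K) * ?R K * u $ K * u' $ M)"
    by (intro sum.cong refl) (simp add: prod_put put_simps mult2_def sum_distrib_left sum_distrib_right mult_ac)
  also have "\<dots> = (\<Sum>K\<in>UNIV. (\<Prod>j\<in>UNIV. (B(k := mult2 (B k) C)) j (j \<in> M) (j \<in> K)) * u $ K * u' $ M)"
  proof (rule sum.cong[OF refl])
    fix K
    have "(\<Prod>j\<in>UNIV - {k}. (B(k := mult2 (B k) C)) j (j \<in> M) (j \<in> K)) = ?R K"
      by (rule prod.cong) auto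
    then have "(\<Prod>j\<in>UNIV. (B(k := mult2 (B k) C)) j (j \<in> M) (j \<in> K)) = mult2 (B k) C (k \<in> M) (k \<in> K) * ?R K"
      by (subst prod.remove[of _ k]) simp_all
    then show "mult2 (B k) C (k \<in> M) (k \<in> K) * ?R K * u $ K * u' $ M
      = (\<Prod>j\<in>UNIV. (B(k := mult2 (B k) C)) j (j \<in> M) (j \<in> K)) * u $ K * u' $ M" by simp
  qed
  finally show "(\<Sum>K\<in>UNIV. (\<Prod>j\<in>UNIV. B j (j \<in> M) (j \<in> K)) * site_op C k u $ K * u' $ M)
    = (\<Sum>K\<in>UNIV. (\<Prod>j\<in>UNIV. (B(k := mult2 (B k) C)) j (j \<in> M) (j \<in> K)) * u $ K * u' $ M)" .
qed

lemma tensor_form_sum: "tensor_form B (\<Sum>k\<in>S. f k) u' = (\<Sum>k\<in>S. tensor_form B (f k) u')"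
proof -
  have lin: "linear (\<lambda>u. tensor_form B u u')"
    by (rule linearI) (simp_all add: tensor_form_def algebra_simps sum.distrib sum_distrib_left)
  show ?thesis by (rule linear_sum[OF lin])
qed

lemma prod_indicator: "(\<Prod>j\<in>UNIV. if P j then 1 else 0 :: real) = (if \<forall>j. P j then 1 else 0)"
  for P :: "'n::finite \<Rightarrow> bool"
  by (auto intro: prod_zero)

lemma tensor_form_one: "tensor_form (\<lambda>_. one2) u u' = u \<bullet> u'"
proof -
  have "(\<forall>j. (j \<in> M) = (j \<in> K)) = (M = K)" for M K :: "'n set" by auto
  then have "tensor_form (\<lambda>_. one2) u u' = (\<Sum>M\<in>UNIV. \<Sum>K\<in>UNIV. if M = K then u $ M * u' $ M else 0)"
    unfolding tensor_form_def one2_def prod_indicator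
    by (intro sum.cong refl) auto
  then show ?thesis by (simp add: inner_vec_def)
qed

lemma finite_perms: "finite (perms :: ('n::finite \<Rightarrow> 'n) set)"
  by simp

lemma sym_form_total:
  fixes B :: "'n::finite \<Rightarrow> op2"
  shows "sym_form i0 B x (\<Sum>k\<in>UNIV. site_op C k u) u' = (\<Sum>k\<in>UNIV. sym_form i0 (B(k := mult2 (B k) C)) x u u')"
proof -
  have "tensor_form (B \<circ> inv \<sigma>) (\<Sum>k\<in>UNIV. site_op C k u) u'
      = (\<Sum>k\<in>UNIV. tensor_form (B(k := mult2 (B k) C) \<circ> inv \<sigma>) u u')" if "\<sigma> \<in> perms" for \<sigma>
  proof -
    have bij: "bij \<sigma>" using that by (simp add: permutes_bij)
    have "tensor_form (B \<circ> inv \<sigma>) (\<Sum>k\<in>UNIV. site_op C k u) u'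
      = (\<Sum>k\<in>UNIV. tensor_form ((B \<circ> inv \<sigma>)(k := mult2 ((B \<circ> inv \<sigma>) k) C)) u u')"
      by (simp add: tensor_form_sum tensor_form_site_op)
    also have "\<dots> = (\<Sum>k\<in>UNIV. tensor_form ((B \<circ> inv \<sigma>)(\<sigma> k := mult2 ((B \<circ> inv \<sigma>) (\<sigma> k)) C)) u u')"
      by (rule sum.reindex_bij_betw[symmetric]) (rule bij)
    also have "\<dots> = (\<Sum>k\<in>UNIV. tensor_form (B(k := mult2 (B k) C) \<circ> inv \<sigma>) u u')"
    proof (rule sum.cong[OF refl])
      fix k
      have "(B \<circ> inv \<sigma>)(\<sigma> k := mult2 ((B \<circ> inv \<sigma>) (\<sigma> k)) C) = B(k := mult2 (B k) C) \<circ> inv \<sigma>"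
        using bij by (auto simp: fun_eq_iff bij_def inv_f_f surj_f_inv_f)
      then show "tensor_form ((B \<circ> inv \<sigma>)(\<sigma> k := mult2 ((B \<circ> inv \<sigma>) (\<sigma> k)) C)) u u'
        = tensor_form (B(k := mult2 (B k) C) \<circ> inv \<sigma>) u u'" by simp
    qed
    finally show ?thesis .
  qed
  then have "sym_form i0 B x (\<Sum>k\<in>UNIV. site_op C k u) u'
      = (\<Sum>\<sigma>\<in>perms. \<Sum>k\<in>UNIV. x $ \<sigma> i0 * tensor_form (B(k := mult2 (B k) C) \<circ> inv \<sigma>) u u')"
    unfolding sym_form_def by (intro sum.cong refl) (simp add: sum_distrib_left)
  also have "\<dots> = (\<Sum>k\<in>UNIV. sym_form i0 (B(k := mult2 (B k) C)) x u u')"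
    unfolding sym_form_def by (rule sum.swap)
  finally show ?thesis .
qed

text \<open>Reindexing the sum by \<open>\<pi>\<close> undoes the relabelling of the factors, and
  the coefficient stays the same since \<open>\<pi>\<close> fixes \<open>i0\<close>.\<close>

lemma sym_form_permute:
  fixes \<pi> :: "'n::finite \<Rightarrow> 'n"
  assumes \<pi>: "\<pi> permutes UNIV" "\<pi> i0 = i0"
  shows "sym_form i0 (B \<circ> \<pi>) = sym_form i0 B"
proof (intro ext)
  fix x u u'
  have "sym_form i0 (B \<circ> \<pi>) x u u' = (\<Sum>\<sigma>\<in>perms. x $ (\<sigma> \<circ> \<pi>) i0 * tensor_form (B \<circ> \<pi> \<circ> inv (\<sigma> \<circ> \<pi>)) u u')"
    unfolding sym_form_def by (rule sum_permutations_compose_right[OF \<pi>(1)])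
  also have "\<dots> = sym_form i0 B x u u'"
    unfolding sym_form_def
  proof (rule sum.cong[OF refl])
    fix \<sigma> :: "'n \<Rightarrow> 'n" assume "\<sigma> \<in> perms"
    then have "inv (\<sigma> \<circ> \<pi>) = inv \<pi> \<circ> inv \<sigma>" using \<pi>(1) by (simp add: o_inv_distrib permutes_bij)
    then have "B \<circ> \<pi> \<circ> inv (\<sigma> \<circ> \<pi>) = B \<circ> inv \<sigma>"
      using permutes_inv_o[OF \<pi>(1)] by (simp add: fun_eq_iff)
    then show "x $ (\<sigma> \<circ> \<pi>) i0 * tensor_form (B \<circ> \<pi> \<circ> inv (\<sigma> \<circ> \<pi>)) u u' = x $ \<sigma> i0 * tensor_form (B \<circ> inv \<sigma>) u u'"
      using \<pi>(2) by simp
  qed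
  finally show "sym_form i0 (B \<circ> \<pi>) x u u' = sym_form i0 B x u u'" .
qed

lemma sum_perms_apply:
  fixes f :: "'n::finite \<Rightarrow> real"
  shows "(\<Sum>\<sigma>\<in>perms. f (\<sigma> i0)) = card (perms :: ('n \<Rightarrow> 'n) set) / CARD('n) * (\<Sum>i\<in>UNIV. f i)"
proof -
  have same: "(\<Sum>\<sigma>\<in>perms. f (\<sigma> k)) = (\<Sum>\<sigma>\<in>perms. f (\<sigma> i0))" for k
  proof -
    have "Transposition.transpose i0 k permutes (UNIV :: 'n set)" by (rule permutes_swap_id) auto
    from sum_permutations_compose_right[OF this, of "\<lambda>\<sigma>. f (\<sigma> i0)"]
    show ?thesis by simp
  qed
  have "CARD('n) * (\<Sum>\<sigma>\<in>perms. f (\<sigma> i0)) = (\<Sum>k\<in>(UNIV :: 'n set). \<Sum>\<sigma>\<in>perms. f (\<sigma> i0))"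
    by simp
  also have "\<dots> = (\<Sum>k\<in>UNIV. \<Sum>\<sigma>\<in>perms. f (\<sigma> k))"
    by (intro sum.cong refl same[symmetric])
  also have "\<dots> = (\<Sum>\<sigma>\<in>perms. \<Sum>k\<in>UNIV. f (\<sigma> k))"
    by (rule sum.swap)
  also have "\<dots> = (\<Sum>\<sigma>\<in>(perms :: ('n \<Rightarrow> 'n) set). \<Sum>i\<in>UNIV. f i)"
    by (rule sum.cong[OF refl], rule sum.reindex_bij_betw) (simp add: permutes_bij)
  finally show ?thesis by (simp add: field_simps)
qed

lemma sum_Compl: "(\<Sum>k\<in>UNIV. f k) = (\<Sum>k\<in>-Z. f k) + (\<Sum>k\<in>Z. f k)"
  for f :: "'n::finite \<Rightarrow> 'b::comm_monoid_add"
  using sum.subset_diff[of Z UNIV f] by (simp add: Compl_eq_Diff_UNIV)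

text \<open>Induction on the number of nontrivial tensor factors besides the one at \<open>i0\<close>: composing
  the form with one factor \<open>C\<close> removed with the total action of \<open>C\<close> puts \<open>C\<close> back into each trivial slot,
  all of which give the same form, up to terms with fewer nontrivial factors.\<close>

lemma liftable_sym_form:
  fixes i0 :: "'n::finite"
  shows "liftable (sym_form i0 B)"
proof (induction "card {j. j \<noteq> i0 \<and> B j \<noteq> one2}" arbitrary: B rule: less_induct)
  case less
  let ?act = "\<lambda>B. {j. j \<noteq> i0 \<and> B j \<noteq> one2}"
  show ?case
  proof (cases "?act B = {}")
    case True
    \<comment> \<open>Without further factors the form depends on the permutation only through the
      image of \<open>i0\<close>; the constant is the number of permutations that carry
      \<open>i0\<close> to a given site.\<close>
    have "sym_form i0 B x u u' = card (perms :: ('n \<Rightarrow> 'n) set) / CARD('n) * (\<Sum>i\<in>UNIV. x $ i * (site_op (B i0) i u \<bullet> u'))" for x u u'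
    proof -
      have "tensor_form (B \<circ> inv \<sigma>) u u' = site_op (B i0) (\<sigma> i0) u \<bullet> u'" if "\<sigma> \<in> perms" for \<sigma>
      proof -
        have "bij \<sigma>" using that by (simp add: permutes_bij)
        then have "B \<circ> inv \<sigma> = (\<lambda>_. one2)(\<sigma> i0 := mult2 one2 (B i0))"
          using True by (auto simp: fun_eq_iff bij_def inv_f_f inv_f_eq)
            (metis surj_f_inv_f)
        then show ?thesis
          using tensor_form_site_op[of "\<lambda>_. one2" "B i0" "\<sigma> i0" u u'] by (simp add: tensor_form_one)
      qed
      then have "sym_form i0 B x u u' = (\<Sum>\<sigma>\<in>perms. x $ \<sigma> i0 * (site_op (B i0) (\<sigma> i0) u \<bullet> u'))"
        by (simp add: sym_form_def)
      also have "\<dots> = card (perms :: ('n \<Rightarrow> 'n) set) / CARD('n) * (\<Sum>i\<in>UNIV. x $ i * (site_op (B i0) i u \<bullet> u'))"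
        by (rule sum_perms_apply)
      finally show ?thesis .
    qed
    then have "sym_form i0 B = (\<lambda>x u u'. card (perms :: ('n \<Rightarrow> 'n) set) / CARD('n) * (\<Sum>i\<in>UNIV. x $ i * (site_op (B i0) i u \<bullet> u')))"
      by (intro ext)
    moreover have "liftable \<dots>" by (intro liftable_scale liftable_site_op)
    ultimately show ?thesis by (simp only:)
  next
    case False
    then obtain j0 where j0: "j0 \<noteq> i0" "B j0 \<noteq> one2" by auto
    define C where "C = B j0"
    define B0 where "B0 = B(j0 := one2)"
    \<comment> \<open>The slots at which \<open>C\<close> can return. Excluding \<open>i0\<close>
      ensures that the transposition with \<open>j0\<close> fixes \<open>i0\<close>;
      \<open>j0\<close> itself is in \<open>Z\<close>, so division by \<open>card Z\<close> is
      possible.\<close>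
    define Z where "Z = {k. k \<noteq> i0 \<and> B0 k = one2}"
    have act0: "?act B0 = ?act B - {j0}" by (auto simp: B0_def)
    have j0act: "j0 \<in> ?act B" using j0 by simp
    have less_act: "card (?act B0) < card (?act B)"
      unfolding act0 using j0act by (intro psubset_card_mono) auto
    have inZ: "sym_form i0 (B0(k := mult2 (B0 k) C)) = sym_form i0 B" if "k \<in> Z" for k
    proof -
      have "B0(k := mult2 (B0 k) C) = B \<circ> Transposition.transpose j0 k"
        by (rule ext) (use that in \<open>auto simp: Z_def B0_def C_def Transposition.transpose_def\<close>)
      moreover have "Transposition.transpose j0 k permutes UNIV" by (rule permutes_swap_id) auto
      moreover have "Transposition.transpose j0 k i0 = i0" using that j0 by (auto simp: Z_def Transposition.transpose_def)
      ultimately show ?thesis using sym_form_permute by metis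
    qed
    \<comment> \<open>Here \<open>C\<close> lands at \<open>i0\<close> or on a slot that is already
      nontrivial, so the count does not exceed that of \<open>B0\<close>.\<close>
    have notZ: "liftable (sym_form i0 (B0(k := mult2 (B0 k) C)))" if "k \<notin> Z" for k
    proof (rule less)
      have "?act (B0(k := mult2 (B0 k) C)) \<subseteq> ?act B0" using that by (auto simp: Z_def)
      then have "card (?act (B0(k := mult2 (B0 k) C))) \<le> card (?act B0)" by (intro card_mono) auto
      with less_act show "card (?act (B0(k := mult2 (B0 k) C))) < card (?act B)" by linarith
    qed
    have "j0 \<in> Z" using j0 by (simp add: Z_def B0_def)
    then have Zpos: "card Z > 0" by (auto simp: card_gt_0_iff)
    have "sym_form i0 B x u u' = (1 / card Z) * (sym_form i0 B0 x (\<Sum>k\<in>UNIV. site_op C k u) u'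
        + (-1) * (\<Sum>k\<in>-Z. sym_form i0 (B0(k := mult2 (B0 k) C)) x u u'))" for x u u'
    proof -
      have "sym_form i0 B0 x (\<Sum>k\<in>UNIV. site_op C k u) u' =
        (\<Sum>k\<in>-Z. sym_form i0 (B0(k := mult2 (B0 k) C)) x u u') + (\<Sum>k\<in>Z. sym_form i0 (B0(k := mult2 (B0 k) C)) x u u')"
        unfolding sym_form_total by (rule sum_Compl)
      also have "(\<Sum>k\<in>Z. sym_form i0 (B0(k := mult2 (B0 k) C)) x u u') = card Z * sym_form i0 B x u u'"
        by (simp add: inZ)
      finally have e: "sym_form i0 B0 x (\<Sum>k\<in>UNIV. site_op C k u) u' =
        (\<Sum>k\<in>-Z. sym_form i0 (B0(k := mult2 (B0 k) C)) x u u') + card Z * sym_form i0 B x u u'" .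
      have alg: "y = (1 / a) * ((r + a * y) + (-1) * r)" if "a > 0" for a r y :: real
        using that by simp
      show ?thesis unfolding e by (rule alg) (use Zpos in simp)
    qed
    then have "sym_form i0 B = (\<lambda>x u u'. (1 / card Z) * (sym_form i0 B0 x (\<Sum>k\<in>UNIV. site_op C k u) u'
        + (-1) * (\<Sum>k\<in>-Z. sym_form i0 (B0(k := mult2 (B0 k) C)) x u u')))"
      by (intro ext)
    moreover have "liftable \<dots>"
      by (rule liftable_scale[OF liftable_add[OF liftable_total[OF less(1)[OF less_act]] liftable_scale[OF liftable_sum]]])
         (rule notZ, simp)
    ultimately show ?thesis by (simp only:)
  qed
qed

lemma sum_rotate4:
  "(\<Sum>i\<in>A. \<Sum>j\<in>B. \<Sum>k\<in>C. \<Sum>l\<in>D. g i j k l) = (\<Sum>l\<in>D. \<Sum>i\<in>A. \<Sum>j\<in>B. \<Sum>k\<in>C. g i j k l)"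
proof -
  have "(\<Sum>i\<in>A. \<Sum>j\<in>B. \<Sum>k\<in>C. \<Sum>l\<in>D. g i j k l) = (\<Sum>i\<in>A. \<Sum>j\<in>B. \<Sum>l\<in>D. \<Sum>k\<in>C. g i j k l)"
    by (rule sum.cong[OF refl], rule sum.cong[OF refl], rule sum.swap)
  also have "\<dots> = (\<Sum>i\<in>A. \<Sum>l\<in>D. \<Sum>j\<in>B. \<Sum>k\<in>C. g i j k l)"
    by (rule sum.cong[OF refl], rule sum.swap)
  also have "\<dots> = (\<Sum>l\<in>D. \<Sum>i\<in>A. \<Sum>j\<in>B. \<Sum>k\<in>C. g i j k l)"
    by (rule sum.swap)
  finally show ?thesis .
qed

text \<open>An invariant form equals its own average, and averaging a single coefficient gives a
  \<open>sym_form\<close>, because every matrix unit of the tensor power is a tensor product of 2 by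
  2 matrix units.\<close>

lemma liftable_invariant:
  fixes c :: "'n::finite \<Rightarrow> 'n set \<Rightarrow> 'n set \<Rightarrow> real"
  assumes inv: "\<And>\<sigma> i K M. \<sigma> permutes UNIV \<Longrightarrow> c (\<sigma> i) (\<sigma> ` K) (\<sigma> ` M) = c i K M"
  shows "liftable (\<lambda>x u u'. \<Sum>i\<in>UNIV. \<Sum>K\<in>UNIV. \<Sum>M\<in>UNIV. x $ i * c i K M * u $ K * u' $ M)"
proof -
  define B :: "'n set \<Rightarrow> 'n set \<Rightarrow> 'n \<Rightarrow> op2"
    where "B = (\<lambda>K M j a b. if a = (j \<in> M) \<and> b = (j \<in> K) then 1 else 0)"
  let ?g = "card (perms :: ('n \<Rightarrow> 'n) set)"
  have "id \<in> (perms :: ('n \<Rightarrow> 'n) set)" by (simp add: permutes_id)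
  then have g: "?g > 0" using finite_perms card_gt_0_iff by blast
  have B: "tensor_form (B K M \<circ> inv \<sigma>) u u' = u $ (\<sigma> ` K) * u' $ (\<sigma> ` M)" if "\<sigma> permutes UNIV" for K M \<sigma> u u'
  proof -
    have mem: "(inv \<sigma> j \<in> K) = (j \<in> \<sigma> ` K)" for j K
    proof
      assume "inv \<sigma> j \<in> K"
      then show "j \<in> \<sigma> ` K" by (rule image_eqI[rotated]) (simp add: permutes_inverses[OF that])
    qed (auto simp: permutes_inverses[OF that])
    have "(\<forall>j. (j \<in> M') = (j \<in> X) \<and> (j \<in> K') = (j \<in> Y)) = (M' = X \<and> K' = Y)" for M' K' X Y :: "'n set"
      by auto
    then have "tensor_form (B K M \<circ> inv \<sigma>) u u' = (\<Sum>M'\<in>UNIV. \<Sum>K'\<in>UNIV.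
        (if K' = \<sigma> ` K then if M' = \<sigma> ` M then u $ (\<sigma> ` K) * u' $ (\<sigma> ` M) else 0 else 0))"
      unfolding tensor_form_def B_def o_def mem prod_indicator by (intro sum.cong refl) auto
    then show ?thesis by simp
  qed
  have "(\<Sum>i\<in>UNIV. \<Sum>K\<in>UNIV. \<Sum>M\<in>UNIV. x $ i * c i K M * u $ K * u' $ M)
    = (1 / ?g) * (\<Sum>i\<in>UNIV. \<Sum>K\<in>UNIV. \<Sum>M\<in>UNIV. c i K M * sym_form i (B K M) x u u')" for x u u'
  proof -
    let ?F = "\<lambda>i K M. x $ i * c i K M * u $ K * u' $ M"
    have "(\<Sum>i\<in>UNIV. \<Sum>K\<in>UNIV. \<Sum>M\<in>UNIV. c i K M * sym_form i (B K M) x u u')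
      = (\<Sum>i\<in>UNIV. \<Sum>K\<in>UNIV. \<Sum>M\<in>UNIV. \<Sum>\<sigma>\<in>perms. ?F (\<sigma> i) (\<sigma> ` K) (\<sigma> ` M))"
      unfolding sym_form_def sum_distrib_left
      by (intro sum.cong refl) (simp add: B inv mult_ac)
    also have "\<dots> = (\<Sum>\<sigma>\<in>perms. \<Sum>i\<in>UNIV. \<Sum>K\<in>UNIV. \<Sum>M\<in>UNIV. ?F (\<sigma> i) (\<sigma> ` K) (\<sigma> ` M))"
      by (rule sum_rotate4)
    also have "\<dots> = (\<Sum>\<sigma>\<in>(perms :: ('n \<Rightarrow> 'n) set). \<Sum>i\<in>UNIV. \<Sum>K\<in>UNIV. \<Sum>M\<in>UNIV. ?F i K M)"
    proof (rule sum.cong[OF refl])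
      fix \<sigma> :: "'n \<Rightarrow> 'n" assume "\<sigma> \<in> perms"
      then have b: "bij \<sigma>" by (simp add: permutes_bij)
      then have b': "bij ((`) \<sigma>)" by (metis bij_betw_Pow Pow_UNIV)
      have "(\<Sum>i\<in>UNIV. \<Sum>K\<in>UNIV. \<Sum>M\<in>UNIV. ?F (\<sigma> i) (\<sigma> ` K) (\<sigma> ` M))
        = (\<Sum>i\<in>UNIV. \<Sum>K\<in>UNIV. \<Sum>M\<in>UNIV. ?F (\<sigma> i) (\<sigma> ` K) M)"
        by (intro sum.cong refl sum.reindex_bij_betw[OF b'])
      also have "\<dots> = (\<Sum>i\<in>UNIV. \<Sum>K\<in>UNIV. \<Sum>M\<in>UNIV. ?F (\<sigma> i) K M)"
        by (rule sum.cong[OF refl], rule sum.reindex_bij_betw[OF b'])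
      also have "\<dots> = (\<Sum>i\<in>UNIV. \<Sum>K\<in>UNIV. \<Sum>M\<in>UNIV. ?F i K M)"
        by (rule sum.reindex_bij_betw[OF b])
      finally show "(\<Sum>i\<in>UNIV. \<Sum>K\<in>UNIV. \<Sum>M\<in>UNIV. ?F (\<sigma> i) (\<sigma> ` K) (\<sigma> ` M))
        = (\<Sum>i\<in>UNIV. \<Sum>K\<in>UNIV. \<Sum>M\<in>UNIV. ?F i K M)" .
    qed
    finally have e: "(\<Sum>i\<in>UNIV. \<Sum>K\<in>UNIV. \<Sum>M\<in>UNIV. c i K M * sym_form i (B K M) x u u')
      = ?g * (\<Sum>i\<in>UNIV. \<Sum>K\<in>UNIV. \<Sum>M\<in>UNIV. ?F i K M)" by simp
    have alg: "y = (1 / a) * (a * y)" if "a \<noteq> 0" for a y :: real using that by simp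
    show ?thesis unfolding e by (rule alg) (use g in linarith)
  qed
  then have "(\<lambda>x u u'. \<Sum>i\<in>UNIV. \<Sum>K\<in>UNIV. \<Sum>M\<in>UNIV. x $ i * c i K M * u $ K * u' $ M)
    = (\<lambda>x u u'. (1 / ?g) * (\<Sum>i\<in>UNIV. \<Sum>K\<in>UNIV. \<Sum>M\<in>UNIV. c i K M * sym_form i (B K M) x u u'))"
    by (intro ext)
  moreover have "liftable \<dots>"
    by (intro liftable_scale liftable_sum liftable_sym_form)
  ultimately show ?thesis by (simp only:)
qed

subsection \<open>Diagonalisation of symmetric matrices by reflections\<close>

lemma inner_symmetric_matrix:
  fixes A :: "real ^ 'n::finite ^ 'n"
  assumes "transpose A = A"
  shows "(A *v x) \<bullet> y = x \<bullet> (A *v y)"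
  by (metis assms dot_lmul_matrix transpose_matrix_vector)

lemma quadratic_nonneg_imp_zero:
  fixes a c :: real
  assumes "\<And>t. 0 \<le> 2 * t * a + t\<^sup>2 * c"
  shows "a = 0"
proof (rule ccontr)
  assume a: "a \<noteq> 0"
  \<comment> \<open>Chosen so that the linear term outweighs the quadratic one at
    \<open>- a / d\<close>.\<close>
  define d where "d = \<bar>c\<bar> + 1"
  have d: "d > 0" "c < 2 * d" by (auto simp: d_def)
  have "0 \<le> 2 * (- a / d) * a + (- a / d)\<^sup>2 * c" by (rule assms)
  also have "\<dots> = (a / d)\<^sup>2 * (c - 2 * d)"
    using d by (simp add: field_simps power2_eq_square)
  also have "\<dots> < 0"
    using a d by (intro mult_pos_neg) auto
  finally show False by simp
qed

text \<open>A maximiser \<open>v\<close> of the Rayleigh quotient on \<open>T\<close>, with value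
  \<open>l\<close>. The form \<open>l * (x \<bullet> x) - x \<bullet> (A *v x)\<close> is
  nonnegative on \<open>T\<close> and zero at \<open>v\<close>, so its first variation there
  vanishes; along the residual \<open>l *\<^sub>R v - A *v v\<close> this variation is twice the
  squared norm of the residual.\<close>

lemma symmetric_eigenvector:
  fixes A :: "real ^ 'n::finite ^ 'n"
  assumes sym: "transpose A = A" and T: "subspace T" "T \<noteq> {0}"
    and inv: "\<And>x. x \<in> T \<Longrightarrow> A *v x \<in> T"
  obtains v l where "v \<in> T" "norm v = 1" "A *v v = l *\<^sub>R v"
proof -
  let ?K = "T \<inter> sphere 0 1"
  obtain w where w: "w \<in> T" "w \<noteq> 0" using T subspace_0 by blast
  then have "(1 / norm w) *\<^sub>R w \<in> ?K" using T by (simp add: subspace_scale)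
  then have ne: "?K \<noteq> {}" by blast
  have comp: "compact ?K" using T closed_subspace by (intro closed_Int_compact) auto
  have cont: "continuous_on ?K (\<lambda>x. x \<bullet> (A *v x))"
    by (intro continuous_intros matrix_vector_mult_linear_continuous_on)
  obtain v where v: "v \<in> ?K" and max: "\<And>x. x \<in> ?K \<Longrightarrow> x \<bullet> (A *v x) \<le> v \<bullet> (A *v v)"
    using continuous_attains_sup[OF comp ne cont] by blast
  define l where "l = v \<bullet> (A *v v)"
  have le: "x \<bullet> (A *v x) \<le> l * (x \<bullet> x)" if "x \<in> T" for x
  proof (cases "x = 0")
    case False
    let ?y = "(1 / norm x) *\<^sub>R x"
    have "?y \<in> ?K" using that False T by (simp add: subspace_scale)
    then have "?y \<bullet> (A *v ?y) \<le> l" unfolding l_def by (rule max)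
    then have "(x \<bullet> (A *v x)) / (norm x)\<^sup>2 \<le> l"
      by (simp add: matrix_vector_mult_scaleR power2_eq_square)
    then show ?thesis using False by (simp add: divide_simps power2_norm_eq_inner split: if_splits)
  qed simp
  define r where "r = l *\<^sub>R v - A *v v"
  have vT: "v \<in> T" "norm v = 1" using v by auto
  then have rT: "r \<in> T" unfolding r_def using T inv by (intro subspace_diff subspace_scale) auto
  have vv: "v \<bullet> v = 1" using vT by (simp add: norm_eq_1)
  have "r \<bullet> r = 0"
  proof (rule quadratic_nonneg_imp_zero)
    fix t
    have "v + t *\<^sub>R r \<in> T" using T vT rT by (intro subspace_add subspace_scale) auto
    from le[OF this] have e0: "(v + t *\<^sub>R r) \<bullet> (A *v (v + t *\<^sub>R r)) \<le> l * ((v + t *\<^sub>R r) \<bullet> (v + t *\<^sub>R r))" .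
    have e1: "(v + t *\<^sub>R r) \<bullet> (A *v (v + t *\<^sub>R r)) = l + 2 * t * (r \<bullet> (A *v v)) + t\<^sup>2 * (r \<bullet> (A *v r))"
    proof -
      have "v \<bullet> (A *v r) = r \<bullet> (A *v v)" using inner_symmetric_matrix[OF sym, of v r] by (simp add: inner_commute)
      then show ?thesis
        by (simp add: matrix_vector_right_distrib matrix_vector_mult_scaleR inner_add_left inner_add_right
            l_def power2_eq_square algebra_simps)
    qed
    have e2: "(v + t *\<^sub>R r) \<bullet> (v + t *\<^sub>R r) = 1 + 2 * t * (v \<bullet> r) + t\<^sup>2 * (r \<bullet> r)"
      by (simp add: inner_add_left inner_add_right vv power2_eq_square algebra_simps inner_commute)
    have e3: "r \<bullet> (A *v v) = l * (v \<bullet> r) - r \<bullet> r"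
      by (simp add: r_def inner_diff_left inner_diff_right inner_commute algebra_simps)
    show "0 \<le> 2 * t * (r \<bullet> r) + t\<^sup>2 * (l * (r \<bullet> r) - r \<bullet> (A *v r))"
      using e0 unfolding e1 e2 e3 by (simp add: algebra_simps)
  qed
  then have "A *v v = l *\<^sub>R v" by (simp add: r_def)
  with vT show thesis by (rule that)
qed

definition diagonal_coords :: "real ^ 'n ^ 'n \<Rightarrow> 'n::finite set" where
  "diagonal_coords A = {j. \<forall>i. i \<noteq> j \<longrightarrow> A $ i $ j = 0}"

lemma matrix_axis: "(A *v axis j 1) $ i = (A :: real ^ 'n::finite ^ 'n) $ i $ j"
  by (simp add: matrix_vector_mult_basis column_def)

lemma axis_apply: "axis j a $ i = (if i = j then a else 0)"
  by (simp add: axis_def)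

lemma diagonal_coords_iff:
  "j \<in> diagonal_coords A \<longleftrightarrow> (\<exists>c. A *v axis j 1 = c *\<^sub>R axis j 1)"
proof
  assume "j \<in> diagonal_coords A"
  then have "A *v axis j 1 = (A $ j $ j) *\<^sub>R axis j 1"
    by (simp add: vec_eq_iff matrix_axis diagonal_coords_def axis_apply)
  then show "\<exists>c. A *v axis j 1 = c *\<^sub>R axis j 1" by blast
next
  assume "\<exists>c. A *v axis j 1 = c *\<^sub>R axis j 1"
  then obtain c where c: "A *v axis j 1 = c *\<^sub>R axis j 1" by blast
  have "A $ i $ j = 0" if "i \<noteq> j" for i
    using arg_cong[OF c, of "\<lambda>x. x $ i"] that by (simp add: matrix_axis axis_apply)
  then show "j \<in> diagonal_coords A" by (simp add: diagonal_coords_def)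
qed

text \<open>The mirror is the hyperplane bisecting the two unit vectors.\<close>

lemma householder_swap:
  fixes v e :: "real ^ 'n::finite"
  assumes "norm v = 1" "norm e = 1" "v \<noteq> e"
  defines "u \<equiv> (1 / norm (v - e)) *\<^sub>R (v - e)"
  shows "norm u = 1" "householder u *v v = e" "householder u *v e = v"
proof -
  show 1: "norm u = 1" using assms by simp
  have n: "(norm (v - e))\<^sup>2 = 2 * ((v - e) \<bullet> v)"
    using assms(1,2) by (simp add: power2_norm_eq_inner norm_eq_1 inner_diff_left inner_diff_right inner_commute)
  have "(2 * (u \<bullet> v)) *\<^sub>R u = (2 * ((v - e) \<bullet> v) / (norm (v - e))\<^sup>2) *\<^sub>R (v - e)"
    by (simp add: u_def power2_eq_square)
  also have "\<dots> = v - e" using assms(3) unfolding n[symmetric] by simp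
  finally show 2: "householder u *v v = e" by (simp add: householder_mult_vec)
  show "householder u *v e = v"
    using householder_square[OF 1] by (metis 2 matrix_vector_mul_assoc matrix_vector_mul_lid)
qed

lemma transpose_conj_by_householder:
  "transpose A = A \<Longrightarrow> transpose (conj_by (householder v) A) = conj_by (householder v) A"
  by (simp add: matrix_transpose_mul matrix_mul_assoc)

text \<open>A reflection carries an eigenvector to a coordinate axis. The eigenvector is taken
  orthogonal to the axes already split off, so these stay fixed and one more axis is gained. The
  form of an induction rule fits \<open>lifts\<close>, where invariance is known for one reflection
  at a time.\<close>

lemma symmetric_householder_induct [consumes 1, case_names reflect diag]:
  fixes A :: "real ^ 'n::finite ^ 'n"
  assumes "transpose A = A"
    and step: "\<And>A v. transpose A = A \<Longrightarrow> norm v = 1 \<Longrightarrow> P (conj_by (householder v) A) \<Longrightarrow> P A"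
    and diag: "\<And>x. P (diag x)"
  shows "P A"
  using assms(1)
proof (induction "card (- diagonal_coords A)" arbitrary: A rule: less_induct)
  case less
  note sym = less.prems
  show ?case
  proof (cases "diagonal_coords A = UNIV")
    case True
    then have "i \<noteq> j \<Longrightarrow> A $ i $ j = 0" for i j by (auto simp: diagonal_coords_def)
    then have "A = diag (\<chi> i. A $ i $ i)" by (auto simp: vec_eq_iff diag_nth)
    then show ?thesis using diag by metis
  next
    case False
    then obtain j where j: "j \<notin> diagonal_coords A" by auto
    define T where "T = {x :: real ^ 'n. \<forall>i\<in>diagonal_coords A. x $ i = 0}"
    have "subspace T" by (auto simp: T_def subspace_def)
    moreover have "axis j 1 \<in> T" using j by (auto simp: T_def axis_apply)
    then have "T \<noteq> {0}" using axis_eq_0_iff[of j "1::real"] by auto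
    moreover have "A *v x \<in> T" if x: "x \<in> T" for x
    proof -
      have "(A *v x) $ i = 0" if i: "i \<in> diagonal_coords A" for i
      proof -
        have "A $ i $ k * x $ k = 0" for k
        proof (cases "k = i")
          case True
          then show ?thesis using i x by (simp add: T_def)
        next
          case False
          then have "A $ k $ i = 0" using i by (simp add: diagonal_coords_def)
          then show ?thesis using transpose_nth[of A k i] by (simp add: sym)
        qed
        then show ?thesis unfolding matrix_vector_mult_def vec_lambda_beta by (intro sum.neutral) blast
      qed
      then show ?thesis by (simp add: T_def)
    qed
    ultimately obtain v l where v: "v \<in> T" "norm v = 1" "A *v v = l *\<^sub>R v"
      using symmetric_eigenvector[OF sym, of T] by blast
    let ?e = "axis j 1 :: real ^ 'n"
    have ne: "v \<noteq> ?e" using v(3) j by (auto simp: diagonal_coords_iff)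
    define u where "u = (1 / norm (v - ?e)) *\<^sub>R (v - ?e)"
    have u: "norm u = 1" "householder u *v v = ?e" "householder u *v ?e = v"
      using householder_swap[OF v(2) _ ne] by (auto simp: u_def)
    let ?A = "conj_by (householder u) A"
    have A: "?A *v x = householder u *v (A *v (householder u *v x))" for x
      by (simp add: matrix_vector_mul_assoc matrix_mul_assoc)
    have "diagonal_coords A \<subseteq> diagonal_coords ?A"
    proof
      fix i assume i: "i \<in> diagonal_coords A"
      then have "u $ i = 0" using v(1) j by (auto simp: u_def T_def axis_apply)
      then have h: "householder u *v axis i 1 = axis i 1"
        by (simp add: householder_mult_vec inner_axis)
      obtain c where "A *v axis i 1 = c *\<^sub>R axis i 1" using i diagonal_coords_iff by blast
      then have "?A *v axis i 1 = c *\<^sub>R axis i 1" by (simp add: A h matrix_vector_mult_scaleR)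
      then show "i \<in> diagonal_coords ?A" using diagonal_coords_iff by blast
    qed
    moreover have "j \<in> diagonal_coords ?A"
      using u v(3) by (auto simp: diagonal_coords_iff A matrix_vector_mult_scaleR)
    ultimately have "card (- diagonal_coords ?A) < card (- diagonal_coords A)"
      using j by (intro psubset_card_mono) auto
    then have "P ?A" using less.hyps transpose_conj_by_householder[OF sym] by blast
    then show ?thesis using step[OF sym u(1)] by blast
  qed
qed

section \<open>Eigenvalue vectors and spectral sets\<close>

lemma eigenvalue_vector_conj_by:
  fixes A H :: "real ^ 'n::finite ^ 'n"
  assumes "H ** H = mat 1"
  shows "eigenvalue_vector (conj_by H A) x \<longleftrightarrow> eigenvalue_vector A x"
proof -
  have "det (t *\<^sub>R mat 1 - conj_by H A) = det (t *\<^sub>R mat 1 - A)" for t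
  proof -
    have "t *\<^sub>R mat 1 - conj_by H A = conj_by H (t *\<^sub>R mat 1 - A)"
      by (simp add: matrix_bilinear assms)
    moreover have "det H * det H = 1" using assms by (metis det_I det_mul)
    ultimately show ?thesis by (simp add: det_mul mult.assoc mult.left_commute)
  qed
  then show ?thesis by (simp add: eigenvalue_vector_def)
qed

lemma eigenvalue_vector_diag:
  "eigenvalue_vector (diag x) y \<longleftrightarrow> (\<forall>t. (\<Prod>i\<in>UNIV. t - x $ i) = (\<Prod>i\<in>UNIV. t - y $ i))"
proof -
  have "det (t *\<^sub>R mat 1 - diag x) = (\<Prod>i\<in>UNIV. t - x $ i)" for t :: real
    by (subst det_diagonal) (simp_all add: mat_def diag_nth)
  then show ?thesis by (simp add: eigenvalue_vector_def)
qed

text \<open>A root of one product is a root of the other, so a common linear factor cancels; this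
  matches the roots with multiplicities.\<close>

lemma linear_factors_unique:
  fixes x :: "'a \<Rightarrow> 'c::idom" and y :: "'b \<Rightarrow> 'c"
  assumes "finite A" "finite B" "(\<Prod>i\<in>A. [:- x i, 1:]) = (\<Prod>i\<in>B. [:- y i, 1:])"
  shows "\<exists>f. bij_betw f A B \<and> (\<forall>i\<in>A. y (f i) = x i)"
  using assms
proof (induction A arbitrary: B rule: finite_induct)
  case empty
  have "B = {}"
  proof (rule ccontr)
    assume "B \<noteq> {}"
    then obtain b where b: "b \<in> B" by auto
    have "poly (\<Prod>i\<in>B. [:- y i, 1:]) (y b) = 0"
      unfolding poly_prod using b empty by (intro prod_zero) auto
    then show False using empty by simp
  qed
  then show ?case by (auto simp: bij_betw_def)
next
  case (insert a A)
  have "poly (\<Prod>i\<in>B. [:- y i, 1:]) (x a) = 0"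
    unfolding insert.prems(2)[symmetric] poly_prod using insert.hyps by (intro prod_zero) auto
  then obtain b where b: "b \<in> B" "y b = x a"
    unfolding poly_prod using insert.prems(1) by (auto simp: prod_zero_iff)
  have "[:- x a, 1:] * (\<Prod>i\<in>A. [:- x i, 1:]) = [:- x a, 1:] * (\<Prod>i\<in>B - {b}. [:- y i, 1:])"
    using insert b by (simp add: prod.remove[of B b])
  then have "(\<Prod>i\<in>A. [:- x i, 1:]) = (\<Prod>i\<in>B - {b}. [:- y i, 1:])"
    by (subst (asm) mult_left_cancel) auto
  then obtain f where f: "bij_betw f A (B - {b})" "\<forall>i\<in>A. y (f i) = x i"
    using insert.IH[of "B - {b}"] insert.prems(1) by auto
  let ?g = "f(a := b)"
  have "bij_betw ?g A (B - {b})" using f(1) insert.hyps(2) by (subst bij_betw_cong[of _ _ f]) auto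
  then have "bij_betw ?g (A \<union> {a}) ((B - {b}) \<union> {b})"
    using insert.hyps(2) by (intro bij_betw_combine) (auto simp: bij_betw_def)
  moreover have "(B - {b}) \<union> {b} = B" using b by auto
  ultimately have "bij_betw ?g (insert a A) B" by simp
  moreover have "\<forall>i\<in>insert a A. y (?g i) = x i" using f(2) b insert.hyps(2) by auto
  ultimately show ?case by blast
qed

text \<open>Any eigenvalue vector of \<open>diag x\<close> is a rearrangement of \<open>x\<close> by
  unique factorization, and \<open>S\<close> does not distinguish rearrangements.\<close>

lemma spectral_set_diag:
  fixes S :: "(real ^ 'n::finite) set"
  assumes "\<And>\<sigma> x. \<sigma> permutes UNIV \<Longrightarrow> permute_coords \<sigma> x \<in> S \<longleftrightarrow> x \<in> S"
  shows "diag x \<in> spectral_set S \<longleftrightarrow> x \<in> S"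
proof
  assume "x \<in> S"
  moreover have "eigenvalue_vector (diag x) x" by (simp add: eigenvalue_vector_diag)
  ultimately show "diag x \<in> spectral_set S"
    by (auto simp: spectral_set_def symmetric_matrices_def transpose_diag)
next
  assume "diag x \<in> spectral_set S"
  then obtain y where y: "y \<in> S" "\<And>t. (\<Prod>i\<in>UNIV. t - x $ i) = (\<Prod>i\<in>UNIV. t - y $ i)"
    by (auto simp: spectral_set_def eigenvalue_vector_diag)
  have "poly (\<Prod>i\<in>UNIV. [:- x $ i, 1:]) = poly (\<Prod>i\<in>UNIV. [:- y $ i, 1:])"
    using y(2) by (simp add: fun_eq_iff poly_prod)
  then have "(\<Prod>i\<in>UNIV. [:- x $ i, 1:]) = (\<Prod>i\<in>UNIV. [:- y $ i, 1:])"
    by (simp only: poly_eq_poly_eq_iff)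
  from linear_factors_unique[OF _ _ this] obtain f where f: "bij f" "\<And>i. y $ f i = x $ i"
    by auto
  have "permute_coords f x = y"
    using f by (simp add: permute_coords_def vec_eq_iff) (metis bij_inv_eq_iff)
  moreover have "f permutes UNIV" by (rule bij_imp_permutes) (use f(1) in auto)
  ultimately show "x \<in> S" using assms y(1) by metis
qed

subsection \<open>Specht modules with at most two rows\<close>

text \<open>The common form of row and column stabilizers, with \<open>F\<close> listing the entries
  of the rows or of the columns.\<close>

definition stabilizer :: "('i \<Rightarrow> 'n::finite set) \<Rightarrow> ('n \<Rightarrow> 'n) set" where
  "stabilizer F = {p\<in>perms. \<forall>i. p ` F i = F i}"

lemma stabilizer_perms: "p \<in> stabilizer F \<Longrightarrow> p permutes UNIV"
  by (simp add: stabilizer_def)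

lemma stabilizer_comp: "p \<in> stabilizer F \<Longrightarrow> q \<in> stabilizer F \<Longrightarrow> p \<circ> q \<in> stabilizer F"
  unfolding stabilizer_def by (simp add: permutes_compose image_comp[symmetric] del: comp_apply)

lemma stabilizer_inv:
  assumes "p \<in> stabilizer F"
  shows "inv p \<in> stabilizer F"
proof -
  have p: "p permutes UNIV" "\<And>i. p ` F i = F i" using assms by (auto simp: stabilizer_def)
  have "inv p ` F i = F i" for i
  proof -
    have "inv p ` F i = inv p ` (p ` F i)" by (simp only: p(2))
    also have "\<dots> = F i" by (simp add: image_comp permutes_inv_o[OF p(1)])
    finally show ?thesis .
  qed
  then show ?thesis by (simp add: stabilizer_def permutes_inv[OF p(1)])
qed

lemma stabilizer_sum_left:
  assumes "p \<in> stabilizer F"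
  shows "(\<Sum>q\<in>stabilizer F. f (p \<circ> q)) = (\<Sum>q\<in>stabilizer F. f q)"
proof (rule sum.reindex_bij_witness[where i = "\<lambda>q. inv p \<circ> q" and j = "\<lambda>q. p \<circ> q"])
  have p: "p permutes UNIV" using assms by (rule stabilizer_perms)
  show "inv p \<circ> (p \<circ> q) = q" "p \<circ> (inv p \<circ> q) = q" for q
    using permutes_inv_o[OF p] by (simp_all add: o_assoc)
qed (simp_all add: stabilizer_comp stabilizer_inv assms)

lemma stabilizer_sum_inv:
  "(\<Sum>q\<in>stabilizer F. f (inv q)) = (\<Sum>q\<in>stabilizer F. f q)"
  by (rule sum.reindex_bij_witness[where i = inv and j = inv])
     (auto intro: stabilizer_inv simp: permutes_inv_inv[where S = UNIV] stabilizer_perms)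

lemma linear_left_mult: "linear (left_mult \<sigma>)"
  by (rule linearI) (simp_all add: vec_eq_iff left_mult_def)

lemma inv_comp_perms:
  assumes "p permutes UNIV" "q permutes UNIV"
  shows "inv (p \<circ> q) = inv q \<circ> inv p"
  using assms by (simp add: o_inv_distrib permutes_bij)

lemma left_mult_comp:
  assumes "\<sigma> permutes UNIV" "\<tau> permutes UNIV"
  shows "left_mult (\<sigma> \<circ> \<tau>) x = left_mult \<sigma> (left_mult \<tau> x)"
  by (simp add: vec_eq_iff left_mult_def inv_comp_perms[OF assms] o_assoc)

lemma left_mult_axis:
  assumes "\<sigma> permutes UNIV"
  shows "left_mult \<sigma> (axis \<tau> c) = axis (\<sigma> \<circ> \<tau>) c"
proof -
  have "(inv \<sigma> \<circ> \<upsilon> = \<tau>) = (\<upsilon> = \<sigma> \<circ> \<tau>)" for \<upsilon>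
    using permutes_inv_o[OF assms] by (metis comp_assoc id_comp)
  then show ?thesis by (simp add: vec_eq_iff left_mult_def axis_def)
qed

lemma inner_left_mult:
  assumes "\<sigma> permutes UNIV"
  shows "left_mult \<sigma> x \<bullet> left_mult \<sigma> y = x \<bullet> y"
proof -
  have "bij (\<lambda>\<tau>. inv \<sigma> \<circ> \<tau>)"
    by (rule bij_betw_byWitness[where f' = "\<lambda>\<tau>. \<sigma> \<circ> \<tau>"])
       (auto simp: o_assoc permutes_inv_o[OF assms])
  from sum.reindex_bij_betw[OF this, of "\<lambda>\<tau>. x $ \<tau> * y $ \<tau>"]
  show ?thesis by (simp add: inner_vec_def left_mult_def)
qed

lemma inner_left_mult_inv:
  assumes "\<sigma> permutes UNIV"
  shows "left_mult \<sigma> x \<bullet> y = x \<bullet> left_mult (inv \<sigma>) y"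
proof -
  have "left_mult \<sigma> (left_mult (inv \<sigma>) y) = left_mult id y"
    by (simp add: permutes_inv_o[OF assms] flip: left_mult_comp[OF assms permutes_inv[OF assms]])
  also have "\<dots> = y" by (simp add: vec_eq_iff left_mult_def)
  finally show ?thesis using inner_left_mult[OF assms, of x "left_mult (inv \<sigma>) y"] by simp
qed

text \<open>With \<open>b\<close> the signed column sum and \<open>a\<close> the row sum, \<open>z = b a\<close> satisfies
  \<open>z \<bullet> z = card C * (a \<bullet> b a)\<close> and \<open>a \<bullet> b a\<close> is the coefficient of the identity in \<open>a b a\<close>.\<close>

lemma young_symmetrizer_row_sum_nonzero:
  fixes F :: "'i \<Rightarrow> 'n::finite set" and G :: "'j \<Rightarrow> 'n set"
  defines "R \<equiv> stabilizer F" and "C \<equiv> stabilizer G"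
  defines "z \<equiv> \<Sum>q\<in>C. \<Sum>p\<in>R. of_int (sign q) *\<^sub>R axis (q \<circ> p) 1 :: real ^ ('n \<Rightarrow> 'n)"
  assumes "(\<Sum>p\<in>R. left_mult p z) = 0"
  shows "z = 0"
proof -
  define a :: "real ^ ('n \<Rightarrow> 'n)" where "a = (\<Sum>p\<in>R. axis p 1)"
  have lin: "left_mult q (\<Sum>p\<in>A. f p) = (\<Sum>p\<in>A. left_mult q (f p))"
       "left_mult q (c *\<^sub>R x) = c *\<^sub>R left_mult q x"
      for q and A :: "('n \<Rightarrow> 'n) set" and f c x
    by (rule linear_sum[OF linear_left_mult], rule linear_scale[OF linear_left_mult])
  have perm: "p permutes UNIV" if "p \<in> R \<or> p \<in> C" for p
    using that by (auto simp: R_def C_def stabilizer_perms)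
  have z: "z = (\<Sum>q\<in>C. of_int (sign q) *\<^sub>R left_mult q a)"
    unfolding z_def by (intro sum.cong refl) (simp add: a_def lin scaleR_sum_right left_mult_axis perm)
  \<comment> \<open>The column stabilizer acts on \<open>z\<close> through the sign, by reindexing
    the signed sum.\<close>
  have col: "left_mult q z = of_int (sign q) *\<^sub>R z" if q: "q \<in> C" for q
  proof -
    have "left_mult q z = (\<Sum>q'\<in>C. of_int (sign q') *\<^sub>R left_mult (q \<circ> q') a)"
      using q by (simp add: z lin left_mult_comp perm)
    also have "\<dots> = (\<Sum>q'\<in>C. of_int (sign q * sign (q \<circ> q')) *\<^sub>R left_mult (q \<circ> q') a)"
    proof (rule sum.cong[OF refl])
      fix q' assume "q' \<in> C"
      then have "permutation q" "permutation q'"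
        using q perm permutes_imp_permutation by (metis finite_code)+
      then have "sign q * sign (q \<circ> q') = sign q'"
        by (simp add: sign_compose flip: mult.assoc)
      then show "of_int (sign q') *\<^sub>R left_mult (q \<circ> q') a = of_int (sign q * sign (q \<circ> q')) *\<^sub>R left_mult (q \<circ> q') a"
        by simp
    qed
    also have "\<dots> = (\<Sum>q'\<in>C. of_int (sign q * sign q') *\<^sub>R left_mult q' a)"
      using q unfolding C_def by (rule stabilizer_sum_left)
    also have "\<dots> = of_int (sign q) *\<^sub>R z"
      by (simp add: z scaleR_sum_right)
    finally show ?thesis .
  qed
  have "a \<bullet> z = (\<Sum>p\<in>R. left_mult p (axis id 1) \<bullet> z)"
    unfolding a_def by (simp add: inner_sum_left left_mult_axis perm)
  also have "\<dots> = (\<Sum>p\<in>R. axis id 1 \<bullet> left_mult (inv p) z)"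
    by (simp add: inner_left_mult_inv perm)
  also have "\<dots> = (\<Sum>p\<in>R. axis id 1 \<bullet> left_mult p z)"
    unfolding R_def by (rule stabilizer_sum_inv)
  also have "\<dots> = 0"
    using assms(4) by (simp flip: inner_sum_right)
  finally have az: "a \<bullet> z = 0" .
  have "z \<bullet> z = (\<Sum>q\<in>C. of_int (sign q) * (left_mult q a \<bullet> z))"
    by (subst (1) z) (simp add: inner_sum_left)
  also have "\<dots> = 0"
  proof (rule sum.neutral, rule ballI)
    fix q assume q: "q \<in> C"
    then have "inv q \<in> C" unfolding C_def by (rule stabilizer_inv)
    then have "left_mult q a \<bullet> z = 0"
      using q by (simp add: inner_left_mult_inv perm col az)
    then show "of_int (sign q) * (left_mult q a \<bullet> z) = 0" by simp
  qed
  finally show ?thesis by simp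
qed

lemma row_stabilizer_eq: "row_stabilizer \<mu> T = stabilizer (\<lambda>i. T ` {c\<in>young_diagram \<mu>. fst c = i})"
  by (simp add: row_stabilizer_def stabilizer_def)

lemma column_stabilizer_eq: "column_stabilizer \<mu> T = stabilizer (\<lambda>j. T ` {c\<in>young_diagram \<mu>. snd c = j})"
  by (simp add: column_stabilizer_def stabilizer_def)

text \<open>The sum of the row translates of the generator is invariant by reindexing. It is nonzero
  by \<open>young_symmetrizer_row_sum_nonzero\<close>, since the generator of a nonzero module is
  nonzero.\<close>

lemma specht_row_invariant:
  fixes T :: "nat \<times> nat \<Rightarrow> 'n::finite"
  assumes nz: "specht_module \<mu> T \<noteq> {0}"
  shows "\<exists>y\<in>specht_module \<mu> T. y \<noteq> 0 \<and> (\<forall>\<sigma>\<in>row_stabilizer \<mu> T. left_mult \<sigma> y = y)"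
proof -
  let ?R = "row_stabilizer \<mu> T" and ?C = "column_stabilizer \<mu> T"
  define z :: "real ^ ('n \<Rightarrow> 'n)" where "z = (\<Sum>q\<in>?C. \<Sum>p\<in>?R. of_int (sign q) *\<^sub>R axis (q \<circ> p) 1)"
  have gen: "(\<Sum>q\<in>?C. \<Sum>p\<in>?R. of_int (sign q) *\<^sub>R axis (\<sigma> \<circ> q \<circ> p) 1) = left_mult \<sigma> z"
    if "\<sigma> \<in> perms" for \<sigma>
    using that by (simp add: z_def linear_sum[OF linear_left_mult] linear_scale[OF linear_left_mult] left_mult_axis comp_assoc)
  then have specht: "specht_module \<mu> T = span ((\<lambda>\<sigma>. left_mult \<sigma> z) ` perms)"
    unfolding specht_module_def by (intro arg_cong[where f = span] image_cong refl)
  have "z \<noteq> 0"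
  proof
    assume "z = 0"
    then have "(\<lambda>\<sigma>. left_mult \<sigma> z) ` perms \<subseteq> {0}" by (auto simp: linear_0[OF linear_left_mult])
    then have "specht_module \<mu> T \<subseteq> {0}" unfolding specht
      by (metis span_mono span_0 insert_absorb span_insert_0 span_empty)
    moreover have "0 \<in> specht_module \<mu> T" unfolding specht by (rule span_0)
    ultimately show False using nz by blast
  qed
  let ?y = "\<Sum>p\<in>?R. left_mult p z"
  have "?y \<noteq> 0"
    using \<open>z \<noteq> 0\<close> young_symmetrizer_row_sum_nonzero unfolding z_def row_stabilizer_eq column_stabilizer_eq
    by blast
  moreover have "?y \<in> specht_module \<mu> T"
    unfolding specht by (intro span_sum span_base) (auto simp: row_stabilizer_def)
  moreover have "left_mult \<sigma> ?y = ?y" if \<sigma>: "\<sigma> \<in> ?R" for \<sigma>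
  proof -
    have "left_mult \<sigma> ?y = (\<Sum>p\<in>?R. left_mult (\<sigma> \<circ> p) z)"
      unfolding linear_sum[OF linear_left_mult]
      by (intro sum.cong refl left_mult_comp[symmetric]) (use \<sigma> in \<open>auto simp: row_stabilizer_def\<close>)
    also have "\<dots> = ?y" using \<sigma> unfolding row_stabilizer_eq by (rule stabilizer_sum_left)
    finally show ?thesis .
  qed
  ultimately show ?thesis by blast
qed

text \<open>With at most two rows the second is the complement of the first, so the row stabilizer
  is the stabilizer of one subset. This is where the bound on the number of parts enters.\<close>

lemma two_rows_stabilizer:
  fixes T :: "nat \<times> nat \<Rightarrow> 'n::finite"
  assumes T: "tableau \<mu> T" and len: "length \<mu> \<le> 2"
    and \<sigma>: "\<sigma> \<in> perms" "\<sigma> ` (T ` {c\<in>young_diagram \<mu>. fst c = 0}) = T ` {c\<in>young_diagram \<mu>. fst c = 0}"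
  shows "\<sigma> \<in> row_stabilizer \<mu> T"
proof -
  let ?row = "\<lambda>i. {c\<in>young_diagram \<mu>. fst c = i}"
  have T': "inj_on T (young_diagram \<mu>)" "T ` young_diagram \<mu> = UNIV"
    using T by (auto simp: tableau_def bij_betw_def)
  have rows: "?row 0 \<union> ?row 1 = young_diagram \<mu>"
    using len by (auto simp: young_diagram_def)
  have compl: "T ` ?row 1 = - T ` ?row 0"
  proof -
    have "T ` ?row 1 \<inter> T ` ?row 0 = T ` (?row 1 \<inter> ?row 0)"
      by (rule inj_on_image_Int[OF T'(1), symmetric]) auto
    moreover have "?row 1 \<inter> ?row 0 = {}" by auto
    ultimately have "T ` ?row 1 \<inter> T ` ?row 0 = {}" by (simp only: image_empty)
    moreover have "T ` ?row 0 \<union> T ` ?row 1 = UNIV"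
      unfolding image_Un[symmetric] rows by (rule T'(2))
    ultimately show ?thesis by blast
  qed
  have "\<sigma> ` (T ` ?row i) = T ` ?row i" for i
  proof -
    consider "i = 0" | "i = 1" | "i \<ge> 2" by linarith
    then show ?thesis
    proof cases
      case 2
      have "bij \<sigma>" using \<sigma>(1) by (simp add: permutes_bij)
      then have "\<sigma> ` (- T ` ?row 0) = - T ` ?row 0" using \<sigma>(2) by (simp add: bij_image_Compl_eq)
      then show ?thesis unfolding 2 compl .
    next
      case 3
      then have "?row i = {}" using len by (auto simp: young_diagram_def)
      then show ?thesis by (simp only: image_empty)
    qed (use \<sigma>(2) in simp)
  qed
  then show ?thesis using \<sigma>(1) by (simp add: row_stabilizer_def)
qed

subsection \<open>Short representations\<close>

lemma linear_on_sum:
  assumes "subspace V" "linear_on V f" "finite S" "\<And>a. a \<in> S \<Longrightarrow> x a \<in> V"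
  shows "f (\<Sum>a\<in>S. x a) = (\<Sum>a\<in>S. f (x a))"
  using assms(3,4)
proof (induction S)
  case empty
  have "f (0 *\<^sub>R 0) = 0 *\<^sub>R f 0" using assms(1,2) subspace_0 unfolding linear_on_def by blast
  then show ?case by simp
next
  case (insert a S)
  have "(\<Sum>a\<in>S. x a) \<in> V" using assms(1) insert by (intro subspace_sum) auto
  then have "f (x a + (\<Sum>a\<in>S. x a)) = f (x a) + f (\<Sum>a\<in>S. x a)"
    using assms(2) insert.prems by (simp add: linear_on_def)
  then show ?case using insert by simp
qed

lemma linear_on_0: "subspace V \<Longrightarrow> linear_on V f \<Longrightarrow> f 0 = 0"
  using linear_on_sum[of V f "{}"] by simp

lemma linear_on_scale: "linear_on V f \<Longrightarrow> v \<in> V \<Longrightarrow> f (c *\<^sub>R v) = c *\<^sub>R f v"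
  by (simp add: linear_on_def)

lemma linear_on_subset: "linear_on V f \<Longrightarrow> W \<subseteq> V \<Longrightarrow> linear_on W f"
  unfolding linear_on_def by blast

section \<open>Vectors fixed by two-block Young subgroups\<close>

locale orthogonal_rep =
  fixes \<rho> :: "('n::finite \<Rightarrow> 'n) \<Rightarrow> 'v::euclidean_space \<Rightarrow> 'v" and V :: "'v set"
  assumes rep: "symmetric_group_rep \<rho> V" and inner: "invariant_inner \<rho> V"
begin

lemma subspace_V: "subspace V"
  using rep by (simp add: symmetric_group_rep_def)

lemma linear_rep: "\<sigma> permutes UNIV \<Longrightarrow> linear_on V (\<rho> \<sigma>)"
  using rep by (simp add: symmetric_group_rep_def)

lemma rep_in: "\<sigma> permutes UNIV \<Longrightarrow> v \<in> V \<Longrightarrow> \<rho> \<sigma> v \<in> V"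
  using rep by (auto simp: symmetric_group_rep_def)

lemma rep_id: "v \<in> V \<Longrightarrow> \<rho> id v = v"
  using rep by (simp add: symmetric_group_rep_def)

lemma rep_comp: "\<sigma> permutes UNIV \<Longrightarrow> \<tau> permutes UNIV \<Longrightarrow> v \<in> V \<Longrightarrow> \<rho> (\<sigma> \<circ> \<tau>) v = \<rho> \<sigma> (\<rho> \<tau> v)"
  using rep by (simp add: symmetric_group_rep_def)

lemma rep_inv:
  assumes "\<sigma> permutes UNIV" "v \<in> V"
  shows "\<rho> (inv \<sigma>) (\<rho> \<sigma> v) = v" "\<rho> \<sigma> (\<rho> (inv \<sigma>) v) = v"
  using rep_comp[OF permutes_inv[OF assms(1)] assms] rep_comp[OF assms(1) permutes_inv[OF assms(1)] assms(2)]
  by (simp_all add: permutes_inv_o[OF assms(1)] rep_id[OF assms(2)])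

lemma rep_inner: "\<sigma> permutes UNIV \<Longrightarrow> u \<in> V \<Longrightarrow> v \<in> V \<Longrightarrow> \<rho> \<sigma> u \<bullet> \<rho> \<sigma> v = u \<bullet> v"
  using inner by (simp add: invariant_inner_def)

text \<open>The permutations preserving \<open>I\<close> form the Young subgroup with blocks
  \<open>I\<close> and its complement. As \<open>I\<close> may vary with the vector, only the span
  is a subspace in general.\<close>

definition young_fixed :: "'v set" where
  "young_fixed = {v\<in>V. \<exists>I. \<forall>\<sigma>. \<sigma> permutes UNIV \<and> \<sigma> ` I = I \<longrightarrow> \<rho> \<sigma> v = v}"

text \<open>Conjugation by \<open>\<tau>\<close> carries the stabilizer of \<open>I\<close> to that
  of its image.\<close>

lemma young_fixed_rep:
  assumes \<tau>: "\<tau> permutes UNIV" and v: "v \<in> young_fixed"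
  shows "\<rho> \<tau> v \<in> young_fixed"
proof -
  obtain I where vV: "v \<in> V" and I: "\<And>\<sigma>. \<sigma> permutes UNIV \<Longrightarrow> \<sigma> ` I = I \<Longrightarrow> \<rho> \<sigma> v = v"
    using v by (auto simp: young_fixed_def)
  have "\<rho> \<sigma> (\<rho> \<tau> v) = \<rho> \<tau> v" if \<sigma>: "\<sigma> permutes UNIV" "\<sigma> ` (\<tau> ` I) = \<tau> ` I" for \<sigma>
  proof -
    let ?c = "inv \<tau> \<circ> (\<sigma> \<circ> \<tau>)"
    have c: "?c permutes UNIV" using \<sigma>(1) \<tau> by (intro permutes_compose permutes_inv)
    have "?c ` I = inv \<tau> ` (\<sigma> ` (\<tau> ` I))" by (simp only: image_comp)
    also have "\<dots> = inv \<tau> ` (\<tau> ` I)" by (simp only: \<sigma>(2))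
    also have "\<dots> = I" by (simp only: image_comp permutes_inv_o[OF \<tau>] image_id id_apply)
    finally have "\<rho> ?c v = v" using c I by blast
    then have "\<rho> \<tau> (\<rho> ?c v) = \<rho> \<tau> v" by simp
    moreover have "\<rho> \<tau> (\<rho> ?c v) = \<rho> (\<tau> \<circ> ?c) v" using rep_comp[OF \<tau> c vV] by simp
    moreover have "\<tau> \<circ> ?c = \<sigma> \<circ> \<tau>" by (simp add: o_assoc permutes_inv_o[OF \<tau>])
    ultimately show ?thesis using rep_comp[OF \<sigma>(1) \<tau> vV] by simp
  qed
  then have "\<forall>\<sigma>. \<sigma> permutes UNIV \<and> \<sigma> ` (\<tau> ` I) = \<tau> ` I \<longrightarrow> \<rho> \<sigma> (\<rho> \<tau> v) = \<rho> \<tau> v"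
    by simp
  with rep_in[OF \<tau> vV] show ?thesis unfolding young_fixed_def mem_Collect_eq by (intro conjI exI)
qed

lemma span_young_fixed_subset: "span young_fixed \<subseteq> V"
  by (rule span_minimal[OF _ subspace_V]) (auto simp: young_fixed_def)

lemma span_young_fixed_rep:
  assumes \<tau>: "\<tau> permutes UNIV" and v: "v \<in> span young_fixed"
  shows "\<rho> \<tau> v \<in> span young_fixed"
proof -
  obtain t r where t: "finite t" "t \<subseteq> young_fixed" and v: "v = (\<Sum>a\<in>t. r a *\<^sub>R a)"
    using v unfolding span_explicit by auto
  have tV: "a \<in> V" if "a \<in> t" for a using t that by (auto simp: young_fixed_def)
  have "\<rho> \<tau> v = (\<Sum>a\<in>t. \<rho> \<tau> (r a *\<^sub>R a))"
    unfolding v by (rule linear_on_sum[OF subspace_V linear_rep[OF \<tau>] t(1)]) (simp add: subspace_scale subspace_V tV)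
  also have "\<dots> = (\<Sum>a\<in>t. r a *\<^sub>R \<rho> \<tau> a)"
    by (intro sum.cong refl linear_on_scale[OF linear_rep[OF \<tau>]] tV)
  also have "\<dots> \<in> span young_fixed"
    using t young_fixed_rep[OF \<tau>] by (intro span_sum span_scale span_base) auto
  finally show ?thesis .
qed

lemma orthogonal_complement_subrepresentation:
  assumes U: "subrepresentation \<rho> V U"
  shows "subrepresentation \<rho> V {v\<in>V. \<forall>u\<in>U. u \<bullet> v = 0}"
proof -
  have "u \<bullet> \<rho> \<sigma> v = 0" if \<sigma>: "\<sigma> permutes UNIV" and v: "v \<in> V" "\<forall>u\<in>U. u \<bullet> v = 0" and u: "u \<in> U" for \<sigma> u v
  proof -
    have "u \<in> V" using U u by (auto simp: subrepresentation_def)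
    have "\<rho> (inv \<sigma>) u \<in> U" using U u permutes_inv[OF \<sigma>] by (auto simp: subrepresentation_def)
    then have "\<rho> (inv \<sigma>) u \<bullet> v = 0" using v by blast
    moreover have "\<rho> (inv \<sigma>) u \<bullet> v = \<rho> \<sigma> (\<rho> (inv \<sigma>) u) \<bullet> \<rho> \<sigma> v"
      using rep_inner[OF \<sigma> rep_in[OF permutes_inv[OF \<sigma>] \<open>u \<in> V\<close>] v(1)] by simp
    ultimately show ?thesis by (simp add: rep_inv(2)[OF \<sigma> \<open>u \<in> V\<close>])
  qed
  moreover have "subspace {v\<in>V. \<forall>u\<in>U. u \<bullet> v = 0}"
    using subspace_V by (auto simp: subspace_def inner_add_right)
  ultimately show ?thesis using rep_in by (auto simp: subrepresentation_def)
qed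

lemma subrepresentation_rep:
  assumes W: "subrepresentation \<rho> V W"
  shows "symmetric_group_rep \<rho> W"
  using W rep unfolding symmetric_group_rep_def subrepresentation_def
  by (meson linear_on_subset subsetD)

text \<open>A nonzero subrepresentation of least dimension is irreducible.\<close>

lemma irreducible_subrepresentation_exists:
  assumes W: "subrepresentation \<rho> V W" "W \<noteq> {0}"
  shows "\<exists>W'\<subseteq>W. subrepresentation \<rho> V W' \<and> irreducible_rep \<rho> W'"
proof -
  let ?P = "\<lambda>W'. subrepresentation \<rho> V W' \<and> W' \<subseteq> W \<and> W' \<noteq> {0}"
  have "?P W" using W by blast
  from ex_has_least_nat[of ?P, OF this, of dim]
  obtain W' where W': "subrepresentation \<rho> V W'" "W' \<subseteq> W" "W' \<noteq> {0}"
    and least: "\<And>X. ?P X \<Longrightarrow> dim W' \<le> dim X" by blast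
  have "X = {0} \<or> X = W'" if X: "subrepresentation \<rho> W' X" for X
  proof (cases "X = {0}")
    case False
    have "?P X" using X W' False unfolding subrepresentation_def by blast
    then have "dim W' \<le> dim X" by (rule least)
    moreover have "X \<subseteq> W'" "subspace X" "subspace W'"
      using X W' by (auto simp: subrepresentation_def)
    ultimately show ?thesis using subspace_dim_equal by blast
  qed simp
  then have "irreducible_rep \<rho> W'"
    using subrepresentation_rep[OF W'(1)] W'(3) by (simp add: irreducible_rep_def)
  with W' show ?thesis by blast
qed

text \<open>The row-invariant vector of the Specht module is pulled back along the isomorphism; the
  subset is the first row of the tableau.\<close>

lemma irreducible_short_young_fixed:
  assumes W: "W \<subseteq> V" "irreducible_rep \<rho> W" and \<mu>: "length \<mu> \<le> 2" "corresponds_to \<rho> W \<mu>"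
  shows "\<exists>w\<in>W. w \<noteq> 0 \<and> w \<in> young_fixed"
proof -
  obtain T :: "nat \<times> nat \<Rightarrow> 'n" and f where T: "tableau \<mu> T" and f: "linear_on W f"
    "bij_betw f W (specht_module \<mu> T)" "\<And>\<sigma> v. \<sigma> \<in> perms \<Longrightarrow> v \<in> W \<Longrightarrow> f (\<rho> \<sigma> v) = left_mult \<sigma> (f v)"
    using \<mu>(2) by (auto simp: corresponds_to_def isomorphic_reps_def)
  have W': "subspace W" "W \<noteq> {0}" "\<And>\<sigma> v. \<sigma> \<in> perms \<Longrightarrow> v \<in> W \<Longrightarrow> \<rho> \<sigma> v \<in> W"
    using W(2) by (auto simp: irreducible_rep_def symmetric_group_rep_def)
  have f0: "f 0 = 0" using linear_on_0[OF W'(1) f(1)] .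
  have inj: "inj_on f W" and img: "f ` W = specht_module \<mu> T" using f(2) by (auto simp: bij_betw_def)
  have nz: "specht_module \<mu> T \<noteq> {0}"
  proof
    assume "specht_module \<mu> T = {0}"
    then have "f w = f 0" if "w \<in> W" for w
      using imageI[OF that, of f] unfolding img f0 by simp
    then have "w = 0" if "w \<in> W" for w
      using inj_onD[OF inj _ that subspace_0[OF W'(1)]] that by blast
    then show False using W'(2) subspace_0[OF W'(1)] by blast
  qed
  obtain y where y: "y \<in> specht_module \<mu> T" "y \<noteq> 0" "\<forall>\<sigma>\<in>row_stabilizer \<mu> T. left_mult \<sigma> y = y"
    using specht_row_invariant[OF nz] by (elim bexE conjE) (rule that)
  obtain w where w: "w \<in> W" "f w = y" using y(1) unfolding img[symmetric] by (elim imageE) simp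
  have "\<rho> \<sigma> w = w" if \<sigma>: "\<sigma> permutes UNIV"
      "\<sigma> ` (T ` {c\<in>young_diagram \<mu>. fst c = 0}) = T ` {c\<in>young_diagram \<mu>. fst c = 0}" for \<sigma>
  proof -
    have p: "\<sigma> \<in> perms" using \<sigma>(1) by simp
    have "f (\<rho> \<sigma> w) = f w"
      using f(3)[OF p w(1)] bspec[OF y(3) two_rows_stabilizer[OF T \<mu>(1) p \<sigma>(2)]] w(2) by simp
    then show ?thesis by (rule inj_onD[OF inj _ W'(3)[OF p w(1)] w(1)])
  qed
  then have "\<forall>\<sigma>. \<sigma> permutes UNIV \<and> \<sigma> ` (T ` {c\<in>young_diagram \<mu>. fst c = 0}) = T ` {c\<in>young_diagram \<mu>. fst c = 0}
      \<longrightarrow> \<rho> \<sigma> w = w"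
    by simp
  moreover have "w \<in> V" using w(1) W(1) by blast
  ultimately have "w \<in> young_fixed" unfolding young_fixed_def mem_Collect_eq by (intro conjI exI)
  moreover have "w \<noteq> 0" using w(2) y(2) f0 by auto
  ultimately show ?thesis using w(1) by blast
qed

text \<open>A nonzero orthogonal complement of the span would contain an irreducible constituent,
  hence a nonzero vector of \<open>young_fixed\<close>, which would be orthogonal to itself.\<close>

lemma short_span_young_fixed:
  assumes "short \<rho> V"
  shows "span young_fixed = V"
proof -
  let ?U = "span young_fixed"
  let ?W = "{v\<in>V. \<forall>u\<in>?U. u \<bullet> v = 0}"
  have U: "subrepresentation \<rho> V ?U"
    using span_young_fixed_subset span_young_fixed_rep by (auto simp: subrepresentation_def)
  note W = orthogonal_complement_subrepresentation[OF U]
  have "?W = {0}"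
  proof (rule ccontr)
    assume "?W \<noteq> {0}"
    then obtain X where X: "X \<subseteq> ?W" "subrepresentation \<rho> V X" "irreducible_rep \<rho> X"
      using irreducible_subrepresentation_exists[OF W] by blast
    then obtain \<mu> where "length \<mu> \<le> 2" "corresponds_to \<rho> X \<mu>"
      using assms unfolding short_def by blast
    then obtain w where w: "w \<in> X" "w \<noteq> 0" "w \<in> young_fixed"
      using irreducible_short_young_fixed[of X \<mu>] X by blast
    then have "w \<bullet> w = 0" using X(1) span_base by blast
    then show False using w by simp
  qed
  have "V \<subseteq> ?U"
  proof
    fix v assume v: "v \<in> V"
    obtain y z where yz: "y \<in> ?U" "\<And>w. w \<in> ?U \<Longrightarrow> orthogonal z w" "v = y + z"
      using orthogonal_subspace_decomp_exists[of young_fixed v] by blast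
    have "z = v - y" using yz by simp
    then have "z \<in> V" using v yz(1) span_young_fixed_subset subspace_V by (auto intro: subspace_diff)
    then have "z \<in> ?W" using yz(2) by (auto simp: orthogonal_def inner_commute)
    then have "z = 0" using \<open>?W = {0}\<close> by blast
    then show "v \<in> ?U" using yz by simp
  qed
  then show ?thesis using span_young_fixed_subset by blast
qed

end

section \<open>From positive forms to spectrahedral cones\<close>

lemma spectrahedral_cone_forms:
  fixes \<Psi> :: "'b \<Rightarrow> 'b \<Rightarrow> 'a::euclidean_space \<Rightarrow> 'w::euclidean_space \<Rightarrow> 'w \<Rightarrow> real"
  assumes B: "finite B"
    and linA: "\<And>b c w w'. linear (\<lambda>A. \<Psi> b c A w w')"
    and lin1: "\<And>b c A w'. linear (\<lambda>w. \<Psi> b c A w w')"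
    and lin2: "\<And>b c A w. linear (\<Psi> b c A w)"
  shows "spectrahedral_cone_in U {A\<in>U. \<forall>\<omega>. 0 \<le> (\<Sum>b\<in>B. \<Sum>c\<in>B. \<Psi> b c A (\<omega> b) (\<omega> c))}"
proof -
  let ?I = "B \<times> (Basis :: 'w set)"
  define N where "N = card ?I"
  obtain e where e: "bij_betw e {..<N} ?I"
    using ex_bij_betw_nat_finite[of ?I] B by (auto simp: N_def lessThan_atLeast0)
  define M where "M A p q = \<Psi> (fst p) (fst q) A (snd p) (snd q)" for A p q
  \<comment> \<open>The forms need not be symmetric; symmetrizing their Gram matrix does not change
    the quadratic form.\<close>
  define L where "L A i j = (M A (e i) (e j) + M A (e j) (e i)) / 2" for A i j
  have form: "(\<Sum>i<N. \<Sum>j<N. v i * L A i j * v j)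
      = (\<Sum>b\<in>B. \<Sum>c\<in>B. \<Psi> b c A (\<Sum>k\<in>Basis. v (inv_into {..<N} e (b, k)) *\<^sub>R k)
           (\<Sum>k\<in>Basis. v (inv_into {..<N} e (c, k)) *\<^sub>R k))" for A and v :: "nat \<Rightarrow> real"
  proof -
    let ?v = "\<lambda>p. v (inv_into {..<N} e p)"
    have ev: "?v (e i) = v i" if "i < N" for i
      using e that by (simp add: bij_betw_def inv_into_f_f)
    have "(\<Sum>i<N. \<Sum>j<N. v i * L A i j * v j)
      = (\<Sum>i<N. \<Sum>j<N. v i * M A (e i) (e j) * v j) / 2 + (\<Sum>i<N. \<Sum>j<N. v i * M A (e j) (e i) * v j) / 2"
      by (simp add: L_def sum_divide_distrib field_simps flip: sum.distrib)
    also have "(\<Sum>i<N. \<Sum>j<N. v i * M A (e j) (e i) * v j) = (\<Sum>i<N. \<Sum>j<N. v i * M A (e i) (e j) * v j)"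
      by (subst sum.swap) (simp add: mult_ac)
    also have "(\<Sum>i<N. \<Sum>j<N. v i * M A (e i) (e j) * v j) / 2 + (\<Sum>i<N. \<Sum>j<N. v i * M A (e i) (e j) * v j) / 2
      = (\<Sum>i<N. \<Sum>j<N. ?v (e i) * M A (e i) (e j) * ?v (e j))"
      by (simp add: ev)
    also have "\<dots> = (\<Sum>i<N. \<Sum>q\<in>?I. ?v (e i) * M A (e i) q * ?v q)"
      by (rule sum.cong[OF refl], rule sum.reindex_bij_betw[OF e])
    also have "\<dots> = (\<Sum>p\<in>?I. \<Sum>q\<in>?I. ?v p * M A p q * ?v q)"
      by (rule sum.reindex_bij_betw[OF e])
    also have "\<dots> = (\<Sum>b\<in>B. \<Sum>k\<in>Basis. \<Sum>c\<in>B. \<Sum>l\<in>Basis. ?v (b, k) * \<Psi> b c A k l * ?v (c, l))"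
      by (simp add: M_def sum.cartesian_product')
    also have "\<dots> = (\<Sum>b\<in>B. \<Sum>c\<in>B. \<Sum>k\<in>Basis. \<Sum>l\<in>Basis. ?v (b, k) * \<Psi> b c A k l * ?v (c, l))"
      by (rule sum.cong[OF refl], rule sum.swap)
    also have "\<dots> = (\<Sum>b\<in>B. \<Sum>c\<in>B. \<Psi> b c A (\<Sum>k\<in>Basis. ?v (b, k) *\<^sub>R k) (\<Sum>k\<in>Basis. ?v (c, k) *\<^sub>R k))"
    proof (intro sum.cong refl)
      fix b c
      have 1: "\<Psi> b c A (\<Sum>k\<in>Basis. ?v (b, k) *\<^sub>R k) w' = (\<Sum>k\<in>Basis. ?v (b, k) * \<Psi> b c A k w')" for w'
        by (simp add: linear_sum[OF lin1] linear_scale[OF lin1])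
      have 2: "\<Psi> b c A w (\<Sum>k\<in>Basis. ?v (c, k) *\<^sub>R k) = (\<Sum>k\<in>Basis. ?v (c, k) * \<Psi> b c A w k)" for w
        by (simp add: linear_sum[OF lin2] linear_scale[OF lin2])
      show "(\<Sum>k\<in>Basis. \<Sum>l\<in>Basis. ?v (b, k) * \<Psi> b c A k l * ?v (c, l))
        = \<Psi> b c A (\<Sum>k\<in>Basis. ?v (b, k) *\<^sub>R k) (\<Sum>k\<in>Basis. ?v (c, k) *\<^sub>R k)"
        unfolding 1 unfolding 2 by (simp add: sum_distrib_left mult_ac)
    qed
    finally show ?thesis .
  qed
  have "psd_matrix N (L A) \<longleftrightarrow> (\<forall>\<omega>. 0 \<le> (\<Sum>b\<in>B. \<Sum>c\<in>B. \<Psi> b c A (\<omega> b) (\<omega> c)))" for A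
  proof
    assume psd: "psd_matrix N (L A)"
    show "\<forall>\<omega>. 0 \<le> (\<Sum>b\<in>B. \<Sum>c\<in>B. \<Psi> b c A (\<omega> b) (\<omega> c))"
    proof
      fix \<omega> :: "'b \<Rightarrow> 'w"
      define v where "v i = \<omega> (fst (e i)) \<bullet> snd (e i)" for i
      have "(\<Sum>k\<in>Basis. v (inv_into {..<N} e (b, k)) *\<^sub>R k) = \<omega> b" if "b \<in> B" for b
      proof -
        have "e (inv_into {..<N} e (b, k)) = (b, k)" if "k \<in> Basis" for k
          using e that \<open>b \<in> B\<close> by (auto simp: bij_betw_def intro!: f_inv_into_f)
        then have "(\<Sum>k\<in>Basis. v (inv_into {..<N} e (b, k)) *\<^sub>R k) = (\<Sum>k\<in>Basis. (\<omega> b \<bullet> k) *\<^sub>R k)"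
          by (simp add: v_def)
        then show ?thesis by (simp add: euclidean_representation)
      qed
      then have "(\<Sum>i<N. \<Sum>j<N. v i * L A i j * v j) = (\<Sum>b\<in>B. \<Sum>c\<in>B. \<Psi> b c A (\<omega> b) (\<omega> c))"
        unfolding form by simp
      moreover have "0 \<le> (\<Sum>i<N. \<Sum>j<N. v i * L A i j * v j)"
        using psd unfolding psd_matrix_def by blast
      ultimately show "0 \<le> (\<Sum>b\<in>B. \<Sum>c\<in>B. \<Psi> b c A (\<omega> b) (\<omega> c))" by linarith
    qed
  next
    assume nonneg: "\<forall>\<omega>. 0 \<le> (\<Sum>b\<in>B. \<Sum>c\<in>B. \<Psi> b c A (\<omega> b) (\<omega> c))"
    show "psd_matrix N (L A)"
      unfolding psd_matrix_def
    proof (intro conjI allI impI)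
      fix v :: "nat \<Rightarrow> real"
      show "0 \<le> (\<Sum>i<N. \<Sum>j<N. v i * L A i j * v j)"
        unfolding form by (rule nonneg[rule_format])
    qed (simp add: L_def add.commute)
  qed
  moreover have "linear_on U (\<lambda>A. L A i j)" for i j
    by (simp add: linear_on_def L_def M_def linear_add[OF linA] linear_scale[OF linA] field_simps)
  moreover have "L A i j = L A j i" for A i j by (simp add: L_def add.commute)
  ultimately show ?thesis
    unfolding spectrahedral_cone_in_def by (intro exI[of _ N] exI[of _ L]) auto
qed

text \<open>A set \<open>K\<close> in the orbit of \<open>I\<close> goes to the translate of
  \<open>v\<close> by any permutation carrying \<open>I\<close> to \<open>K\<close>; the choice is
  immaterial as the stabilizer of \<open>I\<close> fixes \<open>v\<close>. Sets of other sizes go to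
  0. The linear extension maps the tensor power of \<real>^2 to \<open>V\<close> equivariantly and
  reaches \<open>v\<close>.\<close>

lemma (in orthogonal_rep) orbit_map_exists:
  assumes "v \<in> young_fixed"
  shows "\<exists>f. (\<exists>I. f I = v) \<and> (\<forall>K. f K \<in> V) \<and> (\<forall>\<sigma> K. \<sigma> permutes UNIV \<longrightarrow> f (\<sigma> ` K) = \<rho> \<sigma> (f K))"
proof -
  obtain I where v: "v \<in> V" and fixed: "\<And>\<sigma>. \<sigma> permutes UNIV \<Longrightarrow> \<sigma> ` I = I \<Longrightarrow> \<rho> \<sigma> v = v"
    using assms by (auto simp: young_fixed_def)
  define P where "P K \<sigma> \<longleftrightarrow> \<sigma> permutes UNIV \<and> \<sigma> ` I = K" for K \<sigma>
  define f where "f K = (if \<exists>\<sigma>. P K \<sigma> then \<rho> (SOME \<sigma>. P K \<sigma>) v else 0)" for K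
  have f: "f K = \<rho> \<sigma> v" if \<sigma>: "P K \<sigma>" for K \<sigma>
  proof -
    define \<tau> where "\<tau> = (SOME \<sigma>. P K \<sigma>)"
    have "P K \<tau>" unfolding \<tau>_def using \<sigma> by (rule someI[of "P K"])
    then have \<tau>: "\<tau> permutes UNIV" "\<tau> ` I = K" by (auto simp: P_def)
    have \<sigma>': "\<sigma> permutes UNIV" "\<sigma> ` I = K" using \<sigma> by (auto simp: P_def)
    have "(inv \<tau> \<circ> \<sigma>) ` I = inv \<tau> ` (\<tau> ` I)" unfolding image_comp[symmetric] \<tau> \<sigma>' by (rule refl)
    also have "\<dots> = I" by (simp only: image_comp permutes_inv_o[OF \<tau>(1)] image_id id_apply)
    finally have "\<rho> (inv \<tau> \<circ> \<sigma>) v = v"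
      using \<tau>(1) \<sigma>'(1) by (intro fixed permutes_compose permutes_inv)
    then have "\<rho> (inv \<tau>) (\<rho> \<sigma> v) = v"
      by (simp only: rep_comp[OF permutes_inv[OF \<tau>(1)] \<sigma>'(1) v])
    then have "\<rho> \<tau> v = \<rho> \<sigma> v"
      using rep_inv(2)[OF \<tau>(1) rep_in[OF \<sigma>'(1) v]] by simp
    moreover have "\<exists>\<sigma>. P K \<sigma>" using \<sigma> by blast
    ultimately show ?thesis by (simp add: f_def flip: \<tau>_def)
  qed
  have f0: "f K = 0" if "\<nexists>\<sigma>. P K \<sigma>" for K
    unfolding f_def using that by (rule if_not_P)
  have "P I id" by (simp add: P_def permutes_id)
  then have "f I = v" using f rep_id[OF v] by metis
  moreover have "f K \<in> V" for K
  proof (cases "\<exists>\<sigma>. P K \<sigma>")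
    case True
    then obtain \<sigma> where \<sigma>: "P K \<sigma>" by blast
    then have "\<sigma> permutes UNIV" by (simp add: P_def)
    then show ?thesis unfolding f[OF \<sigma>] by (rule rep_in[OF _ v])
  next
    case False
    then show ?thesis by (simp add: f0 subspace_0 subspace_V)
  qed
  moreover have "f (\<sigma> ` K) = \<rho> \<sigma> (f K)" if \<sigma>: "\<sigma> permutes UNIV" for \<sigma> K
  proof (cases "\<exists>\<tau>. P K \<tau>")
    case True
    then obtain \<tau> where \<tau>: "P K \<tau>" by blast
    then have \<tau>p: "\<tau> permutes UNIV" "\<tau> ` I = K" by (auto simp: P_def)
    have "P (\<sigma> ` K) (\<sigma> \<circ> \<tau>)"
      unfolding P_def image_comp[symmetric] \<tau>p(2) using permutes_compose[OF \<tau>p(1) \<sigma>] by blast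
    then show ?thesis by (simp only: f[OF \<tau>] f rep_comp[OF \<sigma> \<tau>p(1) v])
  next
    case False
    have "\<nexists>\<tau>. P (\<sigma> ` K) \<tau>"
    proof
      assume "\<exists>\<tau>. P (\<sigma> ` K) \<tau>"
      then obtain \<tau> where \<tau>: "\<tau> permutes UNIV" "\<tau> ` I = \<sigma> ` K" by (auto simp: P_def)
      have "(inv \<sigma> \<circ> \<tau>) ` I = inv \<sigma> ` (\<sigma> ` K)" unfolding image_comp[symmetric] \<tau>(2) by (rule refl)
      also have "\<dots> = K" by (simp only: image_comp permutes_inv_o[OF \<sigma>] image_id id_apply)
      finally have "P K (inv \<sigma> \<circ> \<tau>)"
        using \<tau>(1) \<sigma> by (simp only: P_def permutes_compose permutes_inv)
      then show False using False by blast
    qed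
    then show ?thesis using False by (simp add: f0 linear_on_0[OF subspace_V linear_rep[OF \<sigma>]])
  qed
  ultimately show ?thesis by blast
qed

lemma permute_coords_axis:
  assumes "\<sigma> permutes UNIV"
  shows "permute_coords \<sigma> (axis i c) = axis (\<sigma> i) c"
  using assms by (auto simp: vec_eq_iff permute_coords_def axis_apply permutes_inverses)

theorem theorem2p2:
  fixes \<rho> :: "('n::finite \<Rightarrow> 'n) \<Rightarrow> 'v::euclidean_space \<Rightarrow> 'v"
    and V :: "'v set"
    and \<phi> :: "real ^ 'n \<Rightarrow> 'v \<Rightarrow> 'v"
    and S :: "(real ^ 'n) set"
  assumes "symmetric_group_rep \<rho> V"
    and "invariant_inner \<rho> V"
    and "short \<rho> V"
    and "equivariant_linear_Sym2 \<rho> V \<phi>"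
    and "S = {x. psd_on V (\<phi> x)}"
  shows "spectrahedral_cone_in symmetric_matrices (spectral_set S)"
proof -
  interpret orthogonal_rep \<rho> V using assms(1,2) by unfold_locales
  have \<phi>_in: "\<phi> x v \<in> V" if "v \<in> V" for x v
    using assms(4) that by (auto simp: equivariant_linear_Sym2_def Sym2_def)
  have \<phi>_lin: "linear_on V (\<phi> x)" for x
    using assms(4) by (auto simp: equivariant_linear_Sym2_def Sym2_def)
  have \<phi>_equiv: "\<phi> (permute_coords \<sigma> x) (\<rho> \<sigma> v) = \<rho> \<sigma> (\<phi> x v)" if "\<sigma> permutes UNIV" "v \<in> V" for \<sigma> x v
    using assms(4) that rep_in rep_inv(1) by (simp add: equivariant_linear_Sym2_def)
  have \<phi>_expand: "\<phi> x v = (\<Sum>i\<in>UNIV. x $ i *\<^sub>R \<phi> (axis i 1) v)" if "v \<in> V" for x v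
  proof -
    have lin: "linear (\<lambda>x. \<phi> x v)" using assms(4) that by (simp add: equivariant_linear_Sym2_def)
    have "x = (\<Sum>i\<in>UNIV. x $ i *\<^sub>R axis i 1)"
      using basis_expansion[of x] by (simp add: scalar_mult_eq_scaleR)
    then have "\<phi> x v = \<phi> (\<Sum>i\<in>UNIV. x $ i *\<^sub>R axis i 1) v" by simp
    then show ?thesis by (simp add: linear_sum[OF lin] linear_scale[OF lin])
  qed
  have S_inv: "permute_coords \<sigma> x \<in> S \<longleftrightarrow> x \<in> S" if \<sigma>: "\<sigma> permutes UNIV" for \<sigma> x
  proof -
    have q: "\<phi> (permute_coords \<sigma> x) (\<rho> \<sigma> v) \<bullet> \<rho> \<sigma> v = \<phi> x v \<bullet> v" if "v \<in> V" for v
      by (simp add: \<phi>_equiv[OF \<sigma> that] rep_inner[OF \<sigma> \<phi>_in[OF that] that])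
    have "\<phi> (permute_coords \<sigma> x) v \<bullet> v = \<phi> x (\<rho> (inv \<sigma>) v) \<bullet> \<rho> (inv \<sigma>) v" if "v \<in> V" for v
      using q[OF rep_in[OF permutes_inv[OF \<sigma>] that]] by (simp add: rep_inv(2)[OF \<sigma> that])
    then show ?thesis
      unfolding assms(5) psd_on_def mem_Collect_eq
      using q rep_in[OF \<sigma>] rep_in[OF permutes_inv[OF \<sigma>]] by metis
  qed

  \<comment> \<open>A basis of \<open>V\<close> inside \<open>young_fixed\<close>: the orbit maps
    present \<open>V\<close> as a quotient of finitely many copies of the spin space, one for each
    basis vector.\<close>
  obtain B where B: "B \<subseteq> young_fixed" "independent B" "young_fixed \<subseteq> span B"
    using maximal_independent_subset by blast
  have finB: "finite B" using B(2) by (rule independent_imp_finite)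
  have spanB: "span B = V"
    using short_span_young_fixed[OF assms(3)] B span_mono[OF B(1)] span_minimal[OF B(3) subspace_span] by blast
  have "\<forall>b\<in>B. \<exists>f. (\<exists>I. f I = b) \<and> (\<forall>K. f K \<in> V) \<and> (\<forall>\<sigma> K. \<sigma> permutes UNIV \<longrightarrow> f (\<sigma> ` K) = \<rho> \<sigma> (f K))"
    using orbit_map_exists B(1) by blast
  from bchoice[OF this] obtain F where F:
    "\<forall>b\<in>B. (\<exists>I. F b I = b) \<and> (\<forall>K. F b K \<in> V) \<and> (\<forall>\<sigma> K. \<sigma> permutes UNIV \<longrightarrow> F b (\<sigma> ` K) = \<rho> \<sigma> (F b K))"
    by blast
  have "\<forall>b\<in>B. \<exists>I. F b I = b" using F by blast
  from bchoice[OF this] obtain I where I: "\<And>b. b \<in> B \<Longrightarrow> F b (I b) = b" by blast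
  have F_in: "F b K \<in> V" if "b \<in> B" for b K using F that by blast
  have F_equiv: "F b (\<sigma> ` K) = \<rho> \<sigma> (F b K)" if "b \<in> B" "\<sigma> permutes UNIV" for b \<sigma> K using F that by blast

  \<comment> \<open>The coefficients of \<open>\<phi>\<close> pulled back along the orbit maps;
    their invariance combines the equivariance of \<open>\<phi>\<close> and of the orbit maps with
    that of the scalar product.\<close>
  define c where "c b b' i K M = \<phi> (axis i 1) (F b K) \<bullet> F b' M" for b b' i K M
  define \<psi> where "\<psi> b b' = (\<lambda>x u u'. \<Sum>i\<in>UNIV. \<Sum>K\<in>UNIV. \<Sum>M\<in>UNIV. x $ i * c b b' i K M * u $ K * u' $ M)" for b b'
  define g where "g b u = (\<Sum>K\<in>UNIV. u $ K *\<^sub>R F b K)" for b and u :: "real ^ 'n set"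
  have g_in: "g b u \<in> V" if "b \<in> B" for b u
    unfolding g_def using that by (intro subspace_sum subspace_V subspace_scale F_in)
  have \<psi>_g: "\<psi> b b' x u u' = \<phi> x (g b u) \<bullet> g b' u'" if b: "b \<in> B" for b b' x u u'
  proof -
    have "\<phi> x (g b u) = (\<Sum>K\<in>UNIV. \<phi> x (u $ K *\<^sub>R F b K))"
      unfolding g_def by (rule linear_on_sum[OF subspace_V \<phi>_lin]) (simp_all add: subspace_scale subspace_V F_in b)
    also have "\<dots> = (\<Sum>K\<in>UNIV. u $ K *\<^sub>R (\<Sum>i\<in>UNIV. x $ i *\<^sub>R \<phi> (axis i 1) (F b K)))"
      by (intro sum.cong refl) (simp add: linear_on_scale[OF \<phi>_lin F_in[OF b]] \<phi>_expand[OF F_in[OF b], of x])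
    finally have 1: "\<phi> x (g b u) = (\<Sum>K\<in>UNIV. u $ K *\<^sub>R (\<Sum>i\<in>UNIV. x $ i *\<^sub>R \<phi> (axis i 1) (F b K)))" .
    have 2: "y \<bullet> g b' u' = (\<Sum>M\<in>UNIV. u' $ M * (y \<bullet> F b' M))" for y
      by (simp add: g_def inner_sum_right)
    have "\<phi> x (g b u) \<bullet> g b' u' = (\<Sum>K\<in>UNIV. \<Sum>i\<in>UNIV. \<Sum>M\<in>UNIV. x $ i * c b b' i K M * u $ K * u' $ M)"
      unfolding 1 scaleR_sum_right inner_sum_left inner_scaleR_left unfolding 2
      by (simp add: sum_distrib_left c_def mult_ac)
    also have "\<dots> = \<psi> b b' x u u'" unfolding \<psi>_def by (rule sum.swap)
    finally show ?thesis by (rule sym)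
  qed
  have form: "(\<Sum>b\<in>B. \<Sum>b'\<in>B. \<psi> b b' x (u b) (u b')) = \<phi> x (\<Sum>b\<in>B. g b (u b)) \<bullet> (\<Sum>b\<in>B. g b (u b))" for x u
  proof -
    have \<phi>: "\<phi> x (\<Sum>b\<in>B. g b (u b)) = (\<Sum>b\<in>B. \<phi> x (g b (u b)))"
      by (rule linear_on_sum[OF subspace_V \<phi>_lin finB g_in])
    show ?thesis unfolding \<phi> inner_sum_left by (simp add: inner_sum_right \<psi>_g)
  qed
  \<comment> \<open>The maps \<open>g b\<close> together reach all of \<open>V\<close>, so
    positivity may be tested on families of spin vectors.\<close>
  have mem_S: "x \<in> S \<longleftrightarrow> (\<forall>u. 0 \<le> (\<Sum>b\<in>B. \<Sum>b'\<in>B. \<psi> b b' x (u b) (u b')))" for x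
  proof
    assume "x \<in> S"
    moreover have "(\<Sum>b\<in>B. g b (u b)) \<in> V" for u using g_in subspace_V by (intro subspace_sum)
    ultimately show "\<forall>u. 0 \<le> (\<Sum>b\<in>B. \<Sum>b'\<in>B. \<psi> b b' x (u b) (u b'))"
      unfolding form assms(5) psd_on_def by blast
  next
    assume nonneg: "\<forall>u. 0 \<le> (\<Sum>b\<in>B. \<Sum>b'\<in>B. \<psi> b b' x (u b) (u b'))"
    have "0 \<le> \<phi> x v \<bullet> v" if v: "v \<in> V" for v
    proof -
      obtain r where r: "v = (\<Sum>b\<in>B. r b *\<^sub>R b)"
        using v unfolding spanB[symmetric] span_finite[OF finB] by auto
      define u where "u b = r b *\<^sub>R axis (I b) (1 :: real)" for b
      have "g b (u b) = r b *\<^sub>R b" if "b \<in> B" for b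
      proof -
        have "g b (u b) = (\<Sum>K\<in>UNIV. if K = I b then r b *\<^sub>R F b K else 0)"
          unfolding g_def by (intro sum.cong) (auto simp: u_def axis_apply)
        then show ?thesis using I[OF that] by simp
      qed
      then have "v = (\<Sum>b\<in>B. g b (u b))" unfolding r by (intro sum.cong) auto
      then show ?thesis using nonneg[rule_format, of u] unfolding form by simp
    qed
    then show "x \<in> S" unfolding assms(5) psd_on_def by blast
  qed

  have "liftable (\<psi> b b')" if b: "b \<in> B" "b' \<in> B" for b b'
    unfolding \<psi>_def
  proof (rule liftable_invariant)
    fix \<sigma> :: "'n \<Rightarrow> 'n" and i K M assume \<sigma>: "\<sigma> permutes UNIV"
    show "c b b' (\<sigma> i) (\<sigma> ` K) (\<sigma> ` M) = c b b' i K M"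
      unfolding c_def permute_coords_axis[OF \<sigma>, symmetric] F_equiv[OF b(1) \<sigma>] F_equiv[OF b(2) \<sigma>]
        \<phi>_equiv[OF \<sigma> F_in[OF b(1)]]
      by (rule rep_inner[OF \<sigma> \<phi>_in[OF F_in[OF b(1)]] F_in[OF b(2)]])
  qed
  \<comment> \<open>The zero form outside \<open>B\<close> makes multilinearity available for all
    indices, as \<open>spectrahedral_cone_forms\<close> demands.\<close>
  then have "liftable (if b \<in> B \<and> b' \<in> B then \<psi> b b' else (\<lambda>x u u'. 0))" for b b'
    by (simp add: liftable_zero)
  then obtain \<Psi> where \<Psi>': "\<And>b b'. lifts (\<Psi> b b') (if b \<in> B \<and> b' \<in> B then \<psi> b b' else (\<lambda>x u u'. 0))"
    unfolding liftable_def by metis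
  let ?Q = "\<lambda>A \<omega>. \<Sum>b\<in>B. \<Sum>b'\<in>B. \<Psi> b b' A (\<omega> b) (\<omega> b')"
  have \<Psi>: "lifts (\<Psi> b b') (\<psi> b b')" if "b \<in> B" "b' \<in> B" for b b'
    using \<Psi>'[of b b'] that by simp

  have "A \<in> spectral_set S \<longleftrightarrow> (\<forall>\<omega>. 0 \<le> ?Q A \<omega>)" if "transpose A = A" for A
    using that
  proof (induction A rule: symmetric_householder_induct)
    case (reflect A v)
    let ?P = "fock_reflection v"
    have "conj_by (householder v) A \<in> spectral_set S \<longleftrightarrow> A \<in> spectral_set S"
      using reflect(1) transpose_conj_by_householder[OF reflect(1)]
        eigenvalue_vector_conj_by[OF householder_square[OF reflect(2)]]
      by (simp add: spectral_set_def symmetric_matrices_def)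
    moreover have "(\<forall>\<omega>. 0 \<le> ?Q (conj_by (householder v) A) \<omega>) \<longleftrightarrow> (\<forall>\<omega>. 0 \<le> ?Q A \<omega>)"
    proof -
      have Q: "?Q (conj_by (householder v) A) (\<lambda>b. conj_by ?P (\<omega> b)) = ?Q A \<omega>" for \<omega>
        using \<Psi> reflect(2) by (intro sum.cong refl) (simp add: lifts_def)
      have "conj_by ?P (conj_by ?P w) = w" for w
      proof -
        have "conj_by ?P (conj_by ?P w) = (?P ** ?P) ** w ** (?P ** ?P)" by (simp only: matrix_mul_assoc)
        then show ?thesis by (simp add: fock_reflection_square[OF reflect(2)])
      qed
      then have Q': "?Q (conj_by (householder v) A) \<omega> = ?Q A (\<lambda>b. conj_by ?P (\<omega> b))" for \<omega>
        using Q[of "\<lambda>b. conj_by ?P (\<omega> b)"] by simp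
      show ?thesis
      proof (intro iffI allI)
        fix \<omega> assume "\<forall>\<omega>. 0 \<le> ?Q (conj_by (householder v) A) \<omega>"
        then have "0 \<le> ?Q (conj_by (householder v) A) (\<lambda>b. conj_by ?P (\<omega> b))" by (rule allE)
        then show "0 \<le> ?Q A \<omega>" by (simp only: Q)
      next
        fix \<omega> assume "\<forall>\<omega>. 0 \<le> ?Q A \<omega>"
        then have "0 \<le> ?Q A (\<lambda>b. conj_by ?P (\<omega> b))" by (rule allE)
        then show "0 \<le> ?Q (conj_by (householder v) A) \<omega>" by (simp only: Q')
      qed
    qed
    ultimately show ?case using reflect(3) by blast
  next
    case (diag x)
    have to_diag: "?Q (diag x) (\<lambda>b. diag (u b)) = (\<Sum>b\<in>B. \<Sum>b'\<in>B. \<psi> b b' x (u b) (u b'))" for u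
    proof (intro sum.cong refl)
      fix b b' assume "b \<in> B" "b' \<in> B"
      from \<Psi>[OF this] show "\<Psi> b b' (diag x) (diag (u b)) (diag (u b')) = \<psi> b b' x (u b) (u b')"
        unfolding lifts_def by blast
    qed
    \<comment> \<open>The map \<open>to_spin t\<close> is the same for every basis vector, so each
      sector contributes the complete form at a single family of spin vectors.\<close>
    have from_diag: "?Q (diag x) \<omega> = (\<Sum>t\<in>sectors. \<Sum>b\<in>B. \<Sum>b'\<in>B. \<psi> b b' x (to_spin t (\<omega> b)) (to_spin t (\<omega> b')))" for \<omega>
    proof -
      have "?Q (diag x) \<omega> = (\<Sum>b\<in>B. \<Sum>b'\<in>B. \<Sum>t\<in>sectors. \<psi> b b' x (to_spin t (\<omega> b)) (to_spin t (\<omega> b')))"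
      proof (intro sum.cong refl)
        fix b b' assume "b \<in> B" "b' \<in> B"
        from \<Psi>[OF this] show "\<Psi> b b' (diag x) (\<omega> b) (\<omega> b') = (\<Sum>t\<in>sectors. \<psi> b b' x (to_spin t (\<omega> b)) (to_spin t (\<omega> b')))"
          unfolding lifts_def by blast
      qed
      also have "\<dots> = (\<Sum>b\<in>B. \<Sum>t\<in>sectors. \<Sum>b'\<in>B. \<psi> b b' x (to_spin t (\<omega> b)) (to_spin t (\<omega> b')))"
        by (rule sum.cong[OF refl], rule sum.swap)
      also have "\<dots> = (\<Sum>t\<in>sectors. \<Sum>b\<in>B. \<Sum>b'\<in>B. \<psi> b b' x (to_spin t (\<omega> b)) (to_spin t (\<omega> b')))"
        by (rule sum.swap)
      finally show ?thesis .
    qed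
    have "(\<forall>\<omega>. 0 \<le> ?Q (diag x) \<omega>) \<longleftrightarrow> (\<forall>u. 0 \<le> (\<Sum>b\<in>B. \<Sum>b'\<in>B. \<psi> b b' x (u b) (u b')))"
    proof (intro iffI allI)
      fix u assume "\<forall>\<omega>. 0 \<le> ?Q (diag x) \<omega>"
      then have "0 \<le> ?Q (diag x) (\<lambda>b. diag (u b))" by (rule allE)
      then show "0 \<le> (\<Sum>b\<in>B. \<Sum>b'\<in>B. \<psi> b b' x (u b) (u b'))" by (simp only: to_diag)
    next
      fix \<omega> assume nonneg: "\<forall>u. 0 \<le> (\<Sum>b\<in>B. \<Sum>b'\<in>B. \<psi> b b' x (u b) (u b'))"
      show "0 \<le> ?Q (diag x) \<omega>"
        unfolding from_diag by (rule sum_nonneg) (rule nonneg[rule_format])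
    qed
    then show ?case using mem_S[of x] spectral_set_diag[OF S_inv] by blast
  qed
  then have "spectral_set S = {A\<in>symmetric_matrices. \<forall>\<omega>. 0 \<le> ?Q A \<omega>}"
    by (auto simp: spectral_set_def symmetric_matrices_def)
  moreover have "spectrahedral_cone_in symmetric_matrices \<dots>"
    by (rule spectrahedral_cone_forms[OF finB]) (use \<Psi>' in \<open>unfold lifts_def, blast\<close>)+
  ultimately show ?thesis by (simp only:)
qed

end
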